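(* Let $r$ and $n$ be integers with either ($r\ge 5$, $r\ne 6$, $r\ne 10$, $n\ge 3$) or ($r=10$, $n\ge 5$). Let $$\rho_n^{(2,r)}=\bigoplus_{\lambda\in\Lambda_n^{(2,r)}}\rho_\lambda^{(2,r)}:\ B_n\to\prod_{\lambda\in\Lambda_n^{(2,r)}}U(V_\lambda^{(2,r)})$$ be the (unitary) Jones representation of the $n$-strand braid group. Then the closure $\overline{\rho_n^{(2,r)}(B_n)}$ contains $\prod_{\lambda\in\Lambda_n^{(2,r)}}SU(V_\lambda^{(2,r)})$.
   Context: Fix an integer $r\ge 3$ and let $q=e^{2\pi i/r}$ or $q=e^{-2\pi i/r}$, with $q^{1/2}=e^{\pm\pi i/r}$ (same sign) and $q^{m/2}=(q^{1/2})^m$. Quantum integers: $[m]=\frac{q^{m/2}-q^{-m/2}}{q^{1/2}-q^{-1/2}}$, so $[2]=2\cos(\pi/r)$. $B_n$ denotes the braid group with standard generators $\sigma_1,\dots,\sigma_{n-1}$. A Young diagram $\lambda=[\lambda_1,\dots,\lambda_k]$, $\lambda_1\ge\dots\ge\lambda_k\ge 0$ (empty rows allowed), has $n=\sum\lambda_i$ boxes; a standard tableau of shape $\lambda$ is a filling of the boxes by $1,\dots,n$ increasing along rows and columns. For integers $k,r$ with $r\ge k+1$, a diagram $\lambda$ with at most $k$ rows is $(k,r)$-admissible if $\lambda_1-\lambda_k\le r-k$. For a standard tableau $t$ with $n$ boxes, $t^{(i)}$ ($0\le i\le n$) is obtained by deleting the boxes containing $n,n-1,\dots,n-i+1$; $t$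 is $(k,r)$-admissible if the shape of every $t^{(i)}$ is $(k,r)$-admissible. If entries $m,m'$ of $t$ lie in rows $r_1,r_2$ and columns $c_1,c_2$, put $d_{t,m,m'}=(c_1-c_2)-(r_1-r_2)$. For $1\le i\le n-1$ and $d=d_{t,i,i+1}$ put $\alpha_{t,i}=\frac{[d+1]}{[2][d]}$ and $\beta_{t,i}=\sqrt{\alpha_{t,i}(1-\alpha_{t,i})}$. Let $V_\lambda^{(k,r)}$ be the Hilbert space with orthonormal basis $\{v_t\}$, $t$ ranging over $(k,r)$-admissible standard tableaux of shape $\lambda$, and let $s_i(t)$ be $t$ with entries $i,i+1$ swapped. Define $E_i v_t=\alpha_{t,i}v_t+\beta_{t,i}v_{s_i(t)}$ if $s_i(t)$ is a $(k,r)$-admissible standard tableau, and $E_iv_t=\alpha_{t,i}v_t$ otherwise (then $\alpha_{t,i}\in\{0,1\}$). The Jones–Wenzl sector is the unitary representation $\rho_\lambda^{(k,r)}:B_n\to U(V_\lambda^{(k,r)})$, $\sigma_i\mapsto q\,\mathrm{Id}-(1+q)E_i$. $\Lambda_n^{(k,r)}$ is the set of $(k,r)$-admissible Young diagrams with $n$ boxes. $SU(V)$ denotes the special unitary group of a Hilbert space $V$ (trivial if $\dim V=1$). *)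

theory Defs
  imports "HOL-Analysis.Analysis"
begin

text \<open>A Young diagram with at most k rows (empty rows allowed) is a list
  [lam_1,...,lam_k] of length k, non-increasing. Boxes are 0-indexed (row, column).\<close>

definition young_diagram :: "nat \<Rightarrow> nat list \<Rightarrow> bool" where
  "young_diagram k lam \<longleftrightarrow> length lam = k \<and> sorted_wrt (\<ge>) lam"

definition boxes :: "nat list \<Rightarrow> (nat \<times> nat) set" where
  "boxes lam = {(i, j). i < length lam \<and> j < lam ! i}"

definition admissible_diagram :: "nat \<Rightarrow> nat \<Rightarrow> nat list \<Rightarrow> bool" where
  "admissible_diagram k r lam \<longleftrightarrow>
     young_diagram k lam \<and> int (lam ! 0) - int (lam ! (k - 1)) \<le> int r - int k"

text \<open>A tableau is a shape together with a filling of the boxes (0 outside the boxes).\<close>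

type_synonym tableau = "nat list \<times> (nat \<times> nat \<Rightarrow> nat)"

definition standard_tableau :: "nat \<Rightarrow> nat \<Rightarrow> tableau \<Rightarrow> bool" where
  "standard_tableau k n t \<longleftrightarrow>
     (let lam = fst t; f = snd t in
       young_diagram k lam \<and> sum_list lam = n \<and>
       bij_betw f (boxes lam) {1..n} \<and>
       (\<forall>b. b \<notin> boxes lam \<longrightarrow> f b = 0) \<and>
       (\<forall>i j j'. (i, j') \<in> boxes lam \<and> j < j' \<longrightarrow> f (i, j) < f (i, j')) \<and>
       (\<forall>i i' j. (i', j) \<in> boxes lam \<and> i < i' \<longrightarrow> f (i, j) < f (i', j)))"

definition sub_shape :: "tableau \<Rightarrow> nat \<Rightarrow> nat list" where
  "sub_shape t m =
     map (\<lambda>i. card {j. (i, j) \<in> boxes (fst t) \<and> snd t (i, j) \<le> m}) [0..<length (fst t)]"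

definition admissible_tableau :: "nat \<Rightarrow> nat \<Rightarrow> nat \<Rightarrow> tableau \<Rightarrow> bool" where
  "admissible_tableau k r n t \<longleftrightarrow> (\<forall>i\<le>n. admissible_diagram k r (sub_shape t (n - i)))"

definition adm_tableaux :: "nat \<Rightarrow> nat \<Rightarrow> nat \<Rightarrow> tableau set" where
  "adm_tableaux k r n = {t. standard_tableau k n t \<and> admissible_tableau k r n t}"

definition pos :: "tableau \<Rightarrow> nat \<Rightarrow> nat \<times> nat" where
  "pos t m = (THE b. b \<in> boxes (fst t) \<and> snd t b = m)"

definition dist_tab :: "tableau \<Rightarrow> nat \<Rightarrow> nat \<Rightarrow> int" where
  "dist_tab t m m' =
     (int (snd (pos t m)) - int (snd (pos t m'))) - (int (fst (pos t m)) - int (fst (pos t m')))"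

definition swap_tab :: "nat \<Rightarrow> tableau \<Rightarrow> tableau" where
  "swap_tab i t = (fst t, \<lambda>b. if snd t b = i then i + 1 else if snd t b = i + 1 then i else snd t b)"

text \<open>qh plays the role of q^(1/2); q = qh^2.\<close>

definition qint :: "complex \<Rightarrow> int \<Rightarrow> complex" where
  "qint qh m = (qh powi m - qh powi (- m)) / (qh - inverse qh)"

definition alpha :: "complex \<Rightarrow> tableau \<Rightarrow> nat \<Rightarrow> complex" where
  "alpha qh t i = (let d = dist_tab t i (i + 1) in qint qh (d + 1) / (qint qh 2 * qint qh d))"

definition beta :: "complex \<Rightarrow> tableau \<Rightarrow> nat \<Rightarrow> complex" where
  "beta qh t i = csqrt (alpha qh t i * (1 - alpha qh t i))"

text \<open>Operators on the Hilbert space with orthonormal basis indexed by a finite set T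
  are represented by their matrices (functions on T x T, zero outside).
  Entry (a,b) is the coefficient of v_a in the image of v_b.\<close>

type_synonym tmat = "tableau \<times> tableau \<Rightarrow> complex"

definition idm :: "tableau set \<Rightarrow> tmat" where
  "idm T = (\<lambda>(a, b). if a \<in> T \<and> a = b then 1 else 0)"

definition mmult :: "tableau set \<Rightarrow> tmat \<Rightarrow> tmat \<Rightarrow> tmat" where
  "mmult T A B = (\<lambda>(a, c). \<Sum>b\<in>T. A (a, b) * B (b, c))"

definition supported :: "tableau set \<Rightarrow> tmat \<Rightarrow> bool" where
  "supported T A \<longleftrightarrow> (\<forall>a b. (a \<notin> T \<or> b \<notin> T) \<longrightarrow> A (a, b) = 0)"

definition minv :: "tableau set \<Rightarrow> tmat \<Rightarrow> tmat" where
  "minv T A = (SOME B. supported T B \<and> mmult T A B = idm T \<and> mmult T B A = idm T)"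

definition E_mat :: "nat \<Rightarrow> nat \<Rightarrow> nat \<Rightarrow> complex \<Rightarrow> nat \<Rightarrow> tmat" where
  "E_mat k r n qh i = (\<lambda>(a, b).
     if a \<in> adm_tableaux k r n \<and> b \<in> adm_tableaux k r n then
       (if a = b then alpha qh b i else 0) + (if a = swap_tab i b then beta qh b i else 0)
     else 0)"

definition rho_gen :: "nat \<Rightarrow> nat \<Rightarrow> nat \<Rightarrow> complex \<Rightarrow> nat \<Rightarrow> tmat" where
  "rho_gen k r n qh i = (\<lambda>x. qh\<^sup>2 * idm (adm_tableaux k r n) x - (1 + qh\<^sup>2) * E_mat k r n qh i x)"

inductive_set jones_image :: "nat \<Rightarrow> nat \<Rightarrow> nat \<Rightarrow> complex \<Rightarrow> tmat set"
  for k r n qh where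
  one: "idm (adm_tableaux k r n) \<in> jones_image k r n qh"
| gen: "X \<in> jones_image k r n qh \<Longrightarrow> 1 \<le> i \<Longrightarrow> i \<le> n - 1 \<Longrightarrow>
        mmult (adm_tableaux k r n) (rho_gen k r n qh i) X \<in> jones_image k r n qh"
| gen_inv: "X \<in> jones_image k r n qh \<Longrightarrow> 1 \<le> i \<Longrightarrow> i \<le> n - 1 \<Longrightarrow>
        mmult (adm_tableaux k r n) (minv (adm_tableaux k r n) (rho_gen k r n qh i)) X
          \<in> jones_image k r n qh"

definition det_on :: "tableau set \<Rightarrow> tmat \<Rightarrow> complex" where
  "det_on S M = (\<Sum>p | p permutes S. of_int (sign p) * (\<Prod>a\<in>S. M (p a, a)))"

definition unitary_on :: "tableau set \<Rightarrow> tmat \<Rightarrow> bool" where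
  "unitary_on S M \<longleftrightarrow>
     (\<forall>a\<in>S. \<forall>c\<in>S. (\<Sum>b\<in>S. cnj (M (b, a)) * M (b, c)) = (if a = c then 1 else 0))"

definition prod_SU :: "nat \<Rightarrow> nat \<Rightarrow> nat \<Rightarrow> tmat set" where
  "prod_SU k r n = {M. supported (adm_tableaux k r n) M \<and>
     (\<forall>a b. M (a, b) \<noteq> 0 \<longrightarrow> fst a = fst b) \<and>
     (\<forall>lam. let S = {t \<in> adm_tableaux k r n. fst t = lam} in
        unitary_on S M \<and> det_on S M = 1)}"

end

(*
  The proof is an induction on the number of strands that works only with plane rotations: for two
  basis vectors a, b of one sector, let SU(2)_{a,b} act on their plane and fix the other basis vectors.
  By Givens elimination SU of a sector is generated by these groups, so it suffices that the closure G_n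
  of the image contains all of them.

  On three strands, the two generators are complex reflections up to a scalar.  Some power has angle
  less than pi/3 (here r = 6 and r = 10 are excluded); then the roots of successive conjugates come
  together, G_3 is not discrete, a limit gives a one-parameter group, and the conjugates of this group
  give SU(2).  For r = 10 the same argument is applied on four strands to the full twist of the first
  three, which is a complex reflection of order 10 in the sector of shape [3,1].

  For the step, G_{n-1} acts on V_n through V_lambda = V_mu + V_mu', so an element supported on V_mu
  acts in two sectors at once.  The last generator mixes a path through mu with the path through mu'
  that agrees with it otherwise, and it acts by scalars on the remaining paths.  If p moves a to b in
  one sector, but only multiplies by scalars the vectors that Y meets in the other sector, then the
  commutator of p and Y lives in the plane of a, b alone.  This isolates the sector with the most
  balanced shape (the second one if n is even); the other sectors follow one by one, because the part
  in a sector that is already treated can be divided out.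
*)

theory Submission
  imports Defs
begin

section \<open>Unitary operators in coordinates\<close>

text \<open>Since \<open>rot\<close> is the identity off its plane, having every rotation of one
  sector in \<open>G n\<close> shows at once that the sector is full and that it varies
  independently of the others. This is why the induction carries rotations of the total space and
  not images in single sectors. The obstacle at the bottom is the ratio \<open>- cnj q\<close> of
  the two eigenvalues of a generator: for r = 6 and r = 10 it has order 3 and 5, and no nontrivial
  power of it has an angle below pi / 3, the bound under which the roots contract. What can be
  isolated first depends on the last generator. On an even number of strands it is diagonal in
  height 0, so a commutator dies there and survives in height 2. On an odd number it couples the
  words of height 1 that pass through height 1 two steps earlier in pairs, so it is replaced by a
  conjugate of a torus element that avoids the second pair.\<close>

definition mop :: "'i set \<Rightarrow> ('i \<Rightarrow> 'i \<Rightarrow> complex) \<Rightarrow> ('i \<Rightarrow> complex) \<Rightarrow> 'i \<Rightarrow> complex" where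
  "mop T M v i = (if i \<in> T then \<Sum>j\<in>T. M i j * v j else v i)"

definition ket :: "'i \<Rightarrow> 'i \<Rightarrow> complex" where
  "ket a i = (if i = a then 1 else 0)"

definition adj :: "('i \<Rightarrow> 'i \<Rightarrow> complex) \<Rightarrow> 'i \<Rightarrow> 'i \<Rightarrow> complex" where
  "adj M i j = cnj (M j i)"

text \<open>Operators act on all functions and leave the coordinates outside T alone, so that
  composition, \<open>id\<close> and \<open>inv\<close> are those of HOL. Entries of M outside T are
  arbitrary; unitarity is therefore a statement about operators and not about M.\<close>

definition uop :: "'i set \<Rightarrow> (('i \<Rightarrow> complex) \<Rightarrow> 'i \<Rightarrow> complex) set" where
  "uop T = {mop T M |M. mop T M \<circ> mop T (adj M) = id \<and> mop T (adj M) \<circ> mop T M = id}"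

text \<open>The matrix with rows \<open>(x, - cnj y)\<close> and \<open>(y, cnj x)\<close>, for
  |x|^2 + |y|^2 = 1 the general element of SU(2). The normalisation is left to the lemmas.\<close>

definition rot :: "'i \<Rightarrow> 'i \<Rightarrow> complex \<Rightarrow> complex \<Rightarrow> ('i \<Rightarrow> complex) \<Rightarrow> 'i \<Rightarrow> complex" where
  "rot a b x y v = v(a := x * v a - cnj y * v b, b := y * v a + cnj x * v b)"

text \<open>In the plane of \<open>a, b\<close> the operator is the unitary matrix with first column \<open>(x, y)\<close> and determinant \<open>c\<close>;
  it need not be the identity elsewhere.\<close>

definition plan :: "'i \<Rightarrow> 'i \<Rightarrow> (('i \<Rightarrow> complex) \<Rightarrow> 'i \<Rightarrow> complex) \<Rightarrow> complex \<Rightarrow> complex \<Rightarrow> complex \<Rightarrow> bool" where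
  "plan a b f x y c \<longleftrightarrow> (cmod x)\<^sup>2 + (cmod y)\<^sup>2 = 1 \<and> cmod c = 1 \<and>
     (\<forall>v. f v a = x * v a - c * cnj y * v b \<and> f v b = y * v a + c * cnj x * v b)"

text \<open>A condition on a row: the output at w depends on the input at w only. For unitary
  operators the matching statement about the column follows from norms
  (\<open>unit_column\<close>).\<close>

definition scal :: "(('i \<Rightarrow> complex) \<Rightarrow> 'i \<Rightarrow> complex) \<Rightarrow> 'i \<Rightarrow> complex \<Rightarrow> bool" where
  "scal f w d \<longleftrightarrow> cmod d = 1 \<and> (\<forall>v. f v w = d * v w)"

text \<open>The shape kept by the conjugations in \<open>swapper\<close>: a block on the plane of a,
  b, and eigenlines for the indices in C, which a later transport or commutator has to leave in
  place.\<close>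

definition frame :: "'i \<Rightarrow> 'i \<Rightarrow> 'i set \<Rightarrow> (('i \<Rightarrow> complex) \<Rightarrow> 'i \<Rightarrow> complex) \<Rightarrow> bool" where
  "frame a b C f \<longleftrightarrow> (\<exists>x y c. plan a b f x y c) \<and> (\<forall>w\<in>C. \<exists>d. scal f w d)"

definition plG :: "(('i \<Rightarrow> complex) \<Rightarrow> 'i \<Rightarrow> complex) set \<Rightarrow> 'i \<Rightarrow> 'i \<Rightarrow> bool" where
  "plG G a b \<longleftrightarrow> (\<forall>x y. (cmod x)\<^sup>2 + (cmod y)\<^sup>2 = 1 \<longrightarrow> rot a b x y \<in> G)"

lemma unit_cnj: "cmod c = 1 \<Longrightarrow> c * cnj c = 1" "cmod c = 1 \<Longrightarrow> cnj c * c = 1"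
  using complex_norm_square[of c] by (auto simp: mult.commute)

lemma unit_norm_cnj: "(cmod x)\<^sup>2 + (cmod y)\<^sup>2 = 1 \<longleftrightarrow> x * cnj x + y * cnj y = 1"
proof -
  have "x * cnj x + y * cnj y = of_real ((cmod x)\<^sup>2 + (cmod y)\<^sup>2)"
    using complex_norm_square[of x] complex_norm_square[of y] by simp
  then show ?thesis
    by (metis of_real_1 of_real_eq_iff)
qed

lemma mop_ket: "finite T \<Longrightarrow> i \<in> T \<Longrightarrow> j \<in> T \<Longrightarrow> mop T M (ket j) i = M i j"
  by (simp add: mop_def ket_def if_distrib cong: if_cong)

lemma mop_cong:
  assumes "\<And>i j. i \<in> T \<Longrightarrow> j \<in> T \<Longrightarrow> M i j = N i j"
  shows "mop T M = mop T N"
  using assms by (auto simp: fun_eq_iff mop_def intro!: sum.cong)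

lemma mop_comp: "mop T M \<circ> mop T N = mop T (\<lambda>i k. \<Sum>j\<in>T. M i j * N j k)"
proof -
  have "(\<Sum>j\<in>T. M i j * (\<Sum>k\<in>T. N j k * v k)) = (\<Sum>k\<in>T. (\<Sum>j\<in>T. M i j * N j k) * v k)" for i v
    by (simp add: sum_distrib_left sum_distrib_right mult.assoc) (rule sum.swap)
  then show ?thesis by (auto simp: fun_eq_iff mop_def)
qed

lemma mop_one: "finite T \<Longrightarrow> mop T (\<lambda>i j. if i = j then 1 else 0) = id"
  by (auto simp: fun_eq_iff mop_def if_distrib[of "\<lambda>x. x * _"] cong: if_cong)

lemma adj_adj [simp]: "adj (adj M) = M"
  by (simp add: adj_def fun_eq_iff)

lemma adj_mult: "adj (\<lambda>i k. \<Sum>j\<in>T. M i j * N j k) = (\<lambda>i k. \<Sum>j\<in>T. adj N i j * adj M j k)"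
  by (simp add: adj_def fun_eq_iff mult.commute)

lemma uop_id:
  fixes T :: "'i set"
  assumes "finite T" shows "id \<in> uop T"
proof -
  let ?I = "\<lambda>i j :: 'i. if i = j then 1 else (0::complex)"
  have "adj ?I = ?I" by (auto simp: adj_def fun_eq_iff)
  then show ?thesis
    using mop_one[OF assms] unfolding uop_def by (intro CollectI exI[of _ ?I]) simp
qed

lemma uop_comp:
  assumes "f \<in> uop T" "g \<in> uop T" shows "f \<circ> g \<in> uop T"
proof -
  obtain M where M: "f = mop T M" "mop T M \<circ> mop T (adj M) = id" "mop T (adj M) \<circ> mop T M = id"
    using assms(1) by (auto simp: uop_def)
  obtain N where N: "g = mop T N" "mop T N \<circ> mop T (adj N) = id" "mop T (adj N) \<circ> mop T N = id"
    using assms(2) by (auto simp: uop_def)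
  let ?K = "\<lambda>i k. \<Sum>j\<in>T. M i j * N j k"
  have 1: "mop T ?K = mop T M \<circ> mop T N" by (simp add: mop_comp)
  have 2: "mop T (adj ?K) = mop T (adj N) \<circ> mop T (adj M)" by (simp add: mop_comp adj_mult)
  have "mop T ?K \<circ> mop T (adj ?K) = id" "mop T (adj ?K) \<circ> mop T ?K = id"
    unfolding 1 2 using M N by (metis comp_assoc comp_id)+
  moreover have "f \<circ> g = mop T ?K" using M(1) N(1) 1 by simp
  ultimately show ?thesis unfolding uop_def by blast
qed

lemma uop_inv:
  assumes "mop T M \<in> uop T" "finite T"
  shows "bij (mop T M)" "inv (mop T M) = mop T (adj M)" "mop T (adj M) \<in> uop T"
proof -
  obtain N where N: "mop T M = mop T N" "mop T N \<circ> mop T (adj N) = id" "mop T (adj N) \<circ> mop T N = id"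
    using assms(1) by (auto simp: uop_def)
  \<comment> \<open>The witness N of unitarity need not be M, but both have the same entries on
    T.\<close>
  have "M i j = N i j" if "i \<in> T" "j \<in> T" for i j
    using that N(1) mop_ket assms(2) by metis
  then have e: "mop T (adj M) = mop T (adj N)"
    by (intro mop_cong) (auto simp: adj_def)
  show "bij (mop T M)" using N o_bij by metis
  show "inv (mop T M) = mop T (adj M)" using N e
    by (metis inv_unique_comp)
  show "mop T (adj M) \<in> uop T" unfolding uop_def e using N by (auto intro!: exI[of _ "adj N"])
qed

lemma uop_bij:
  assumes "f \<in> uop T" "finite T" shows "bij f" "inv f \<in> uop T"
proof -
  obtain M where "f = mop T M" using assms(1) by (auto simp: uop_def)
  then show "bij f" "inv f \<in> uop T" using assms uop_inv[of T M] by auto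
qed

lemma mop_lin: "mop T M (\<lambda>i. u i + c * w i) = (\<lambda>i. mop T M u i + c * mop T M w i)"
  by (auto simp: mop_def fun_eq_iff sum.distrib sum_distrib_left algebra_simps)

lemma uop_lin: "f \<in> uop T \<Longrightarrow> f (\<lambda>i. u i + c * w i) = (\<lambda>i. f u i + c * f w i)"
  by (auto simp: uop_def mop_lin)

lemma uop_zero: "f \<in> uop T \<Longrightarrow> f (\<lambda>i. 0) = (\<lambda>i. 0)"
  by (auto simp: uop_def mop_def fun_eq_iff)

lemma unitary_entries:
  assumes "mop T M \<in> uop T" "finite T" "i \<in> T" "j \<in> T"
  shows "(\<Sum>k\<in>T. cnj (M k i) * M k j) = (if i = j then 1 else 0)"
proof -
  have "mop T (adj M) \<circ> mop T M = id"
    using uop_inv[OF assms(1,2)] by (metis bij_is_inj inv_o_cancel)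
  then have "(mop T (adj M) \<circ> mop T M) (ket j) i = ket j i" by auto
  then show ?thesis
    unfolding mop_comp mop_ket[OF assms(2,3,4)] by (auto simp: adj_def ket_def)
qed

lemma uop_eq_mop:
  assumes "f \<in> uop T" "finite T"
  shows "f = mop T (\<lambda>i j. f (ket j) i)"
proof -
  obtain M where "f = mop T M" using assms by (auto simp: uop_def)
  then show ?thesis using mop_ket[OF assms(2)] by (metis (no_types, lifting) mop_cong)
qed

lemma column_norm:
  assumes "mop T M \<in> uop T" "finite T" "j \<in> T"
  shows "(\<Sum>k\<in>T. (cmod (M k j))\<^sup>2) = 1"
proof -
  have "of_real (\<Sum>k\<in>T. (cmod (M k j))\<^sup>2) = (\<Sum>k\<in>T. cnj (M k j) * M k j)"
    by (simp only: of_real_sum complex_norm_square mult.commute)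
  also have "\<dots> = of_real 1" using unitary_entries[OF assms(1,2,3,3)] by simp
  finally show ?thesis by (simp only: of_real_eq_iff)
qed

text \<open>The column of a has norm 1 and its entry at b already has modulus 1, so all other
  entries vanish.\<close>

lemma unit_column:
  assumes f: "f \<in> uop T" "finite T" "a \<in> T" "b \<in> T" and s: "\<And>v. f v b = y * v a" "cmod y = 1"
  shows "f (ket a) = (\<lambda>i. y * ket b i)"
proof -
  obtain M where M: "f = mop T M" using f by (auto simp: uop_def)
  have Mi: "f (ket a) i = M i a" if "i \<in> T" for i using that M f mop_ket by metis
  have Mb: "M b a = y" using Mi[of b] s f by (simp add: ket_def)
  have "(\<Sum>k\<in>T. (cmod (M k a))\<^sup>2) = 1"
    using column_norm[of T M a] f M by simp
  then have "(\<Sum>k\<in>T - {b}. (cmod (M k a))\<^sup>2) = 0"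
    using f by (simp add: sum.remove[of T b] Mb s)
  then have 0: "M k a = 0" if "k \<in> T" "k \<noteq> b" for k
    using that f by (subst (asm) sum_nonneg_eq_0_iff) auto
  show ?thesis
  proof
    fix i
    show "f (ket a) i = y * ket b i"
      using Mi[of i] Mb 0[of i] f by (cases "i \<in> T") (auto simp: ket_def M mop_def)
  qed
qed

section \<open>Plane rotations and operators with a two-dimensional block\<close>

lemma rot_as_sum:
  assumes "a \<noteq> b"
  shows "rot a b x y v = (\<lambda>i. (v i + ((x - 1) * v a - cnj y * v b) * ket a i) + (y * v a + (cnj x - 1) * v b) * ket b i)"
  using assms by (auto simp: rot_def ket_def fun_eq_iff algebra_simps)

lemma rot_eq_mop:
  assumes "finite T" "a \<in> T" "b \<in> T" "a \<noteq> b"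
  shows "rot a b x y = mop T (\<lambda>i j. rot a b x y (ket j) i)"
proof (intro ext)
  fix v i
  have *: "(\<Sum>j\<in>T. ket j i * v j) = (if i \<in> T then v i else 0)" for i
    using assms(1) by (auto simp: ket_def if_distrib[of "\<lambda>x. x * _"] cong: if_cong)
  have "(\<Sum>j\<in>T. rot a b x y (ket j) i * v j) =
        (if i = a then x * (\<Sum>j\<in>T. ket j a * v j) - cnj y * (\<Sum>j\<in>T. ket j b * v j)
         else if i = b then y * (\<Sum>j\<in>T. ket j a * v j) + cnj x * (\<Sum>j\<in>T. ket j b * v j)
         else (\<Sum>j\<in>T. ket j i * v j))"
    using assms(4) by (auto simp: rot_def sum_distrib_left sum_subtractf[symmetric] sum.distrib[symmetric]
      algebra_simps intro!: sum.cong)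
  then show "rot a b x y v i = mop T (\<lambda>i j. rot a b x y (ket j) i) v i"
    using assms by (auto simp: mop_def * rot_def)
qed

lemma rot_comp:
  assumes "a \<noteq> b"
  shows "rot a b x y \<circ> rot a b x' y' = rot a b (x * x' - cnj y * y') (y * x' + cnj x * y')"
  using assms by (auto simp: rot_def fun_eq_iff algebra_simps)

lemma rot_1 [simp]: "a \<noteq> b \<Longrightarrow> rot a b 1 0 = id"
  by (auto simp: rot_def fun_eq_iff)

lemma rot_flip: "a \<noteq> b \<Longrightarrow> rot b a x y = rot a b (cnj x) (- cnj y)"
  by (auto simp: rot_def fun_eq_iff algebra_simps)

lemma rot_inverse:
  assumes "a \<noteq> b" "(cmod x)\<^sup>2 + (cmod y)\<^sup>2 = 1"
  shows "rot a b x y \<circ> rot a b (cnj x) (- y) = id" "rot a b (cnj x) (- y) \<circ> rot a b x y = id"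
    "inv (rot a b x y) = rot a b (cnj x) (- y)"
proof -
  have *: "x * cnj x + y * cnj y = 1" using assms(2) unit_norm_cnj by blast
  show 1: "rot a b x y \<circ> rot a b (cnj x) (- y) = id" "rot a b (cnj x) (- y) \<circ> rot a b x y = id"
    using * assms(1) by (simp_all add: rot_comp algebra_simps)
  then show "inv (rot a b x y) = rot a b (cnj x) (- y)"
    by (metis inv_unique_comp)
qed

lemma rot_uop:
  assumes "finite T" "a \<in> T" "b \<in> T" "a \<noteq> b" "(cmod x)\<^sup>2 + (cmod y)\<^sup>2 = 1"
  shows "rot a b x y \<in> uop T"
proof -
  let ?M = "\<lambda>i j. rot a b x y (ket j) i"
  have "adj ?M = (\<lambda>i j. rot a b (cnj x) (- y) (ket j) i)"
    using assms(4) by (auto simp: adj_def rot_def ket_def fun_eq_iff)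
  then have "mop T (adj ?M) = rot a b (cnj x) (- y)"
    using rot_eq_mop[OF assms(1-4), of "cnj x" "- y"] by simp
  then show ?thesis
    unfolding uop_def using rot_eq_mop[OF assms(1-4), of x y] rot_inverse[OF assms(4,5)]
    by (auto intro!: exI[of _ ?M])
qed

lemma plan_rot: "a \<noteq> b \<Longrightarrow> (cmod x)\<^sup>2 + (cmod y)\<^sup>2 = 1 \<Longrightarrow> plan a b (rot a b x y) x y 1"
  by (auto simp: plan_def rot_def)

lemma cmod_mult_unit: "(cmod x)\<^sup>2 + (cmod y)\<^sup>2 = 1 \<Longrightarrow> (cmod x')\<^sup>2 + (cmod y')\<^sup>2 = 1 \<Longrightarrow> cmod c = 1 \<Longrightarrow>
   (cmod (x * x' - c * cnj y * y'))\<^sup>2 + (cmod (y * x' + c * cnj x * y'))\<^sup>2 = 1"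
proof -
  assume "(cmod x)\<^sup>2 + (cmod y)\<^sup>2 = 1" "(cmod x')\<^sup>2 + (cmod y')\<^sup>2 = 1" "cmod c = 1"
  then have h: "x * cnj x + y * cnj y = 1" "x' * cnj x' + y' * cnj y' = 1" "c * cnj c = 1"
    using unit_norm_cnj unit_cnj by auto
  have "(x * x' - c * cnj y * y') * cnj (x * x' - c * cnj y * y') +
        (y * x' + c * cnj x * y') * cnj (y * x' + c * cnj x * y')
      = (x * cnj x + y * cnj y) * (x' * cnj x' + (c * cnj c) * y' * cnj y')"
    by (simp add: algebra_simps)
  also have "\<dots> = 1" using h by simp
  finally show ?thesis using unit_norm_cnj by blast
qed

lemma plan_comp:
  assumes "plan a b f x y c" "plan a b g x' y' c'"
  shows "plan a b (f \<circ> g) (x * x' - c * cnj y * y') (y * x' + c * cnj x * y') (c * c')"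
proof -
  have c: "c * cnj c = 1" using assms unit_cnj by (auto simp: plan_def)
  have 1: "c * c' * cnj (y * x' + c * cnj x * y') = c * cnj y * (c' * cnj x') + x * (c' * cnj y')"
  proof -
    have "c * c' * cnj (y * x' + c * cnj x * y') = c * cnj y * (c' * cnj x') + (c * cnj c) * (x * (c' * cnj y'))"
      by (simp add: algebra_simps)
    then show ?thesis by (simp add: c)
  qed
  have 2: "c * c' * cnj (x * x' - c * cnj y * y') = c * cnj x * (c' * cnj x') - y * (c' * cnj y')"
  proof -
    have "c * c' * cnj (x * x' - c * cnj y * y') = c * cnj x * (c' * cnj x') - (c * cnj c) * (y * (c' * cnj y'))"
      by (simp add: algebra_simps)
    then show ?thesis by (simp add: c)
  qed
  have fg: "f v a = x * v a - c * cnj y * v b" "f v b = y * v a + c * cnj x * v b"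
    "g v a = x' * v a - c' * cnj y' * v b" "g v b = y' * v a + c' * cnj x' * v b" for v
    using assms by (auto simp: plan_def)
  show ?thesis
    using assms cmod_mult_unit[of x y x' y' c]
    unfolding plan_def 1 2 by (simp add: norm_mult fg algebra_simps)
qed

lemma plan_inv:
  assumes "plan a b f x y c" "bij f"
  shows "plan a b (inv f) (cnj x) (- cnj c * y) (cnj c)"
proof -
  have c: "c * cnj c = 1" and n: "x * cnj x + y * cnj y = 1"
    using assms unit_cnj unit_norm_cnj by (auto simp: plan_def)
  have "inv f v a = cnj x * v a - cnj c * cnj (- cnj c * y) * v b \<and>
        inv f v b = (- cnj c * y) * v a + cnj c * cnj (cnj x) * v b" for v
  proof -
    define u where "u = inv f v"
    have v: "v = f u" using assms(2) by (simp add: u_def bij_is_surj surj_f_inv_f)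
    have va: "v a = x * u a - c * cnj y * u b" "v b = y * u a + c * cnj x * u b"
      using assms(1) v by (auto simp: plan_def)
    have "cnj x * v a - cnj c * cnj (- cnj c * y) * v b = u a * (x * cnj x + (c * cnj c) * y * cnj y) + (c * cnj c * c - c) * cnj x * cnj y * u b"
      unfolding va by (simp add: algebra_simps)
    also have "\<dots> = u a" using c n by simp
    finally have 1: "u a = cnj x * v a - cnj c * cnj (- cnj c * y) * v b" by simp
    have "(- cnj c * y) * v a + cnj c * cnj (cnj x) * v b = u b * (c * cnj c) * (x * cnj x + y * cnj y)"
      unfolding va by (simp add: algebra_simps)
    also have "\<dots> = u b" using c n by simp
    finally show ?thesis using 1 u_def by simp
  qed
  then show ?thesis using assms by (auto simp: plan_def norm_mult)
qed

lemma scal_comp: "scal f w d \<Longrightarrow> scal g w e \<Longrightarrow> scal (f \<circ> g) w (d * e)"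
  by (auto simp: scal_def norm_mult)

lemma scal_inv:
  assumes "scal f w d" "bij f" shows "scal (inv f) w (cnj d)"
proof -
  have "inv f v w = cnj d * v w" for v
  proof -
    have "v w = d * inv f v w" using assms by (metis bij_inv_eq_iff scal_def)
    then show ?thesis using assms unit_cnj(2)[of d] by (simp add: scal_def mult.assoc[symmetric])
  qed
  then show ?thesis using assms by (simp add: scal_def)
qed

lemma frame_comp: "frame a b C f \<Longrightarrow> frame a b C g \<Longrightarrow> frame a b C (f \<circ> g)"
  unfolding frame_def using plan_comp scal_comp by metis

lemma frame_inv: "frame a b C f \<Longrightarrow> bij f \<Longrightarrow> frame a b C (inv f)"
  unfolding frame_def using plan_inv scal_inv by metis

lemma cmod_cis_m1: "cmod (cis t - 1) = 2 * \<bar>sin (t / 2)\<bar>"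
proof -
  have "(cmod (cis t - 1))\<^sup>2 = (cos t - 1)\<^sup>2 + (sin t)\<^sup>2" by (simp add: cmod_power2)
  also have "\<dots> = 2 - 2 * cos t" by (simp add: power2_diff sin_squared_eq)
  also have "cos t = 1 - 2 * (sin (t/2))\<^sup>2" using cos_double_sin[of "t/2"] by simp
  finally have "(cmod (cis t - 1))\<^sup>2 = (2 * \<bar>sin (t / 2)\<bar>)\<^sup>2" by (simp add: power_mult_distrib)
  then show ?thesis by (metis abs_ge_zero mult_nonneg_nonneg norm_ge_zero power2_eq_imp_eq zero_le_numeral)
qed

section \<open>Groups of unitary operators\<close>

locale ugroup =
  fixes T :: "'i set" and G :: "(('i \<Rightarrow> complex) \<Rightarrow> 'i \<Rightarrow> complex) set"
  assumes fin: "finite T" and sub: "G \<subseteq> uop T"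
    and id_in: "id \<in> G"
    and comp_in: "\<And>f g. f \<in> G \<Longrightarrow> g \<in> G \<Longrightarrow> f \<circ> g \<in> G"
    and inv_in: "\<And>f. f \<in> G \<Longrightarrow> inv f \<in> G"
begin

lemma bij_in: "f \<in> G \<Longrightarrow> bij f"
  using sub fin uop_bij by blast

lemma inv_cancel: "f \<in> G \<Longrightarrow> inv f \<circ> f = id" "f \<in> G \<Longrightarrow> f \<circ> inv f = id"
  using bij_in by (simp_all add: bij_is_inj, metis bij_is_surj surj_iff)

section \<open>Transport of plane rotations by conjugation\<close>

lemma rot_transport:
  assumes "f \<in> G" "a \<in> T" "w \<in> T" "a' \<in> T" "w' \<in> T" "a \<noteq> w" "a' \<noteq> w'"
    and s: "\<And>v. f v a' = c * v a" "\<And>v. f v w' = c' * v w" "cmod c = 1" "cmod c' = 1"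
  shows "f \<circ> rot a w x y = rot a' w' x (cnj c * c' * y) \<circ> f"
proof
  fix v
  have f: "f \<in> uop T" using assms sub by auto
  have cols: "f (ket a) = (\<lambda>i. c * ket a' i)" "f (ket w) = (\<lambda>i. c' * ket w' i)"
    using unit_column[OF f fin] assms by auto
  have cc: "c * cnj c = 1" "c' * cnj c' = 1" using s unit_cnj by auto
  \<comment> \<open>A rotation is the identity plus a correction in \<open>ket a\<close> and
    \<open>ket w\<close>, so linearity and the two columns of f determine the image.\<close>
  have "f (rot a w x y v) = (\<lambda>i. (f v i + ((x - 1) * v a - cnj y * v w) * (c * ket a' i)) + (y * v a + (cnj x - 1) * v w) * (c' * ket w' i))"
    unfolding rot_as_sum[OF assms(6)] uop_lin[OF f] cols by simp
  moreover have "rot a' w' x (cnj c * c' * y) (f v) =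
     (\<lambda>i. (f v i + ((x - 1) * v a - cnj y * v w) * (c * ket a' i)) + (y * v a + (cnj x - 1) * v w) * (c' * ket w' i))"
  proof -
    have "(x - 1) * (c * v a) - cnj (cnj c * c' * y) * (c' * v w) = (x - 1) * c * v a - (c' * cnj c') * c * cnj y * v w"
      by (simp add: algebra_simps)
    also have "\<dots> = ((x - 1) * v a - cnj y * v w) * c"
      by (simp add: cc algebra_simps)
    finally have 1: "(x - 1) * (c * v a) - cnj (cnj c * c' * y) * (c' * v w) = ((x - 1) * v a - cnj y * v w) * c" .
    have "(cnj c * c' * y) * (c * v a) + (cnj x - 1) * (c' * v w) = (c * cnj c) * c' * y * v a + (cnj x - 1) * c' * v w"
      by (simp add: algebra_simps)
    also have "\<dots> = (y * v a + (cnj x - 1) * v w) * c'"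
      by (simp add: cc algebra_simps)
    finally have 2: "(cnj c * c' * y) * (c * v a) + (cnj x - 1) * (c' * v w) = (y * v a + (cnj x - 1) * v w) * c'" .
    show ?thesis
      unfolding rot_as_sum[OF assms(7)] s(1,2) 1 2 by (simp add: mult.assoc)
  qed
  ultimately show "(f \<circ> rot a w x y) v = (rot a' w' x (cnj c * c' * y) \<circ> f) v" by simp
qed

text \<open>Conjugation only multiplies the second parameter of the rotation by a phase; as all
  parameters are available, the phase is compensated in advance.\<close>

lemma plG_transport:
  assumes "plG G a w" "f \<in> G" "a \<in> T" "w \<in> T" "a' \<in> T" "w' \<in> T" "a \<noteq> w" "a' \<noteq> w'"
    and s: "\<And>v. f v a' = c * v a" "\<And>v. f v w' = c' * v w" "cmod c = 1" "cmod c' = 1"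
  shows "plG G a' w'"
  unfolding plG_def
proof (intro allI impI)
  fix x y assume xy: "(cmod x)\<^sup>2 + (cmod y)\<^sup>2 = 1"
  define y0 where "y0 = c * cnj c' * y"
  have y0: "cnj c * c' * y0 = y"
  proof -
    have "cnj c * c' * y0 = (c * cnj c) * (c' * cnj c') * y" by (simp add: y0_def)
    then show ?thesis using unit_cnj(1)[OF s(3)] unit_cnj(1)[OF s(4)] by simp
  qed
  have "rot a w x y0 \<in> G" using assms(1) xy s unfolding plG_def y0_def
    by (simp add: norm_mult)
  then have "f \<circ> rot a w x y0 \<circ> inv f \<in> G" using assms(2) comp_in inv_in by blast
  also have "f \<circ> rot a w x y0 \<circ> inv f = rot a' w' x y \<circ> (f \<circ> inv f)"
    using rot_transport[OF assms(2-8) s, of x y0] by (simp add: y0 comp_assoc)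
  finally show "rot a' w' x y \<in> G" using inv_cancel assms(2) by simp
qed

lemma plG_sym: "plG G a b \<Longrightarrow> a \<noteq> b \<Longrightarrow> plG G b a"
  unfolding plG_def using rot_flip[of a b] by simp

lemma plG_trans:
  assumes "plG G a b" "plG G b c" "a \<in> T" "b \<in> T" "c \<in> T" "a \<noteq> b" "b \<noteq> c" "a \<noteq> c"
  shows "plG G a c"
proof (rule plG_transport[OF assms(1), of "rot b c 0 1" a c 1 1])
  show "rot b c 0 1 \<in> G" using assms(2) by (simp add: plG_def)
qed (use assms in \<open>auto simp: rot_def\<close>)

text \<open>Conjugating a diagonal element by \<open>p\<close> gives every off-diagonal modulus up to \<open>sin (2 t)\<close> if \<open>p\<close> has \<open>sin t\<close>;
  starting from a small angle of the form \<open>pi / 2 ^ k\<close>, doubling reaches \<open>pi / 2\<close>.\<close>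

lemma swapper:
  assumes ab: "a \<noteq> b"
    and tt: "\<And>\<phi>. \<exists>t\<in>G. frame a b C t \<and> (\<exists>\<tau> c. plan a b t \<tau> 0 c \<and> \<tau> = cis \<phi> * (c * cnj \<tau>))"
    and g: "g \<in> G" "frame a b C g" "plan a b g x y c" "x \<noteq> 0" "y \<noteq> 0"
    and \<rho>: "0 \<le> \<rho>" "\<rho> \<le> 1"
  shows "\<exists>p\<in>G. frame a b C p \<and> (\<exists>x y c. plan a b p x y c \<and> cmod y = \<rho>)"
proof -
  define Q where "Q \<rho> \<longleftrightarrow> (\<exists>p\<in>G. frame a b C p \<and> (\<exists>x y c. plan a b p x y c \<and> cmod y = \<rho>))" for \<rho>
  have conj: "Q \<sigma>" if p: "p \<in> G" "frame a b C p" "plan a b p x y c" and \<sigma>: "0 \<le> \<sigma>" "\<sigma> \<le> 2 * (cmod x * cmod y)"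
    for p x y c \<sigma>
  proof (cases "cmod x * cmod y = 0")
    case True
    then have "\<sigma> = 0" using \<sigma> by linarith
    moreover have "Q 0" unfolding Q_def
    proof (rule bexI[OF _ id_in], intro conjI exI)
      show "plan a b id 1 0 1" by (simp add: plan_def)
      then show "frame a b C id" unfolding frame_def by (auto simp: scal_def intro: exI[of _ 1])
    qed simp
    ultimately show ?thesis by simp
  next
    case False
    define K where "K = cmod x * cmod y"
    have K: "K > 0" using False by (simp add: K_def less_le)
    \<comment> \<open>Conjugation by p produces an off-diagonal entry of modulus
      \<open>K * cmod (cis \<phi> - 1)\<close>, which is \<open>2 * K * sin (\<phi> / 2)\<close>;
      this angle makes it equal to \<sigma>.\<close>
    define \<phi> where "\<phi> = 2 * arcsin (\<sigma> / (2 * K))"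
    have "0 \<le> \<sigma> / (2 * K)" "\<sigma> / (2 * K) \<le> 1" using \<sigma> K by (auto simp: K_def field_simps)
    then have "sin (\<phi> / 2) = \<sigma> / (2 * K)" by (simp add: \<phi>_def)
    then have *: "K * cmod (cis \<phi> - 1) = \<sigma>"
      using K \<sigma> by (simp add: cmod_cis_m1 abs_of_nonneg)
    \<comment> \<open>The eigenvalues of t on the two lines are \<open>\<tau>\<close> and
      \<open>d * cnj \<tau>\<close>; only their ratio \<open>cis \<phi>\<close> enters the
      modulus.\<close>
    obtain t \<tau> d where t: "t \<in> G" "frame a b C t" "plan a b t \<tau> 0 d" "\<tau> = cis \<phi> * (d * cnj \<tau>)"
      using tt by blast
    have u: "cmod d = 1" "cmod \<tau> = 1" "cmod c = 1" "d * cnj d = 1" "c * cnj c = 1"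
      using t(3) p(3) unit_cnj norm_ge_zero[of \<tau>] by (auto simp: plan_def power2_eq_1_iff)
    have pl: "plan a b (p \<circ> t \<circ> inv p) ((x * \<tau>) * cnj x - (c * d) * cnj (y * \<tau>) * (- cnj c * y))
                ((y * \<tau>) * cnj x + (c * d) * cnj (x * \<tau>) * (- cnj c * y)) ((c * d) * cnj c)"
      using plan_comp[OF plan_comp[OF p(3) t(3)] plan_inv[OF p(3) bij_in[OF p(1)]]] by simp
    have "(y * \<tau>) * cnj x + (c * d) * cnj (x * \<tau>) * (- cnj c * y) = y * cnj x * \<tau> - (c * cnj c) * (y * cnj x * (d * cnj \<tau>))"
      by (simp add: algebra_simps)
    also have "\<dots> = y * cnj x * (d * cnj \<tau>) * (cis \<phi> - 1)"
      by (subst t(4)) (simp add: u algebra_simps)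
    finally have "cmod ((y * \<tau>) * cnj x + (c * d) * cnj (x * \<tau>) * (- cnj c * y)) = \<sigma>"
      using * u by (simp add: norm_mult K_def mult.commute)
    moreover have "p \<circ> t \<circ> inv p \<in> G" "frame a b C (p \<circ> t \<circ> inv p)"
      by (intro comp_in inv_in frame_comp frame_inv bij_in p t)+
    ultimately show ?thesis unfolding Q_def using pl by blast
  qed
  have pos: "0 < cmod x * cmod y" using g by simp
  have "(\<lambda>k. pi / 4 * (1 / 2) ^ k) \<longlonglongrightarrow> pi / 4 * 0"
    by (intro tendsto_mult tendsto_const LIMSEQ_power_zero) simp
  moreover have "(\<lambda>k. pi / 4 * (1 / 2) ^ k) = (\<lambda>k. pi / 2 ^ (k + 2))"
    by (simp add: fun_eq_iff power_add power_divide)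
  ultimately have "(\<lambda>k. pi / 2 ^ (k + 2)) \<longlonglongrightarrow> 0" by (simp only: mult_zero_right)
  then have "(\<lambda>k. sin (pi / 2 ^ (k + 2))) \<longlonglongrightarrow> sin 0"
    by (rule tendsto_sin)
  then have "eventually (\<lambda>k. sin (pi / 2 ^ (k + 2)) < 2 * (cmod x * cmod y)) sequentially"
    using order_tendstoD(2)[of _ "sin 0" _ "2 * (cmod x * cmod y)"] pos by simp
  then obtain k where k: "sin (pi / 2 ^ (k + 2)) < 2 * (cmod x * cmod y)"
    by (auto simp: eventually_sequentially)
  have rng: "0 \<le> pi / 2 ^ (k + 2)" "pi / 2 ^ (k + 2) \<le> pi / 4" for k :: nat
    using pi_gt_zero by (auto simp: field_simps)
  have sn: "0 \<le> sin (pi / 2 ^ (k + 2))" for k :: nat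
    using rng[of k] pi_gt_zero by (intro sin_ge_zero) linarith+
  have "Q (sin (pi / 2 ^ (k + 2)))" using conj[OF g(1-3) sn] k by simp
  then have "Q (sin (pi / 4))"
  proof (induction k)
    case 0
    then show ?case by simp
  next
    case (Suc k)
    let ?t = "pi / 2 ^ (Suc k + 2)"
    obtain p x y c where p: "p \<in> G" "frame a b C p" "plan a b p x y c" "cmod y = sin ?t"
      using Suc.prems by (auto simp: Q_def)
    have "(cmod x)\<^sup>2 = (cos ?t)\<^sup>2" using p by (auto simp: plan_def cos_squared_eq)
    moreover have "0 \<le> cos ?t" using rng[of "Suc k"] pi_gt_zero by (intro cos_ge_zero) linarith+
    ultimately have "cmod x = cos ?t" by (metis norm_ge_zero power2_eq_imp_eq)
    then have "2 * (cmod x * cmod y) = sin (pi / 2 ^ (k + 2))"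
      using sin_double[of ?t] p(4) by simp
    then show ?case using conj[OF p(1-3) sn[of k]] Suc.IH by simp
  qed
  then obtain p x y c where p: "p \<in> G" "frame a b C p" "plan a b p x y c" "cmod y = sin (pi / 4)"
    by (auto simp: Q_def)
  \<comment> \<open>At pi / 4 both moduli are the square root of 1 / 2, so one more conjugation
    reaches every modulus up to 1.\<close>
  have "(cmod y)\<^sup>2 = 1 / 2" unfolding p(4) sin_45 power_divide by simp
  moreover have "(cmod x)\<^sup>2 + (cmod y)\<^sup>2 = 1" using p(3) by (simp add: plan_def)
  ultimately have "(cmod x)\<^sup>2 = (cmod y)\<^sup>2" by linarith
  then have "cmod x = cmod y" by (metis norm_ge_zero power2_eq_imp_eq)
  then have "2 * (cmod x * cmod y) = 1" using \<open>(cmod y)\<^sup>2 = 1 / 2\<close> by (simp add: power2_eq_square)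
  then show ?thesis using conj[OF p(1-3) \<rho>(1)] \<rho>(2) unfolding Q_def by simp
qed

lemma plan_swap:
  assumes "plan a b p x y c" "cmod y = 1"
  shows "\<And>v. p v b = y * v a"
proof -
  have "x = 0" using assms by (auto simp: plan_def)
  then show "p v b = y * v a" for v using assms by (auto simp: plan_def)
qed

text \<open>The torus of the plane a, w turns a against b and scales w. Together with g it feeds
  \<open>swapper\<close>, whose p carries the line of a to that of b and keeps the line of w;
  transport by p turns the plane a, w into b, w.\<close>

lemma plG_bridge:
  assumes "plG G a w" "g \<in> G" "plan a b g x y c" "x \<noteq> 0" "y \<noteq> 0" "scal g w d"
    and "a \<in> T" "b \<in> T" "w \<in> T" "a \<noteq> b" "a \<noteq> w" "b \<noteq> w"
  shows "plG G b w"
proof -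
  have "\<exists>p\<in>G. frame a b {w} p \<and> (\<exists>x y c. plan a b p x y c \<and> cmod y = 1)"
  proof (rule swapper[OF assms(10) _ assms(2) _ assms(3-5)])
    fix \<phi>
    let ?t = "rot a w (cis \<phi>) 0"
    have "plan a b ?t (cis \<phi>) 0 (cis \<phi>)" "scal ?t w (cnj (cis \<phi>))"
      using assms(10-12) by (auto simp: plan_def rot_def scal_def unit_cnj)
    moreover have "?t \<in> G" using assms(1) by (simp add: plG_def)
    ultimately show "\<exists>t\<in>G. frame a b {w} t \<and> (\<exists>\<tau> c. plan a b t \<tau> 0 c \<and> \<tau> = cis \<phi> * (c * cnj \<tau>))"
      by (intro bexI[of _ ?t] conjI exI[of _ "cis \<phi>"]) (auto simp: frame_def unit_cnj)
  qed (use assms in \<open>auto simp: frame_def\<close>)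
  then obtain p x y c d where p: "p \<in> G" "plan a b p x y c" "cmod y = 1" "scal p w d"
    by (auto simp: frame_def)
  show ?thesis
    by (rule plG_transport[OF assms(1) p(1), of b w y d])
      (use assms p plan_swap[OF p(2,3)] in \<open>auto simp: scal_def\<close>)
qed

section \<open>Conjugation inside a plane and generation of its SU(2)\<close>

lemma plan_columns:
  assumes "f \<in> G" "plan a b f x y c" "a \<in> T" "b \<in> T" "a \<noteq> b"
  shows "f (ket a) = (\<lambda>i. x * ket a i + y * ket b i)"
    "f (ket b) = (\<lambda>i. - c * cnj y * ket a i + c * cnj x * ket b i)"
proof -
  obtain M where M: "f = mop T M" using assms sub by (auto simp: uop_def)
  have Me: "f (ket j) i = M i j" if "i \<in> T" "j \<in> T" for i j using that M mop_ket[OF fin] by simp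
  have e: "f (ket a) a = x" "f (ket a) b = y" "f (ket b) a = - c * cnj y" "f (ket b) b = c * cnj x"
    using assms(2,5) by (auto simp: plan_def ket_def)
  have z: "f (ket j) i = 0" if i: "i \<noteq> a" "i \<noteq> b" and j: "j = a \<or> j = b" for i j
  proof (cases "i \<in> T")
    case False
    then show ?thesis using i j by (auto simp: M mop_def ket_def)
  next
    case True
    have jT: "j \<in> T" using j assms by auto
    have s: "(\<Sum>k\<in>T. (cmod (M k j))\<^sup>2) = 1"
      using column_norm[of T M j] assms(1) sub M fin jT by auto
    have xy: "(cmod x)\<^sup>2 + (cmod y)\<^sup>2 = 1" "cmod c = 1" using assms by (auto simp: plan_def)
    \<comment> \<open>Two entries already exhaust the norm of the column.\<close>
    have "(cmod (M a j))\<^sup>2 + (cmod (M b j))\<^sup>2 = 1"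
      using j xy e Me[of a a] Me[of a b] Me[of b a] Me[of b b] assms(3,4)
      by (auto simp: norm_mult)
    then have "(\<Sum>k\<in>T - {a} - {b}. (cmod (M k j))\<^sup>2) = 0"
      using s fin assms(3-5) by (simp add: sum.remove[of T a] sum.remove[of "T - {a}" b])
    then have "M i j = 0" using True i fin by (subst (asm) sum_nonneg_eq_0_iff) auto
    then show ?thesis using Me[OF True jT] by simp
  qed
  show "f (ket a) = (\<lambda>i. x * ket a i + y * ket b i)"
    "f (ket b) = (\<lambda>i. - c * cnj y * ket a i + c * cnj x * ket b i)"
    using e z assms(5) by (auto simp: fun_eq_iff ket_def)
qed

text \<open>The rotation is the identity off the plane, so whatever f does there cancels and only
  the block of f enters. The determinant c cancels as well, and the conjugate is again in
  SU(2).\<close>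

lemma rot_conj:
  assumes "f \<in> G" "plan a b f x y c" "a \<in> T" "b \<in> T" "a \<noteq> b"
  shows "f \<circ> rot a b p 0 \<circ> inv f = rot a b (x * cnj x * p + y * cnj y * cnj p) (y * cnj x * (p - cnj p))"
proof -
  have f: "f \<in> uop T" using assms sub by auto
  have n: "x * cnj x + y * cnj y = 1" using assms unit_norm_cnj by (auto simp: plan_def)
  have fv: "f v a = x * v a - c * cnj y * v b" "f v b = y * v a + c * cnj x * v b" for v
    using assms(2) by (auto simp: plan_def)
  have "f (rot a b p 0 v) = rot a b (x * cnj x * p + y * cnj y * cnj p) (y * cnj x * (p - cnj p)) (f v)" for v
  proof
    fix i
    have lhs: "f (rot a b p 0 v) i = f v i + (p - 1) * v a * (x * ket a i + y * ket b i)
        + (cnj p - 1) * v b * (- c * cnj y * ket a i + c * cnj x * ket b i)"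
      unfolding rot_as_sum[OF assms(5)] uop_lin[OF f] plan_columns[OF assms] by simp
    have "f v a + (p - 1) * v a * x + (cnj p - 1) * v b * (- c * cnj y) = p * x * v a - cnj p * c * cnj y * v b"
      by (simp add: fv algebra_simps)
    also have "\<dots> = p * x * v a * (x * cnj x + y * cnj y) - cnj p * c * cnj y * v b * (x * cnj x + y * cnj y)"
      by (simp add: n)
    also have "\<dots> = (x * cnj x * p + y * cnj y * cnj p) * f v a - cnj (y * cnj x * (p - cnj p)) * f v b"
      by (simp add: fv algebra_simps)
    finally have 1: "f v a + (p - 1) * v a * x + (cnj p - 1) * v b * (- c * cnj y) = \<dots>" .
    have "f v b + (p - 1) * v a * y + (cnj p - 1) * v b * (c * cnj x) = p * y * v a + cnj p * c * cnj x * v b"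
      by (simp add: fv algebra_simps)
    also have "\<dots> = p * y * v a * (x * cnj x + y * cnj y) + cnj p * c * cnj x * v b * (x * cnj x + y * cnj y)"
      by (simp add: n)
    also have "\<dots> = (y * cnj x * (p - cnj p)) * f v a + cnj (x * cnj x * p + y * cnj y * cnj p) * f v b"
      by (simp add: fv algebra_simps)
    finally have 2: "f v b + (p - 1) * v a * y + (cnj p - 1) * v b * (c * cnj x) = \<dots>" .
    show "f (rot a b p 0 v) i = rot a b (x * cnj x * p + y * cnj y * cnj p) (y * cnj x * (p - cnj p)) (f v) i"
      unfolding lhs rot_def[of a b _ _ "f v"] using 1 2 assms(5) by (auto simp: ket_def)
  qed
  then have e: "f \<circ> rot a b p 0 = rot a b (x * cnj x * p + y * cnj y * cnj p) (y * cnj x * (p - cnj p)) \<circ> f"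
    by (auto simp: fun_eq_iff)
  show ?thesis unfolding e using inv_cancel(2)[OF assms(1)] by (simp add: comp_assoc)
qed

text \<open>Euler angles for SU(2): up to torus factors on both sides an element is determined by
  the modulus of its off-diagonal entry, and \<open>swapper\<close> provides every modulus.\<close>

lemma plG_from_torus:
  assumes tor: "\<And>\<theta>. rot a b (cis \<theta>) 0 \<in> G"
    and g: "rot a b X Y \<in> G" "X \<noteq> 0" "Y \<noteq> 0" "(cmod X)\<^sup>2 + (cmod Y)\<^sup>2 = 1"
    and ab: "a \<in> T" "b \<in> T" "a \<noteq> b"
  shows "plG G a b"
proof -
  \<comment> \<open>Inside the subgroup of pure rotations the operator supplied by
    \<open>swapper\<close> is itself some \<open>rot a b x2 y2\<close>.\<close>
  define G' where "G' = {f \<in> G. \<exists>x y. (cmod x)\<^sup>2 + (cmod y)\<^sup>2 = 1 \<and> f = rot a b x y}"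
  have G'G: "G' \<subseteq> G" by (auto simp: G'_def)
  interpret G': ugroup T G'
  proof
    show "finite T" by (rule fin)
    show "G' \<subseteq> uop T" using sub by (auto simp: G'_def)
    show "id \<in> G'" unfolding G'_def using id_in rot_1[OF ab(3)]
      by (intro CollectI conjI exI[of _ 1] exI[of _ 0]) auto
    show "f \<circ> g \<in> G'" if fg: "f \<in> G'" "g \<in> G'" for f g
    proof -
      obtain x y x' y' where h: "f = rot a b x y" "(cmod x)\<^sup>2 + (cmod y)\<^sup>2 = 1"
         "g = rot a b x' y'" "(cmod x')\<^sup>2 + (cmod y')\<^sup>2 = 1"
        using fg by (auto simp: G'_def)
      have "(cmod (x * x' - cnj y * y'))\<^sup>2 + (cmod (y * x' + cnj x * y'))\<^sup>2 = 1"
        using cmod_mult_unit[OF h(2,4), of 1] by simp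
      then show ?thesis
        using comp_in[of f g] fg h rot_comp[OF ab(3)] unfolding G'_def by auto
    qed
    show "inv f \<in> G'" if f: "f \<in> G'" for f
    proof -
      obtain x y where h: "f = rot a b x y" "(cmod x)\<^sup>2 + (cmod y)\<^sup>2 = 1"
        using f by (auto simp: G'_def)
      show ?thesis
        using inv_in[of f] f h rot_inverse(3)[OF ab(3) h(2)] unfolding G'_def
        by (intro CollectI conjI exI[of _ "cnj x"] exI[of _ "- y"]) auto
    qed
  qed
  show ?thesis unfolding plG_def
  proof (intro allI impI)
    fix x y assume xy: "(cmod x)\<^sup>2 + (cmod y)\<^sup>2 = 1"
    define \<rho> where "\<rho> = cmod y"
    have "\<exists>p\<in>G'. frame a b {} p \<and> (\<exists>x y c. plan a b p x y c \<and> cmod y = \<rho>)"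
    proof (rule G'.swapper[OF ab(3) _ _ _ plan_rot[OF ab(3) g(4)] g(2,3)])
      show "rot a b X Y \<in> G'" using g by (auto simp: G'_def)
      show "frame a b {} (rot a b X Y)" using plan_rot[OF ab(3) g(4)] by (auto simp: frame_def)
      have "(cmod y)\<^sup>2 \<le> 1\<^sup>2" using xy zero_le_power2[of "cmod x"] unfolding one_power2 by linarith
      then show "\<rho> \<le> 1" using power2_le_imp_le[of "cmod y" 1] by (simp add: \<rho>_def)
      show "0 \<le> \<rho>" by (simp add: \<rho>_def)
      fix \<phi> :: real
      \<comment> \<open>The eigenvalues are \<open>cis (\<phi> / 2)\<close> and its conjugate, so
        half the angle gives the ratio \<open>cis \<phi>\<close>.\<close>
      have p: "plan a b (rot a b (cis (\<phi> / 2)) 0) (cis (\<phi> / 2)) 0 1" using plan_rot[OF ab(3), of "cis (\<phi>/2)" 0] by simp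
      have "rot a b (cis (\<phi> / 2)) 0 \<in> G'" using tor[of "\<phi> / 2"] unfolding G'_def
        by (intro CollectI conjI exI[of _ "cis (\<phi> / 2)"] exI[of _ 0]) auto
      then show "\<exists>t\<in>G'. frame a b {} t \<and> (\<exists>\<tau> c. plan a b t \<tau> 0 c \<and> \<tau> = cis \<phi> * (c * cnj \<tau>))"
        using p by (intro bexI[of _ "rot a b (cis (\<phi> / 2)) 0"] conjI exI[of _ "cis (\<phi> / 2)"] exI[of _ 1])
          (auto simp: frame_def cis_cnj cis_mult)
    qed
    then obtain p x1 y1 c1 where p: "p \<in> G'" "plan a b p x1 y1 c1" "cmod y1 = cmod y"
      by (auto simp: \<rho>_def)
    obtain x2 y2 where p2: "p = rot a b x2 y2" "p \<in> G" using p by (auto simp: G'_def)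
    have "p (ket a) b = y1" "p (ket a) a = x1" using p(2) ab(3) by (simp_all add: plan_def ket_def)
    moreover have "p (ket a) b = y2" "p (ket a) a = x2" using ab(3) by (simp_all add: p2(1) rot_def ket_def)
    ultimately have xy1: "x1 = x2" "y1 = y2" by auto
    have "(cmod x1)\<^sup>2 + (cmod y1)\<^sup>2 = 1" using p(2) by (simp add: plan_def)
    then have "(cmod x2)\<^sup>2 = (cmod x)\<^sup>2" using xy unfolding p(3) xy1(1) by linarith
    then have cx: "cmod x2 = cmod x" by (metis norm_ge_zero power2_eq_imp_eq)
    have cy: "cmod y2 = cmod y" using p xy1 by simp
    have ph: "\<exists>\<alpha>. z = cis \<alpha> * z'" if "cmod z' = cmod z" for z z' :: complex
    proof -
      have "z = of_real (cmod z) * cis (Arg z)" "z' = of_real (cmod z') * cis (Arg z')"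
        using rcis_cmod_Arg[of z] rcis_cmod_Arg[of z'] by (simp_all add: rcis_def)
      moreover have "cis (Arg z - Arg z') * (of_real (cmod z') * cis (Arg z')) = of_real (cmod z') * cis (Arg z)"
        by (simp add: cis_mult mult.left_commute)
      ultimately have "z = cis (Arg z - Arg z') * z'" using that by metis
      then show ?thesis by blast
    qed
    obtain \<alpha> where \<alpha>: "x = cis \<alpha> * x2" using ph cx by blast
    obtain \<beta> where \<beta>: "y = cis \<beta> * y2" using ph cy by blast
    \<comment> \<open>A left torus factor u and a right one w multiply the two parameters by
      \<open>u * w\<close> and \<open>cnj u * w\<close>; the angles solve for the phases \<alpha>
      and \<beta>.\<close>
    have "rot a b (cis ((\<alpha> - \<beta>) / 2)) 0 \<circ> rot a b x2 y2 \<circ> rot a b (cis ((\<alpha> + \<beta>) / 2)) 0 \<in> G"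
      using tor p2 comp_in by auto
    moreover have "rot a b (cis ((\<alpha> - \<beta>) / 2)) 0 \<circ> rot a b x2 y2 \<circ> rot a b (cis ((\<alpha> + \<beta>) / 2)) 0 = rot a b x y"
    proof -
      have "cis ((\<alpha> - \<beta>) / 2) * cis ((\<alpha> + \<beta>) / 2) = cis \<alpha>"
           "cnj (cis ((\<alpha> - \<beta>) / 2)) * cis ((\<alpha> + \<beta>) / 2) = cis \<beta>"
        by (simp_all add: cis_mult cis_cnj field_simps)
      then show ?thesis unfolding rot_comp[OF ab(3)] \<alpha> \<beta>
        by (simp add: mult.assoc mult.commute mult.left_commute)
    qed
    ultimately show "rot a b x y \<in> G" by simp
  qed
qed

text \<open>An operator g with a nontrivial block need not be a rotation, but by
  \<open>rot_conj\<close> the conjugate by g of a torus element is one, which reduces the claim to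
  \<open>plG_from_torus\<close>.\<close>

lemma plG_from_torus_conj:
  assumes tor: "\<And>\<theta>. rot a b (cis \<theta>) 0 \<in> G"
    and g: "g \<in> G" "plan a b g x y c" "x \<noteq> 0" "y \<noteq> 0"
    and ab: "a \<in> T" "b \<in> T" "a \<noteq> b"
  shows "plG G a b"
proof -
  \<comment> \<open>Any angle with nonzero sine and cosine would do: the real part of X is its
    cosine, and Y contains its sine as a factor.\<close>
  define z where "z = cis (pi / 4)"
  have z: "z = Complex (sqrt 2 / 2) (sqrt 2 / 2)"
    by (simp add: z_def complex_eq_iff cos_45 sin_45)
  define X Y where "X = x * cnj x * z + y * cnj y * cnj z" and "Y = y * cnj x * (z - cnj z)"
  have n: "x * cnj x + y * cnj y = 1" using g(2) unit_norm_cnj by (auto simp: plan_def)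
  have X0: "X \<noteq> 0"
  proof
    assume "X = 0"
    then have "Re X = 0" by simp
    moreover have "Re X = Re (x * cnj x + y * cnj y) * (sqrt 2 / 2)"
      by (simp add: X_def z algebra_simps)
    ultimately show False using n by simp
  qed
  have "z - cnj z \<noteq> 0" by (simp add: z complex_eq_iff)
  then have Y0: "Y \<noteq> 0" using g(3,4) unfolding Y_def by simp
  have R: "rot a b X Y \<in> G"
    using rot_conj[OF g(1,2) ab(1,2), of z] ab comp_in[OF comp_in[OF g(1) tor[of "pi/4"]] inv_in[OF g(1)]]
    by (simp add: X_def Y_def z_def)
  have cz: "z * cnj z = 1" by (simp add: z_def unit_cnj)
  have "X * cnj X + Y * cnj Y = (x * cnj x + y * cnj y)\<^sup>2 * (z * cnj z)"
    by (simp add: X_def Y_def algebra_simps power2_eq_square)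
  then have "(cmod X)\<^sup>2 + (cmod Y)\<^sup>2 = 1" using n cz unit_norm_cnj by simp
  then show ?thesis using plG_from_torus[OF tor R X0 Y0 _ ab(1,2)] ab by simp
qed

text \<open>If \<open>p\<close> carries the line of \<open>a\<close> to that of \<open>b\<close> and preserves the other three coordinate lines,
  the commutator of \<open>p\<close> with \<open>Y\<close> cancels everything outside the plane of \<open>a, b\<close>.\<close>

lemma isolate_plane:
  assumes Y: "\<And>\<theta>. rot a e (cis \<theta>) 0 \<circ> rot u u' (cis \<theta>) 0 \<in> G"
    and tt: "\<And>\<phi>. \<exists>t\<in>G. frame a b {e, u, u'} t \<and> (\<exists>\<tau> c. plan a b t \<tau> 0 c \<and> \<tau> = cis \<phi> * (c * cnj \<tau>))"
    and g: "g \<in> G" "frame a b {e, u, u'} g" "plan a b g x y c" "x \<noteq> 0" "y \<noteq> 0"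
    and T: "a \<in> T" "b \<in> T" "e \<in> T" "u \<in> T" "u' \<in> T" and d: "distinct [a, b, e, u, u']"
  shows "plG G a b"
proof -
  have "\<exists>p\<in>G. frame a b {e, u, u'} p \<and> (\<exists>x y c. plan a b p x y c \<and> cmod y = 1)"
    by (rule swapper[OF _ tt g]) (use d in auto)
  then obtain p x1 y1 c1 de du du' where p: "p \<in> G" "plan a b p x1 y1 c1" "cmod y1 = 1"
    "scal p e de" "scal p u du" "scal p u' du'" by (auto simp: frame_def)
  \<comment> \<open>Conjugation by p changes the factor at a, e of Y into one at b, e and leaves the
    factor at u, u' alone; against the inverse of Y the entries at e, u and u' cancel.\<close>
  have tor: "rot b a (cis \<theta>) 0 \<in> G" for \<theta>
  proof -
    let ?A = "rot a e (cis \<theta>) 0" and ?U = "rot u u' (cis \<theta>) 0" and ?B = "rot b e (cis \<theta>) 0"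
    have A: "p \<circ> ?A = ?B \<circ> p"
      using rot_transport[OF p(1), of a e b e y1 de "cis \<theta>" 0] p plan_swap[OF p(2,3)] T d
      by (auto simp: scal_def)
    have U: "p \<circ> ?U = ?U \<circ> p"
      using rot_transport[OF p(1), of u u' u u' du du' "cis \<theta>" 0] p T d
      by (auto simp: scal_def)
    have "p \<circ> (?A \<circ> ?U) \<circ> inv p = ?B \<circ> ?U \<circ> (p \<circ> inv p)"
      by (metis A U comp_assoc)
    then have 1: "?B \<circ> ?U \<in> G"
      using comp_in[OF comp_in[OF p(1) Y[of \<theta>]] inv_in[OF p(1)]] inv_cancel(2)[OF p(1)] by simp
    have "(?B \<circ> ?U) \<circ> (rot a e (cis (- \<theta>)) 0 \<circ> rot u u' (cis (- \<theta>)) 0) \<in> G"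
      using comp_in[OF 1 Y] .
    moreover have "(?B \<circ> ?U) \<circ> (rot a e (cis (- \<theta>)) 0 \<circ> rot u u' (cis (- \<theta>)) 0) = rot b a (cis \<theta>) 0"
    proof -
      have "cis \<theta> * (cis (- \<theta>) * z) = z" "cis (- \<theta>) * (cis \<theta> * z) = z" for z
        by (simp_all add: cis_mult mult.assoc[symmetric])
      moreover have "a \<noteq> b" "a \<noteq> e" "a \<noteq> u" "a \<noteq> u'" "b \<noteq> a" "b \<noteq> e" "b \<noteq> u" "b \<noteq> u'"
        "e \<noteq> a" "e \<noteq> b" "e \<noteq> u" "e \<noteq> u'" "u \<noteq> a" "u \<noteq> b" "u \<noteq> e" "u \<noteq> u'"
        "u' \<noteq> a" "u' \<noteq> b" "u' \<noteq> e" "u' \<noteq> u"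
        using d by auto
      ultimately show ?thesis by (simp add: rot_def fun_eq_iff cis_cnj)
    qed
    ultimately show ?thesis by simp
  qed
  have tor': "rot a b (cis \<theta>) 0 \<in> G" for \<theta>
    using tor[of "- \<theta>"] rot_flip[of a b] d by (auto simp: cis_cnj)
  show ?thesis using plG_from_torus_conj[OF tor' g(1,3-5)] T d by auto
qed

end

section \<open>Closed groups\<close>

text \<open>When the pair has norm 1, this is the complex reflection with root (\<alpha>, \<beta>)
  and eigenvalue \<omega>: it multiplies the root by \<omega> and fixes the orthogonal
  complement.\<close>

definition creflect :: "'i \<Rightarrow> 'i \<Rightarrow> complex \<Rightarrow> complex \<Rightarrow> complex \<Rightarrow> ('i \<Rightarrow> complex) \<Rightarrow> 'i \<Rightarrow> complex" where
  "creflect a b \<omega> \<alpha> \<beta> v = v(a := v a + (\<omega> - 1) * (cnj \<alpha> * v a + cnj \<beta> * v b) * \<alpha>,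
                          b := v b + (\<omega> - 1) * (cnj \<alpha> * v a + cnj \<beta> * v b) * \<beta>)"

definition diag_op :: "('i \<Rightarrow> complex) \<Rightarrow> ('i \<Rightarrow> complex) \<Rightarrow> 'i \<Rightarrow> complex" where
  "diag_op d v = (\<lambda>i. d i * v i)"

lemma diag_op_creflect: "d a = d b \<Longrightarrow> diag_op d \<circ> creflect a b \<omega> \<alpha> \<beta> = creflect a b \<omega> \<alpha> \<beta> \<circ> diag_op d"
  by (auto simp: diag_op_def creflect_def fun_eq_iff algebra_simps)

lemma creflect_plan:
  assumes "cmod \<omega> = 1" "(cmod \<alpha>)\<^sup>2 + (cmod \<beta>)\<^sup>2 = 1" "a \<noteq> b"
  shows "plan a b (creflect a b \<omega> \<alpha> \<beta>) (1 + (\<omega> - 1) * (\<alpha> * cnj \<alpha>)) ((\<omega> - 1) * (\<beta> * cnj \<alpha>)) \<omega>"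
proof -
  have w: "\<omega> * cnj \<omega> = 1" and n: "\<alpha> * cnj \<alpha> = 1 - \<beta> * cnj \<beta>"
    using assms unit_cnj unit_norm_cnj[of \<alpha> \<beta>] by (auto simp: algebra_simps)
  let ?x = "1 + (\<omega> - 1) * (\<alpha> * cnj \<alpha>)" and ?y = "(\<omega> - 1) * (\<beta> * cnj \<alpha>)"
  have y: "\<omega> * cnj ?y = - (\<omega> - 1) * (\<alpha> * cnj \<beta>)"
  proof -
    have "\<omega> * cnj ?y = (\<omega> * cnj \<omega> - \<omega>) * (\<alpha> * cnj \<beta>)" by (simp add: algebra_simps)
    then show ?thesis by (simp add: w)
  qed
  have x: "\<omega> * cnj ?x = 1 + (\<omega> - 1) * (\<beta> * cnj \<beta>)"
  proof -
    have "\<omega> * cnj ?x = \<omega> + (\<omega> * cnj \<omega> - \<omega>) * (\<alpha> * cnj \<alpha>)" by (simp add: algebra_simps)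
    then show ?thesis unfolding w n by (simp add: algebra_simps)
  qed
  have "?x * cnj ?x + ?y * cnj ?y = 1"
  proof -
    have "?x * cnj ?x + ?y * cnj ?y = 1 + (\<alpha> * cnj \<alpha>) * ((\<omega> - 1) + cnj (\<omega> - 1) + (\<omega> - 1) * cnj (\<omega> - 1) * (\<alpha> * cnj \<alpha> + \<beta> * cnj \<beta>))"
      by (simp add: algebra_simps)
    also have "\<alpha> * cnj \<alpha> + \<beta> * cnj \<beta> = 1" using n by simp
    finally show ?thesis using w by (simp add: algebra_simps)
  qed
  then have "(cmod ?x)\<^sup>2 + (cmod ?y)\<^sup>2 = 1" using unit_norm_cnj by blast
  then show ?thesis unfolding plan_def x y using assms
    by (auto simp: creflect_def algebra_simps)
qed

lemma creflect_inverse: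
  assumes "cmod \<omega> = 1" "(cmod \<alpha>)\<^sup>2 + (cmod \<beta>)\<^sup>2 = 1" "a \<noteq> b"
  shows "bij (creflect a b \<omega> \<alpha> \<beta>)" "inv (creflect a b \<omega> \<alpha> \<beta>) = creflect a b (cnj \<omega>) \<alpha> \<beta>"
proof -
  have n: "\<alpha> * cnj \<alpha> + \<beta> * cnj \<beta> = 1" using assms unit_norm_cnj by auto
  have *: "creflect a b \<omega>' \<alpha> \<beta> \<circ> creflect a b \<omega> \<alpha> \<beta> = id" if w: "\<omega> * \<omega>' = 1" for \<omega> \<omega>' :: complex
  proof
    fix v
    let ?h = "cnj \<alpha> * v a + cnj \<beta> * v b"
    have "cnj \<alpha> * (v a + (\<omega> - 1) * ?h * \<alpha>) + cnj \<beta> * (v b + (\<omega> - 1) * ?h * \<beta>)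
        = ?h + (\<omega> - 1) * ?h * (\<alpha> * cnj \<alpha> + \<beta> * cnj \<beta>)" by (simp add: algebra_simps)
    also have "\<dots> = \<omega> * ?h" by (simp add: n algebra_simps)
    finally have h: "cnj \<alpha> * (v a + (\<omega> - 1) * ?h * \<alpha>) + cnj \<beta> * (v b + (\<omega> - 1) * ?h * \<beta>) = \<omega> * ?h" .
    have "(\<omega> - 1) * ?h * z + (\<omega>' - 1) * (\<omega> * ?h) * z = (\<omega> * \<omega>' - 1) * ?h * z" for z
      by (simp add: algebra_simps)
    then have "(\<omega> - 1) * ?h * z + (\<omega>' - 1) * (\<omega> * ?h) * z = 0" for z using w by simp
    then show "(creflect a b \<omega>' \<alpha> \<beta> \<circ> creflect a b \<omega> \<alpha> \<beta>) v = id v"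
      using assms(3) h unfolding creflect_def comp_def by (auto simp: fun_eq_iff add.assoc)
  qed
  have w: "\<omega> * cnj \<omega> = 1" "cnj \<omega> * \<omega> = 1" using assms unit_cnj by auto
  note 1 = *[OF w(1)] and 2 = *[OF w(2)]
  show "bij (creflect a b \<omega> \<alpha> \<beta>)" using 1 2 o_bij by metis
  show "inv (creflect a b \<omega> \<alpha> \<beta>) = creflect a b (cnj \<omega>) \<alpha> \<beta>" using 1 2 by (metis inv_unique_comp)
qed

text \<open>Conjugating a reflection by a unitary operator gives the reflection in the moved root.
  Here the mover is a reflection with the same eigenvalue, and h is the inner product of the
  roots.\<close>

lemma creflect_creflect:
  assumes "cmod \<omega> = 1" "(cmod \<alpha>)\<^sup>2 + (cmod \<beta>)\<^sup>2 = 1" "a \<noteq> b"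
    and h: "h = cnj \<alpha> * \<alpha>' + cnj \<beta> * \<beta>'"
  shows "creflect a b \<omega> \<alpha> \<beta> \<circ> creflect a b \<omega> \<alpha>' \<beta>' =
     creflect a b \<omega> (\<alpha>' + (\<omega> - 1) * h * \<alpha>) (\<beta>' + (\<omega> - 1) * h * \<beta>) \<circ> creflect a b \<omega> \<alpha> \<beta>"
proof
  fix v
  have n: "\<alpha> * cnj \<alpha> + \<beta> * cnj \<beta> = 1" and w: "\<omega> * cnj \<omega> = 1" using assms unit_norm_cnj unit_cnj by auto
  define s where "s = cnj \<alpha> * v a + cnj \<beta> * v b"
  define p where "p = cnj \<alpha>' * v a + cnj \<beta>' * v b"
  define \<alpha>2 \<beta>2 where "\<alpha>2 = \<alpha>' + (\<omega> - 1) * h * \<alpha>" and "\<beta>2 = \<beta>' + (\<omega> - 1) * h * \<beta>"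
  have hc: "cnj \<alpha>' * \<alpha> + cnj \<beta>' * \<beta> = cnj h" by (simp add: h mult.commute)
  have "cnj \<alpha>2 * (v a + (\<omega> - 1) * s * \<alpha>) + cnj \<beta>2 * (v b + (\<omega> - 1) * s * \<beta>)
     = p + (\<omega> - 1) * s * (cnj \<alpha>' * \<alpha> + cnj \<beta>' * \<beta>) + cnj (\<omega> - 1) * cnj h * s
        + cnj (\<omega> - 1) * (\<omega> - 1) * cnj h * s * (\<alpha> * cnj \<alpha> + \<beta> * cnj \<beta>)"
    by (simp add: \<alpha>2_def \<beta>2_def p_def s_def algebra_simps)
  also have "\<dots> = p + (\<omega> * cnj \<omega> - 1) * cnj h * s"
    unfolding hc n by (simp add: algebra_simps)
  finally have 1: "cnj \<alpha>2 * (v a + (\<omega> - 1) * s * \<alpha>) + cnj \<beta>2 * (v b + (\<omega> - 1) * s * \<beta>) = p"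
    by (simp add: w)
  have 2: "cnj \<alpha> * (v a + (\<omega> - 1) * p * \<alpha>') + cnj \<beta> * (v b + (\<omega> - 1) * p * \<beta>') = s + (\<omega> - 1) * p * h"
    by (simp add: h s_def algebra_simps)
  have L: "(creflect a b \<omega> \<alpha> \<beta> \<circ> creflect a b \<omega> \<alpha>' \<beta>') v = v(a := v a + (\<omega> - 1) * p * \<alpha>' + (\<omega> - 1) * (s + (\<omega> - 1) * p * h) * \<alpha>,
      b := v b + (\<omega> - 1) * p * \<beta>' + (\<omega> - 1) * (s + (\<omega> - 1) * p * h) * \<beta>)"
    using 2 assms(3) unfolding creflect_def comp_def by (auto simp: fun_eq_iff p_def[symmetric])
  have R: "(creflect a b \<omega> \<alpha>2 \<beta>2 \<circ> creflect a b \<omega> \<alpha> \<beta>) v = v(a := v a + (\<omega> - 1) * s * \<alpha> + (\<omega> - 1) * p * \<alpha>2,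
      b := v b + (\<omega> - 1) * s * \<beta> + (\<omega> - 1) * p * \<beta>2)"
    using 1 assms(3) unfolding creflect_def comp_def by (auto simp: fun_eq_iff s_def[symmetric])
  show "(creflect a b \<omega> \<alpha> \<beta> \<circ> creflect a b \<omega> \<alpha>' \<beta>') v =
     (creflect a b \<omega> (\<alpha>' + (\<omega> - 1) * h * \<alpha>) (\<beta>' + (\<omega> - 1) * h * \<beta>) \<circ> creflect a b \<omega> \<alpha> \<beta>) v"
    unfolding L R[unfolded \<alpha>2_def \<beta>2_def] by (auto simp: fun_eq_iff algebra_simps)
qed

text \<open>The vector \<open>(\<alpha>2, \<beta>2)\<close> is the second root reflected in the first one.\<close>

lemma root_contraction:
  assumes "cmod \<omega> = 1" "(cmod \<alpha>)\<^sup>2 + (cmod \<beta>)\<^sup>2 = 1" "(cmod \<alpha>')\<^sup>2 + (cmod \<beta>')\<^sup>2 = 1"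
    and h: "h = cnj \<alpha> * \<alpha>' + cnj \<beta> * \<beta>'"
    and a2: "\<alpha>2 = \<alpha>' + (\<omega> - 1) * h * \<alpha>" and b2: "\<beta>2 = \<beta>' + (\<omega> - 1) * h * \<beta>"
  shows "(cmod \<alpha>2)\<^sup>2 + (cmod \<beta>2)\<^sup>2 = 1"
    "1 - (cmod (cnj \<alpha>' * \<alpha>2 + cnj \<beta>' * \<beta>2))\<^sup>2 = (cmod (\<omega> - 1))\<^sup>2 * (1 - (cmod h)\<^sup>2) * (cmod h)\<^sup>2"
proof -
  have n: "\<alpha> * cnj \<alpha> + \<beta> * cnj \<beta> = 1" "\<alpha>' * cnj \<alpha>' + \<beta>' * cnj \<beta>' = 1" and w: "\<omega> * cnj \<omega> = 1"
    using assms unit_norm_cnj unit_cnj by auto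
  have hc: "cnj \<alpha>' * \<alpha> + cnj \<beta>' * \<beta> = cnj h" by (simp add: h mult.commute)
  have "\<alpha>2 * cnj \<alpha>2 + \<beta>2 * cnj \<beta>2 = (\<alpha>' * cnj \<alpha>' + \<beta>' * cnj \<beta>') + (\<omega> - 1) * h * (cnj \<alpha>' * \<alpha> + cnj \<beta>' * \<beta>)
     + cnj (\<omega> - 1) * cnj h * (cnj \<alpha> * \<alpha>' + cnj \<beta> * \<beta>') + (\<omega> - 1) * cnj (\<omega> - 1) * h * cnj h * (\<alpha> * cnj \<alpha> + \<beta> * cnj \<beta>)"
    by (simp add: a2 b2 algebra_simps)
  also have "\<dots> = 1 + (\<omega> * cnj \<omega> - 1) * h * cnj h"
    unfolding n hc h[symmetric] by (simp add: algebra_simps)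
  finally show "(cmod \<alpha>2)\<^sup>2 + (cmod \<beta>2)\<^sup>2 = 1" using w unit_norm_cnj by simp
  have "cnj \<alpha>' * \<alpha>2 + cnj \<beta>' * \<beta>2 = (\<alpha>' * cnj \<alpha>' + \<beta>' * cnj \<beta>') + (\<omega> - 1) * h * (cnj \<alpha>' * \<alpha> + cnj \<beta>' * \<beta>)"
    by (simp add: a2 b2 algebra_simps)
  also have "\<dots> = 1 + (\<omega> - 1) * of_real ((cmod h)\<^sup>2)"
    unfolding n hc by (simp only: complex_norm_square mult.assoc)
  finally have e: "cnj \<alpha>' * \<alpha>2 + cnj \<beta>' * \<beta>2 = 1 + (\<omega> - 1) * of_real ((cmod h)\<^sup>2)" .
  define c where "c = (cmod h)\<^sup>2"
  have w2: "(Re \<omega>)\<^sup>2 + (Im \<omega>)\<^sup>2 = 1" using assms(1) by (metis cmod_power2 one_power2)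
  have "(cmod (1 + (\<omega> - 1) * of_real c))\<^sup>2 = (1 + (Re \<omega> - 1) * c)\<^sup>2 + (Im \<omega> * c)\<^sup>2"
    unfolding cmod_power2 by simp
  moreover have "(cmod (\<omega> - 1))\<^sup>2 = (Re \<omega> - 1)\<^sup>2 + (Im \<omega>)\<^sup>2" by (simp add: cmod_power2)
  moreover have "1 - ((1 + (Re \<omega> - 1) * c)\<^sup>2 + (Im \<omega> * c)\<^sup>2) = ((Re \<omega> - 1)\<^sup>2 + (Im \<omega>)\<^sup>2) * (1 - c) * c"
  proof -
    have "1 - ((1 + (Re \<omega> - 1) * c)\<^sup>2 + (Im \<omega> * c)\<^sup>2) - ((Re \<omega> - 1)\<^sup>2 + (Im \<omega>)\<^sup>2) * (1 - c) * c
      = c * (1 - ((Re \<omega>)\<^sup>2 + (Im \<omega>)\<^sup>2))" by (simp add: power2_eq_square algebra_simps)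
    then show ?thesis using w2 by simp
  qed
  ultimately show "1 - (cmod (cnj \<alpha>' * \<alpha>2 + cnj \<beta>' * \<beta>2))\<^sup>2 = (cmod (\<omega> - 1))\<^sup>2 * (1 - (cmod h)\<^sup>2) * (cmod h)\<^sup>2"
    unfolding e c_def[symmetric] by simp
qed

text \<open>Both reflections have determinant \<omega>, so their quotient lies in SU(2). Half its
  trace is \<open>Re X\<close>, which tends to 1 as the root lines approach each other.\<close>

lemma creflect_quotient:
  assumes "cmod \<omega> = 1" "(cmod \<alpha>)\<^sup>2 + (cmod \<beta>)\<^sup>2 = 1" "(cmod \<alpha>')\<^sup>2 + (cmod \<beta>')\<^sup>2 = 1" "a \<noteq> b"
    and h: "h = cnj \<alpha> * \<alpha>' + cnj \<beta> * \<beta>'"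
  shows "\<exists>X Y. (cmod X)\<^sup>2 + (cmod Y)\<^sup>2 = 1 \<and> creflect a b \<omega> \<alpha>' \<beta>' \<circ> creflect a b (cnj \<omega>) \<alpha> \<beta> = rot a b X Y \<and>
     Re X = 1 - (cmod (\<omega> - 1))\<^sup>2 / 2 * (1 - (cmod h)\<^sup>2)"
proof -
  let ?f = "creflect a b \<omega> \<alpha>' \<beta>' \<circ> creflect a b (cnj \<omega>) \<alpha> \<beta>"
  let ?x = "1 + (\<omega> - 1) * (\<alpha> * cnj \<alpha>)" and ?y = "(\<omega> - 1) * (\<beta> * cnj \<alpha>)"
  let ?x' = "1 + (\<omega> - 1) * (\<alpha>' * cnj \<alpha>')" and ?y' = "(\<omega> - 1) * (\<beta>' * cnj \<alpha>')"
  have w: "\<omega> * cnj \<omega> = 1" using assms unit_cnj by auto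
  define X Y where "X = ?x' * cnj ?x - \<omega> * cnj ?y' * (- cnj \<omega> * ?y)"
    and "Y = ?y' * cnj ?x + \<omega> * cnj ?x' * (- cnj \<omega> * ?y)"
  have p: "plan a b ?f X Y 1"
    using plan_comp[OF creflect_plan[OF assms(1,3,4)] plan_inv[OF creflect_plan[OF assms(1,2,4)] creflect_inverse(1)[OF assms(1,2,4)]]]
    unfolding creflect_inverse(2)[OF assms(1,2,4)] w X_def Y_def .
  have "?f = rot a b X Y"
  proof (intro ext)
    fix v i
    show "?f v i = rot a b X Y v i"
      using p assms(4) unfolding plan_def by (cases "i = a"; cases "i = b") (simp_all add: rot_def creflect_def)
  qed
  moreover have "Re X = 1 - (cmod (\<omega> - 1))\<^sup>2 / 2 * (1 - (cmod h)\<^sup>2)"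
  proof -
    define A B A' B' where "A = (cmod \<alpha>)\<^sup>2" and "B = (cmod \<beta>)\<^sup>2" and "A' = (cmod \<alpha>')\<^sup>2" and "B' = (cmod \<beta>')\<^sup>2"
    define K where "K = (cmod (\<omega> - 1))\<^sup>2"
    define N where "N = \<alpha>' * cnj \<alpha> * \<beta> * cnj \<beta>'"
    define m where "m = Re N"
    have AB: "B = 1 - A" "B' = 1 - A'" using assms by (auto simp: A_def B_def A'_def B'_def)
    have w2: "(Re \<omega>)\<^sup>2 + (Im \<omega>)\<^sup>2 = 1" using assms(1) by (metis cmod_power2 one_power2)
    have K: "K = 2 - 2 * Re \<omega>" using w2 by (simp add: K_def cmod_power2 power2_diff)
    have aa: "\<alpha> * cnj \<alpha> = of_real A" "\<alpha>' * cnj \<alpha>' = of_real A'" "(\<omega> - 1) * cnj (\<omega> - 1) = of_real K"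
      by (simp_all only: A_def A'_def K_def complex_norm_square)
    have "X = ?x' * cnj ?x + (\<omega> * cnj \<omega>) * cnj ?y' * ?y" by (simp add: X_def)
    also have "\<dots> = 1 + (\<omega> - 1) * of_real A' + cnj (\<omega> - 1) * of_real A + ((\<omega> - 1) * cnj (\<omega> - 1)) * (of_real (A * A') + N)"
      unfolding w aa(1,2) N_def by (simp add: algebra_simps)
    finally have "Re X = 1 - K / 2 * (A + A') + K * (A * A' + m)"
      unfolding aa(3) by (simp add: m_def) (simp add: K algebra_simps add_divide_distrib diff_divide_distrib)
    moreover have "(cmod h)\<^sup>2 = A * A' + B * B' + 2 * m"
    proof -
      have "complex_of_real ((cmod h)\<^sup>2) = (\<alpha> * cnj \<alpha>) * (\<alpha>' * cnj \<alpha>') + (\<beta> * cnj \<beta>) * (\<beta>' * cnj \<beta>') +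
        (N + cnj N)"
        unfolding complex_norm_square h N_def by (simp add: algebra_simps)
      also have "\<dots> = of_real (A * A' + B * B' + 2 * m)"
        unfolding complex_add_cnj m_def by (simp add: A_def A'_def B_def B'_def complex_norm_square[symmetric])
      finally show ?thesis by (simp only: of_real_eq_iff)
    qed
    then have "A * A' + m = ((cmod h)\<^sup>2 - 1 + A + A') / 2" unfolding AB by (simp add: algebra_simps)
    ultimately have "Re X = 1 - K / 2 * (A + A') + K * (((cmod h)\<^sup>2 - 1 + A + A') / 2)" by simp
    then show ?thesis unfolding K_def[symmetric] by (simp add: algebra_simps add_divide_distrib diff_divide_distrib)
  qed
  ultimately show ?thesis using p unfolding plan_def by blast
qed

section \<open>Closed groups and their one-parameter subgroups\<close>

locale cgroup = ugroup +
  assumes closed: "\<And>f. f \<in> uop T \<Longrightarrow>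
    (\<And>\<epsilon>. \<epsilon> > 0 \<Longrightarrow> \<exists>g\<in>G. \<forall>i\<in>T. \<forall>j\<in>T. cmod (f (ket j) i - g (ket j) i) < \<epsilon>) \<Longrightarrow> f \<in> G"
begin

lemma closed_seq:
  assumes f: "f \<in> uop T" and F: "\<And>k::nat. F k \<in> G"
    and lim: "\<And>i j. i \<in> T \<Longrightarrow> j \<in> T \<Longrightarrow> (\<lambda>k. F k (ket j) i) \<longlonglongrightarrow> f (ket j) i"
  shows "f \<in> G"
proof (rule closed[OF f])
  fix \<epsilon> :: real assume e: "\<epsilon> > 0"
  have "eventually (\<lambda>k. \<forall>i\<in>T. \<forall>j\<in>T. cmod (f (ket j) i - F k (ket j) i) < \<epsilon>) sequentially"
    using fin lim e by (auto simp: eventually_ball_finite_distrib norm_minus_commute tendsto_iff dist_norm)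
  then obtain k where "\<forall>i\<in>T. \<forall>j\<in>T. cmod (f (ket j) i - F k (ket j) i) < \<epsilon>"
    by (auto simp: eventually_sequentially)
  then show "\<exists>g\<in>G. \<forall>i\<in>T. \<forall>j\<in>T. cmod (f (ket j) i - g (ket j) i) < \<epsilon>" using F by blast
qed

text \<open>The rotation axes of elements near the identity have a limit point on the unit sphere,
  and integer multiples of their small angles approximate every angle about the limit axis.\<close>

lemma one_parameter_limit:
  assumes ab: "a \<in> T" "b \<in> T" "a \<noteq> b"
    and small: "\<And>\<delta>. \<delta> > 0 \<Longrightarrow> \<exists>X Y. (cmod X)\<^sup>2 + (cmod Y)\<^sup>2 = 1 \<and> rot a b X Y \<in> G \<and> 1 - \<delta> < Re X \<and> Re X < 1"
  shows "\<exists>\<eta> \<zeta>. \<eta>\<^sup>2 + (cmod \<zeta>)\<^sup>2 = 1 \<and> (\<forall>\<theta>. rot a b (Complex (cos \<theta>) (\<eta> * sin \<theta>)) (\<zeta> * of_real (sin \<theta>)) \<in> G)"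
proof -
  \<comment> \<open>The rotation by \<theta> about the axis (\<eta>, \<zeta>):
    \<open>cos \<theta>\<close> plus \<open>sin \<theta>\<close> times a unit imaginary
    quaternion.\<close>
  define A where "A \<theta> \<eta> \<zeta> = rot a b (Complex (cos \<theta>) (\<eta> * sin \<theta>)) (\<zeta> * of_real (sin \<theta>))" for \<theta> \<eta> \<zeta>
  have nrm: "(cmod (Complex (cos \<theta>) (\<eta> * sin \<theta>)))\<^sup>2 + (cmod (\<zeta> * of_real (sin \<theta>)))\<^sup>2 = 1"
    if "\<eta>\<^sup>2 + (cmod \<zeta>)\<^sup>2 = 1" for \<theta> \<eta> \<zeta>
  proof -
    have "(cmod (Complex (cos \<theta>) (\<eta> * sin \<theta>)))\<^sup>2 + (cmod (\<zeta> * of_real (sin \<theta>)))\<^sup>2 = (cos \<theta>)\<^sup>2 + (\<eta>\<^sup>2 + (cmod \<zeta>)\<^sup>2) * (sin \<theta>)\<^sup>2"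
      by (simp add: cmod_power2 norm_mult power_mult_distrib algebra_simps)
    then show ?thesis using that by simp
  qed
  have add: "A \<theta> \<eta> \<zeta> \<circ> A \<theta>' \<eta> \<zeta> = A (\<theta> + \<theta>') \<eta> \<zeta>" if n: "\<eta>\<^sup>2 + (cmod \<zeta>)\<^sup>2 = 1" for \<theta> \<theta>' \<eta> \<zeta>
  proof -
    have "(cmod \<zeta>)\<^sup>2 = 1 - \<eta> * \<eta>" using n by (simp add: power2_eq_square)
    then have z: "cnj \<zeta> * \<zeta> = Complex (1 - \<eta> * \<eta>) 0"
      by (metis complex_norm_square complex_of_real_def mult.commute)
    have "Complex (cos \<theta>) (\<eta> * sin \<theta>) * Complex (cos \<theta>') (\<eta> * sin \<theta>') - (cnj \<zeta> * \<zeta>) * of_real (sin \<theta> * sin \<theta>')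
       = Complex (cos (\<theta> + \<theta>')) (\<eta> * sin (\<theta> + \<theta>'))"
      unfolding z by (simp add: complex_eq_iff cos_add sin_add algebra_simps)
    then have 1: "Complex (cos \<theta>) (\<eta> * sin \<theta>) * Complex (cos \<theta>') (\<eta> * sin \<theta>') - cnj (\<zeta> * of_real (sin \<theta>)) * (\<zeta> * of_real (sin \<theta>'))
       = Complex (cos (\<theta> + \<theta>')) (\<eta> * sin (\<theta> + \<theta>'))"
      by (simp add: algebra_simps)
    have "\<zeta> * (of_real (sin \<theta>) * Complex (cos \<theta>') (\<eta> * sin \<theta>') + cnj (Complex (cos \<theta>) (\<eta> * sin \<theta>)) * of_real (sin \<theta>'))
       = \<zeta> * of_real (sin (\<theta> + \<theta>'))"
      by (rule arg_cong[where f="\<lambda>z. \<zeta> * z"]) (simp add: complex_eq_iff sin_add algebra_simps)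
    then have 2: "\<zeta> * of_real (sin \<theta>) * Complex (cos \<theta>') (\<eta> * sin \<theta>') + cnj (Complex (cos \<theta>) (\<eta> * sin \<theta>)) * (\<zeta> * of_real (sin \<theta>'))
       = \<zeta> * of_real (sin (\<theta> + \<theta>'))" by (simp add: algebra_simps)
    show ?thesis unfolding A_def rot_comp[OF ab(3)] 1 2 ..
  qed
  have pow: "A (of_nat m * \<theta>) \<eta> \<zeta> \<in> G" if n: "\<eta>\<^sup>2 + (cmod \<zeta>)\<^sup>2 = 1" and "A \<theta> \<eta> \<zeta> \<in> G" for m :: nat and \<theta> \<eta> \<zeta>
  proof (induction m)
    case 0
    have "A 0 \<eta> \<zeta> = id" using rot_1[OF ab(3)] by (simp add: A_def Complex_eq)
    then show ?case by (simp only: of_nat_0 mult_zero_left id_in)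
  next
    case (Suc m)
    have e: "A (of_nat (Suc m) * \<theta>) \<eta> \<zeta> = A \<theta> \<eta> \<zeta> \<circ> A (of_nat m * \<theta>) \<eta> \<zeta>"
      using add[OF n, of \<theta> "of_nat m * \<theta>"] by (simp add: algebra_simps)
    show ?case unfolding e by (rule comp_in[OF that(2) Suc])
  qed
  have "\<exists>\<theta> w. 0 < \<theta> \<and> \<theta> < 1 / real (Suc k) \<and> (fst w)\<^sup>2 + (cmod (snd w))\<^sup>2 = 1 \<and> A \<theta> (fst w) (snd w) \<in> G" for k :: nat
  proof -
    \<comment> \<open>The bound 1 keeps the angle below pi / 2, so that \<open>Re X\<close> is
      nonnegative and the sine of the angle is positive.\<close>
    define tt where "tt = min 1 (1 / real (Suc k))"
    have t: "0 < tt" "tt \<le> 1" "tt \<le> 1 / real (Suc k)" by (auto simp: tt_def)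
    have t': "tt \<le> pi" "tt < pi" "tt \<le> pi / 2" using t(2) pi_gt3 by linarith+
    note t = t t'
    then have "cos tt < cos 0" by (intro cos_monotone_0_pi) auto
    then obtain X Y where XY: "(cmod X)\<^sup>2 + (cmod Y)\<^sup>2 = 1" "rot a b X Y \<in> G" "cos tt < Re X" "Re X < 1"
      using small[of "1 - cos tt"] by auto
    define \<theta> where "\<theta> = arccos (Re X)"
    have "cos tt \<ge> 0" using t by (intro cos_ge_zero) auto
    then have ReX: "0 \<le> Re X" "Re X \<le> 1" using XY by auto
    then have c: "cos \<theta> = Re X" by (simp add: \<theta>_def cos_arccos)
    have \<theta>0: "0 \<le> \<theta>" "\<theta> \<le> pi" using ReX by (auto simp: \<theta>_def arccos_lbound arccos_ubound)
    have "\<theta> \<noteq> 0" using c XY by auto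
    then have pos: "0 < \<theta>" using \<theta>0 by simp
    have lt: "\<theta> < tt"
    proof (rule ccontr)
      assume "\<not> \<theta> < tt"
      then have "cos \<theta> \<le> cos tt" using t \<theta>0 by (intro cos_monotone_0_pi_le) auto
      then show False using c XY by simp
    qed
    have s: "sin \<theta> > 0" using pos lt t by (intro sin_gt_zero) auto
    define w where "w = (Im X / sin \<theta>, Y / of_real (sin \<theta>))"
    have "(fst w)\<^sup>2 + (cmod (snd w))\<^sup>2 = ((Im X)\<^sup>2 + (cmod Y)\<^sup>2) / (sin \<theta>)\<^sup>2"
      using s by (simp add: w_def norm_divide power_divide add_divide_distrib)
    also have "(Im X)\<^sup>2 + (cmod Y)\<^sup>2 = (sin \<theta>)\<^sup>2" using XY(1) c by (simp add: sin_squared_eq cmod_power2)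
    finally have "(fst w)\<^sup>2 + (cmod (snd w))\<^sup>2 = 1" using s by simp
    moreover have "A \<theta> (fst w) (snd w) = rot a b X Y"
      using s c by (simp add: A_def w_def)
    moreover have "\<theta> < 1 / real (Suc k)" using lt t(3) by linarith
    ultimately show ?thesis using pos XY(2) by (intro exI[of _ \<theta>] exI[of _ w]) simp
  qed
  then obtain \<theta> w where tw: "\<And>k. 0 < \<theta> k" "\<And>k::nat. \<theta> k < 1 / real (Suc k)"
     "\<And>k. (fst (w k))\<^sup>2 + (cmod (snd (w k)))\<^sup>2 = 1" "\<And>k. A (\<theta> k) (fst (w k)) (snd (w k)) \<in> G"
    by metis
  define S where "S = {w :: real \<times> complex. norm w = 1}"
  have nS: "w \<in> S \<longleftrightarrow> (fst w)\<^sup>2 + (cmod (snd w))\<^sup>2 = 1" for w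
    by (cases w) (simp add: S_def norm_Pair)
  have "compact S"
  proof -
    have "S = sphere 0 1" by (auto simp: S_def sphere_def)
    then show ?thesis by simp
  qed
  moreover have "\<forall>k. w k \<in> S" using tw(3) nS by blast
  ultimately obtain l r where l: "l \<in> S" "strict_mono r" "(w \<circ> r) \<longlonglongrightarrow> l"
    using compact_def[of S] by metis
  obtain \<eta> \<zeta> where lz: "l = (\<eta>, \<zeta>)" by (cases l)
  have n: "\<eta>\<^sup>2 + (cmod \<zeta>)\<^sup>2 = 1" using l nS lz by auto
  have lim1: "(\<lambda>k. fst (w (r k))) \<longlonglongrightarrow> \<eta>" "(\<lambda>k. snd (w (r k))) \<longlonglongrightarrow> \<zeta>"
    using tendsto_fst[OF l(3)] tendsto_snd[OF l(3)] lz by (auto simp: o_def)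
  have "\<theta> \<longlonglongrightarrow> 0"
    by (rule tendsto_sandwich[OF _ _ tendsto_const LIMSEQ_Suc[OF lim_1_over_n]])
      (use tw in \<open>auto intro!: always_eventually less_imp_le\<close>)
  then have lim0: "(\<lambda>k. \<theta> (r k)) \<longlonglongrightarrow> 0" using LIMSEQ_subseq_LIMSEQ[OF _ l(2)] by (simp add: o_def)
  have main: "A t \<eta> \<zeta> \<in> G" if t: "t \<ge> 0" for t
  proof -
    \<comment> \<open>The multiple of the k-th small angle that lies within one such angle below
      t.\<close>
    define m where "m k = nat \<lfloor>t / \<theta> (r k)\<rfloor>" for k
    have m: "real (m k) * \<theta> (r k) \<le> t" "t - \<theta> (r k) \<le> real (m k) * \<theta> (r k)" for k
    proof -
      have p: "\<theta> (r k) > 0" using tw by simp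
      have "real (m k) = of_int \<lfloor>t / \<theta> (r k)\<rfloor>" using t p by (simp add: m_def)
      then have "real (m k) \<le> t / \<theta> (r k)" "t / \<theta> (r k) - 1 \<le> real (m k)" by linarith+
      then show "real (m k) * \<theta> (r k) \<le> t" "t - \<theta> (r k) \<le> real (m k) * \<theta> (r k)"
        using p by (simp_all add: field_simps)
    qed
    have "(\<lambda>k. t - \<theta> (r k)) \<longlonglongrightarrow> t - 0" by (intro tendsto_diff tendsto_const lim0)
    then have lo: "(\<lambda>k. t - \<theta> (r k)) \<longlonglongrightarrow> t" by simp
    have lt: "(\<lambda>k. real (m k) * \<theta> (r k)) \<longlonglongrightarrow> t"
      by (rule tendsto_sandwich[OF always_eventually always_eventually lo tendsto_const]) (use m in auto)
    have lX: "(\<lambda>k. Complex (cos (real (m k) * \<theta> (r k))) (fst (w (r k)) * sin (real (m k) * \<theta> (r k))))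
        \<longlonglongrightarrow> Complex (cos t) (\<eta> * sin t)"
      by (intro tendsto_Complex tendsto_cos tendsto_sin tendsto_mult lt lim1)
    have lY: "(\<lambda>k. snd (w (r k)) * of_real (sin (real (m k) * \<theta> (r k)))) \<longlonglongrightarrow> \<zeta> * of_real (sin t)"
      by (intro tendsto_of_real tendsto_sin tendsto_mult lt lim1)
    show ?thesis
    proof (rule closed_seq)
      show "A t \<eta> \<zeta> \<in> uop T" unfolding A_def by (rule rot_uop[OF fin ab nrm[OF n]])
      show "A (real (m k) * \<theta> (r k)) (fst (w (r k))) (snd (w (r k))) \<in> G" for k
        by (rule pow[OF tw(3,4)])
      fix i j
      show "(\<lambda>k. A (real (m k) * \<theta> (r k)) (fst (w (r k))) (snd (w (r k))) (ket j) i) \<longlonglongrightarrow> A t \<eta> \<zeta> (ket j) i"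
      proof -
        have cont: "(\<lambda>k. rot a b (x k) (y k) v i) \<longlonglongrightarrow> rot a b x0 y0 v i"
          if "x \<longlonglongrightarrow> x0" "y \<longlonglongrightarrow> y0" for x y x0 y0 and v :: "'a \<Rightarrow> complex"
          using that unfolding rot_def fun_upd_def by (auto intro!: tendsto_intros)
        show ?thesis unfolding A_def by (rule cont[OF lX lY])
      qed
    qed
  qed
  have "A t \<eta> \<zeta> \<in> G" for t
  proof (cases "t \<ge> 0")
    case False
    then have 1: "A (- t) \<eta> \<zeta> \<in> G" using main by simp
    have "A t \<eta> \<zeta> \<circ> A (- t) \<eta> \<zeta> = id" "A (- t) \<eta> \<zeta> \<circ> A t \<eta> \<zeta> = id"
      unfolding add[OF n] using rot_1[OF ab(3)] by (simp_all add: A_def Complex_eq)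
    then have "A t \<eta> \<zeta> = inv (A (- t) \<eta> \<zeta>)" by (metis inv_unique_comp)
    then show ?thesis using inv_in[OF 1] by simp
  qed (rule main)
  then show ?thesis using n unfolding A_def by blast
qed


text \<open>The root of the standard reflection is \<open>ket a\<close>, and g moves it to its first
  column in the plane, with coordinates (x, y).\<close>

lemma creflect_transport:
  assumes "g \<in> G" "plan a b g x y c" "a \<in> T" "b \<in> T" "a \<noteq> b"
  shows "g \<circ> creflect a b \<omega> 1 0 = creflect a b \<omega> x y \<circ> g"
proof (intro ext)
  fix v i
  have f: "g \<in> uop T" using assms sub by auto
  have n: "x * cnj x + y * cnj y = 1" using assms unit_norm_cnj by (auto simp: plan_def)
  have gv: "g v a = x * v a - c * cnj y * v b" "g v b = y * v a + c * cnj x * v b"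
    using assms(2) by (auto simp: plan_def)
  have "creflect a b \<omega> 1 0 v = (\<lambda>i. v i + ((\<omega> - 1) * v a) * ket a i)"
    using assms(5) by (auto simp: creflect_def ket_def fun_eq_iff)
  then have "(g \<circ> creflect a b \<omega> 1 0) v i = g v i + (\<omega> - 1) * v a * (x * ket a i + y * ket b i)"
    using uop_lin[OF f, of v "(\<omega> - 1) * v a" "ket a"] plan_columns(1)[OF assms] by simp
  moreover have "cnj x * g v a + cnj y * g v b = (x * cnj x + y * cnj y) * v a"
    unfolding gv by (simp add: algebra_simps)
  ultimately show "(g \<circ> creflect a b \<omega> 1 0) v i = (creflect a b \<omega> x y \<circ> g) v i"
    using assms(5) n by (auto simp: creflect_def ket_def)
qed

text \<open>The roots of \<open>s\<close> and of its conjugate by \<open>g\<close> span the plane of \<open>a, b\<close>. Reflecting one root in the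
  other repeatedly brings the roots together, because the reflection angle is less than \<open>pi / 3\<close>;
  the group is therefore not discrete.\<close>

lemma plG_from_reflection:
  assumes ab: "a \<in> T" "b \<in> T" "a \<noteq> b"
    and \<omega>: "cmod \<omega> = 1" "\<omega> \<noteq> 1" "cmod (\<omega> - 1) < 1"
    and d: "d a = d b" "\<And>i. cmod (d i) = 1"
    and s: "diag_op d \<circ> creflect a b \<omega> 1 0 \<in> G"
    and g: "g \<in> G" "plan a b g x y c" "x \<noteq> 0" "y \<noteq> 0" "g \<circ> diag_op d = diag_op d \<circ> g"
  shows "plG G a b"
proof -
  \<comment> \<open>By \<open>root_contraction\<close> the squared sine of the angle between the
    roots shrinks at least by this factor.\<close>
  define K where "K = (cmod (\<omega> - 1))\<^sup>2"
  have K: "0 < K" "K < 1" using \<omega> by (auto simp: K_def power_less_one_iff)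
  let ?rf = "creflect a b \<omega>"
  have xy: "(cmod x)\<^sup>2 + (cmod y)\<^sup>2 = 1" using g by (auto simp: plan_def)
  have dbij: "bij (diag_op d)"
  proof (rule o_bij)
    have nz: "d i \<noteq> 0" for i using d(2)[of i] by auto
    show "diag_op (\<lambda>i. inverse (d i)) \<circ> diag_op d = id" "diag_op d \<circ> diag_op (\<lambda>i. inverse (d i)) = id"
      using nz by (auto simp: diag_op_def fun_eq_iff)
  qed
  have inv_s: "inv (diag_op d \<circ> ?rf \<alpha> \<beta>) = creflect a b (cnj \<omega>) \<alpha> \<beta> \<circ> inv (diag_op d)" if "(cmod \<alpha>)\<^sup>2 + (cmod \<beta>)\<^sup>2 = 1" for \<alpha> \<beta>
    using o_inv_distrib[OF dbij creflect_inverse(1)[OF \<omega>(1) that ab(3)]] creflect_inverse(2)[OF \<omega>(1) that ab(3)] by simp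
  have dinv: "diag_op d \<circ> inv (diag_op d) = id" using dbij by (metis bij_is_surj surj_iff)
  have comm: "diag_op d \<circ> ?rf \<alpha> \<beta> = ?rf \<alpha> \<beta> \<circ> diag_op d" for \<alpha> \<beta> using diag_op_creflect[of d a b, OF d(1)] .
  \<comment> \<open>The squared sine of the angle between the root lines is at most
    \<open>K ^ k\<close>. It has to stay positive, or the quotient of the reflections would be
    trivial, and below 1, since orthogonal roots do not move each other.\<close>
  define Q where "Q k \<alpha> \<beta> \<alpha>' \<beta>' \<longleftrightarrow> (cmod \<alpha>)\<^sup>2 + (cmod \<beta>)\<^sup>2 = 1 \<and> (cmod \<alpha>')\<^sup>2 + (cmod \<beta>')\<^sup>2 = 1 \<and>
     diag_op d \<circ> ?rf \<alpha> \<beta> \<in> G \<and> diag_op d \<circ> ?rf \<alpha>' \<beta>' \<in> G \<and>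
     0 < 1 - (cmod (cnj \<alpha> * \<alpha>' + cnj \<beta> * \<beta>'))\<^sup>2 \<and> 1 - (cmod (cnj \<alpha> * \<alpha>' + cnj \<beta> * \<beta>'))\<^sup>2 < 1 \<and>
     1 - (cmod (cnj \<alpha> * \<alpha>' + cnj \<beta> * \<beta>'))\<^sup>2 \<le> K ^ k" for k :: nat and \<alpha> \<beta> \<alpha>' \<beta>'
  have step: "\<exists>\<alpha> \<beta> \<alpha>' \<beta>'. Q k \<alpha> \<beta> \<alpha>' \<beta>'" for k :: nat
  proof (induction k)
    case 0
    have "g \<circ> (diag_op d \<circ> ?rf 1 0) \<circ> inv g = diag_op d \<circ> (g \<circ> ?rf 1 0) \<circ> inv g"
      using g(5) by (metis comp_assoc)
    also have "\<dots> = diag_op d \<circ> ?rf x y \<circ> (g \<circ> inv g)"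
      unfolding creflect_transport[OF g(1,2) ab] by (simp only: comp_assoc)
    also have "\<dots> = diag_op d \<circ> ?rf x y" using inv_cancel(2)[OF g(1)] by simp
    finally have "diag_op d \<circ> ?rf x y \<in> G" using comp_in[OF comp_in[OF g(1) s] inv_in[OF g(1)]] by simp
    moreover have "0 < (cmod y)\<^sup>2" "0 < (cmod x)\<^sup>2" using g by auto
    then have "0 < 1 - (cmod x)\<^sup>2" "1 - (cmod x)\<^sup>2 < 1" "1 - (cmod x)\<^sup>2 \<le> 1" using xy by linarith+
    ultimately have "Q 0 1 0 x y" using s xy by (simp add: Q_def)
    then show ?case by blast
  next
    case (Suc k)
    then obtain \<alpha> \<beta> \<alpha>' \<beta>' where v: "(cmod \<alpha>)\<^sup>2 + (cmod \<beta>)\<^sup>2 = 1" "(cmod \<alpha>')\<^sup>2 + (cmod \<beta>')\<^sup>2 = 1"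
      and G: "diag_op d \<circ> ?rf \<alpha> \<beta> \<in> G" "diag_op d \<circ> ?rf \<alpha>' \<beta>' \<in> G"
      and e: "0 < 1 - (cmod (cnj \<alpha> * \<alpha>' + cnj \<beta> * \<beta>'))\<^sup>2" "1 - (cmod (cnj \<alpha> * \<alpha>' + cnj \<beta> * \<beta>'))\<^sup>2 < 1"
       "1 - (cmod (cnj \<alpha> * \<alpha>' + cnj \<beta> * \<beta>'))\<^sup>2 \<le> K ^ k" unfolding Q_def by blast
    define h where "h = cnj \<alpha> * \<alpha>' + cnj \<beta> * \<beta>'"
    define \<alpha>2 \<beta>2 where ab2: "\<alpha>2 = \<alpha>' + (\<omega> - 1) * h * \<alpha>" "\<beta>2 = \<beta>' + (\<omega> - 1) * h * \<beta>"
    note c = root_contraction[OF \<omega>(1) v h_def ab2]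
    have "(diag_op d \<circ> ?rf \<alpha> \<beta>) \<circ> (diag_op d \<circ> ?rf \<alpha>' \<beta>') \<circ> inv (diag_op d \<circ> ?rf \<alpha> \<beta>)
       = diag_op d \<circ> diag_op d \<circ> (?rf \<alpha> \<beta> \<circ> ?rf \<alpha>' \<beta>') \<circ> inv (diag_op d \<circ> ?rf \<alpha> \<beta>)"
      using comm by (metis comp_assoc)
    also have "\<dots> = diag_op d \<circ> ?rf \<alpha>2 \<beta>2 \<circ> ((diag_op d \<circ> ?rf \<alpha> \<beta>) \<circ> inv (diag_op d \<circ> ?rf \<alpha> \<beta>))"
      unfolding creflect_creflect[OF \<omega>(1) v(1) ab(3) h_def] ab2[symmetric] using comm by (metis comp_assoc)
    also have "\<dots> = diag_op d \<circ> ?rf \<alpha>2 \<beta>2" using inv_cancel(2)[OF G(1)] by simp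
    finally have G2: "diag_op d \<circ> ?rf \<alpha>2 \<beta>2 \<in> G" using comp_in[OF comp_in[OF G(1,2)] inv_in[OF G(1)]] by simp
    define e0 where "e0 = 1 - (cmod h)\<^sup>2"
    have e0: "0 < e0" "e0 < 1" "e0 \<le> K ^ k" using e by (auto simp: e0_def h_def)
    have e': "1 - (cmod (cnj \<alpha>' * \<alpha>2 + cnj \<beta>' * \<beta>2))\<^sup>2 = K * e0 * (1 - e0)"
      using c(2) by (simp add: K_def e0_def)
    have "K * e0 * (1 - e0) \<le> K * e0" using e0 K mult_left_mono[of "1 - e0" 1 "K * e0"] by simp
    moreover have "K * e0 \<le> K ^ Suc k" using e0 K by simp
    moreover have "K * e0 < 1" using e0 K mult_strict_mono[of K 1 e0 1] by simp
    moreover have "0 < K * e0 * (1 - e0)" using e0 K by simp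
    \<comment> \<open>The new pair is the second root together with its image under the first
      reflection.\<close>
    ultimately have "Q (Suc k) \<alpha>' \<beta>' \<alpha>2 \<beta>2"
      unfolding Q_def e' using v(2) c(1) G(2) G2 by linarith
    then show ?case by blast
  qed
  have "\<exists>X Y. (cmod X)\<^sup>2 + (cmod Y)\<^sup>2 = 1 \<and> rot a b X Y \<in> G \<and> 1 - \<delta> < Re X \<and> Re X < 1" if \<delta>: "\<delta> > 0" for \<delta> :: real
  proof -
    obtain k where k: "K ^ k < \<delta>" using real_arch_pow_inv[OF \<delta> K(2)] by blast
    obtain \<alpha> \<beta> \<alpha>' \<beta>' where v: "(cmod \<alpha>)\<^sup>2 + (cmod \<beta>)\<^sup>2 = 1" "(cmod \<alpha>')\<^sup>2 + (cmod \<beta>')\<^sup>2 = 1"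
      and G: "diag_op d \<circ> ?rf \<alpha> \<beta> \<in> G" "diag_op d \<circ> ?rf \<alpha>' \<beta>' \<in> G"
      and e: "0 < 1 - (cmod (cnj \<alpha> * \<alpha>' + cnj \<beta> * \<beta>'))\<^sup>2" "1 - (cmod (cnj \<alpha> * \<alpha>' + cnj \<beta> * \<beta>'))\<^sup>2 < 1"
       "1 - (cmod (cnj \<alpha> * \<alpha>' + cnj \<beta> * \<beta>'))\<^sup>2 \<le> K ^ k" using step[of k] unfolding Q_def by blast
    \<comment> \<open>The diagonal factor is scalar on the plane and commutes with both reflections,
      so it drops out of the quotient.\<close>
    have "(diag_op d \<circ> ?rf \<alpha>' \<beta>') \<circ> inv (diag_op d \<circ> ?rf \<alpha> \<beta>) = ?rf \<alpha>' \<beta>' \<circ> creflect a b (cnj \<omega>) \<alpha> \<beta> \<circ> (diag_op d \<circ> inv (diag_op d))"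
      unfolding inv_s[OF v(1)] using comm diag_op_creflect[of d a b, OF d(1), of "cnj \<omega>"] by (metis comp_assoc)
    then have in_G: "?rf \<alpha>' \<beta>' \<circ> creflect a b (cnj \<omega>) \<alpha> \<beta> \<in> G"
      using comp_in[OF G(2) inv_in[OF G(1)]] dinv by simp
    define e0 where "e0 = 1 - (cmod (cnj \<alpha> * \<alpha>' + cnj \<beta> * \<beta>'))\<^sup>2"
    obtain X Y where X: "(cmod X)\<^sup>2 + (cmod Y)\<^sup>2 = 1" "rot a b X Y \<in> G" "Re X = 1 - K / 2 * e0"
      using creflect_quotient[OF \<omega>(1) v ab(3) refl] in_G by (auto simp: K_def e0_def)
    have e0: "0 < e0" "e0 < \<delta>" using e k by (auto simp: e0_def)
    have "0 < K / 2 * e0" "K / 2 * e0 < \<delta>" using e0 K mult_strict_mono[of "K / 2" 1 e0 \<delta>] by auto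
    then have "1 - \<delta> < Re X" "Re X < 1" using X(3) by linarith+
    then show ?thesis using X(1,2) by blast
  qed
  then obtain \<eta> \<zeta> where ax: "\<eta>\<^sup>2 + (cmod \<zeta>)\<^sup>2 = 1"
     "\<And>\<theta>. rot a b (Complex (cos \<theta>) (\<eta> * sin \<theta>)) (\<zeta> * of_real (sin \<theta>)) \<in> G"
    using one_parameter_limit[OF ab] by blast
  show ?thesis
  proof (cases "\<zeta> = 0")
    case True
    then have "\<eta> = 1 \<or> \<eta> = - 1" using ax by (simp add: power2_eq_1_iff)
    then have "rot a b (cis \<theta>) 0 \<in> G" for \<theta>
      using ax(2)[of \<theta>] ax(2)[of "- \<theta>"] True by (auto simp: cis.code)
    then show ?thesis using plG_from_torus_conj g ab by blast
  next
    case False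
    have "(cmod \<zeta>)\<^sup>2 > 0" using False by simp
    then have "\<eta>\<^sup>2 < 1\<^sup>2" using ax(1) unfolding one_power2 by linarith
    then have \<eta>: "- 1 < \<eta>" "\<eta> < 1" using abs_square_less_1[of \<eta>] by auto
    \<comment> \<open>Now the axis is not diagonal. A rotation w is sought that conjugates the
      diagonal torus into the one-parameter group; comparing entries, with P real, requires
      \<open>(cmod P)\<^sup>2 - (cmod S)\<^sup>2 = \<eta>\<close> and
      \<open>2 * \<i> * S * P = \<zeta>\<close>.\<close>
    define p where "p = sqrt ((1 + \<eta>) / 2)"
    have p: "p > 0" "p\<^sup>2 = (1 + \<eta>) / 2" using \<eta> by (auto simp: p_def)
    define P S where "P = complex_of_real p" and "S = \<zeta> / (2 * \<i> * P)"
    have P0: "P \<noteq> 0" using p by (simp add: P_def)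
    have S0: "S \<noteq> 0" using P0 False by (simp add: S_def)
    have cP: "(cmod P)\<^sup>2 = (1 + \<eta>) / 2" using p by (simp add: P_def)
    have cS: "(cmod S)\<^sup>2 = (1 - \<eta>) / 2"
    proof -
      have "(cmod S)\<^sup>2 = (1 - \<eta>\<^sup>2) / (4 * p\<^sup>2)"
        using ax(1) p by (simp add: S_def P_def norm_mult norm_divide power_divide power_mult_distrib)
      also have "\<dots> = (1 - \<eta>) / 2" using \<eta> unfolding p(2) by (simp add: field_simps power2_eq_square)
      finally show ?thesis .
    qed
    have PS: "(cmod P)\<^sup>2 + (cmod S)\<^sup>2 = 1" unfolding cP cS by (simp add: field_simps)
    define w where "w = rot a b P S"
    have wb: "bij w" and wi: "inv w = rot a b (cnj P) (- S)"
      using rot_inverse[OF ab(3) PS] o_bij unfolding w_def by auto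
    have wu: "w \<in> uop T" unfolding w_def by (rule rot_uop[OF fin ab PS])
    have wc: "w \<circ> inv w = id" "inv w \<circ> w = id" using wb by (auto simp: bij_is_inj, metis bij_is_surj surj_iff)
    define G' where "G' = (\<lambda>f. inv w \<circ> f \<circ> w) ` G"
    interpret G': ugroup T G'
    proof
      show "finite T" by (rule fin)
      show "G' \<subseteq> uop T" using sub wu uop_bij(2)[OF wu fin] by (auto simp: G'_def intro!: uop_comp)
      show "id \<in> G'" unfolding G'_def by (rule image_eqI[OF _ id_in]) (simp add: wc)
      show "f \<circ> f' \<in> G'" if ff: "f \<in> G'" "f' \<in> G'" for f f'
      proof -
        obtain k k' where k: "k \<in> G" "k' \<in> G" "f = inv w \<circ> k \<circ> w" "f' = inv w \<circ> k' \<circ> w"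
          using ff by (auto simp: G'_def)
        have "f \<circ> f' = inv w \<circ> (k \<circ> k') \<circ> w" unfolding k(3,4) using wc(1) by (metis comp_assoc comp_id)
        then show ?thesis unfolding G'_def using comp_in[OF k(1,2)] by blast
      qed
      show "inv f \<in> G'" if ff: "f \<in> G'" for f
      proof -
        obtain k where k: "k \<in> G" "f = inv w \<circ> k \<circ> w" using ff by (auto simp: G'_def)
        have "inv f = inv w \<circ> inv k \<circ> w" unfolding k(2)
          using wb bij_in[OF k(1)] by (simp add: o_inv_distrib bij_comp bij_imp_bij_inv inv_inv_eq comp_assoc)
        then show ?thesis unfolding G'_def using inv_in[OF k(1)] by blast
      qed
    qed
    have tor: "rot a b (cis \<theta>) 0 \<in> G'" for \<theta>
    proof -
      have 1: "P * cis \<theta> * cnj P - cnj (S * cis \<theta>) * (- S) = Complex (cos \<theta>) (\<eta> * sin \<theta>)"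
      proof -
        have "P * cis \<theta> * cnj P - cnj (S * cis \<theta>) * (- S) = (P * cnj P) * cis \<theta> + (S * cnj S) * cnj (cis \<theta>)"
          by (simp add: algebra_simps)
        also have "\<dots> = of_real ((1 + \<eta>) / 2) * cis \<theta> + of_real ((1 - \<eta>) / 2) * cnj (cis \<theta>)"
          by (simp only: complex_norm_square[symmetric] cP cS)
        also have "\<dots> = Complex (cos \<theta>) (\<eta> * sin \<theta>)"
          by (simp add: complex_eq_iff field_simps)
        finally show ?thesis .
      qed
      have 2: "S * cis \<theta> * cnj P + cnj (P * cis \<theta>) * (- S) = \<zeta> * of_real (sin \<theta>)"
      proof -
        have "S * cis \<theta> * cnj P + cnj (P * cis \<theta>) * (- S) = S * P * (cis \<theta> - cnj (cis \<theta>))"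
          by (simp add: P_def algebra_simps)
        also have "cis \<theta> - cnj (cis \<theta>) = 2 * \<i> * of_real (sin \<theta>)" by (simp add: complex_eq_iff)
        also have "S * P = \<zeta> / (2 * \<i>)" using P0 by (simp add: S_def)
        also have "\<zeta> / (2 * \<i>) * (2 * \<i> * of_real (sin \<theta>)) = \<zeta> * of_real (sin \<theta>)"
        proof -
          have "c \<noteq> 0 \<Longrightarrow> \<zeta> / c * (c * z) = \<zeta> * z" for c z :: complex by simp
          then show ?thesis by (metis complex_i_not_zero mult_eq_0_iff zero_neq_numeral)
        qed
        finally show ?thesis .
      qed
      have e: "w \<circ> rot a b (cis \<theta>) 0 \<circ> inv w =
          rot a b (P * cis \<theta> * cnj P - cnj (S * cis \<theta>) * (- S)) (S * cis \<theta> * cnj P + cnj (P * cis \<theta>) * (- S))"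
        unfolding wi unfolding w_def rot_comp[OF ab(3)] by simp
      have "w \<circ> rot a b (cis \<theta>) 0 \<circ> inv w \<in> G"
        unfolding e 1 2 by (rule ax(2))
      moreover have "rot a b (cis \<theta>) 0 = inv w \<circ> (w \<circ> rot a b (cis \<theta>) 0 \<circ> inv w) \<circ> w"
        using wc(2) by (metis comp_assoc comp_id id_comp)
      ultimately show ?thesis unfolding G'_def by blast
    qed
    \<comment> \<open>In the basis given by w the reflection itself is no longer diagonal and takes
      over the role of g: its off-diagonal entry has the nonzero factor
      \<open>1 - \<omega>\<close>.\<close>
    define sp where "sp = inv w \<circ> (diag_op d \<circ> ?rf 1 0) \<circ> w"
    have sG: "sp \<in> G'" using s by (auto simp: G'_def sp_def)
    have sc: "cmod (\<omega> * d a) = 1" "d a * cnj (d a) = 1" "\<omega> * cnj \<omega> = 1" using \<omega> d unit_cnj by (auto simp: norm_mult)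
    have ps: "plan a b (diag_op d \<circ> ?rf 1 0) (\<omega> * d a) 0 (\<omega> * d a * d a)"
    proof -
      have "\<omega> * d a * d a * cnj (\<omega> * d a) = (\<omega> * cnj \<omega>) * d a * (d a * cnj (d a))" by (simp add: algebra_simps)
      also have "\<dots> = d b" using sc d(1) by simp
      finally show ?thesis using sc ab(3) \<omega> d by (simp add: plan_def diag_op_def creflect_def norm_mult algebra_simps)
    qed
    have pw: "plan a b w P S 1" "plan a b (inv w) (cnj P) (- S) 1"
      using plan_rot[OF ab(3) PS] plan_inv[OF _ wb] by (auto simp: w_def[symmetric]) fastforce
    have psp: "\<exists>c. plan a b sp (d a * (\<omega> * (P * cnj P) + S * cnj S)) (d a * S * P * (1 - \<omega>)) c"
    proof -
      have "plan a b sp (cnj P * (\<omega> * d a) * P - (\<omega> * d a * d a) * cnj (- S * (\<omega> * d a)) * S)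
         (- S * (\<omega> * d a) * P + (\<omega> * d a * d a) * cnj (cnj P * (\<omega> * d a)) * S) (\<omega> * d a * d a)"
        using plan_comp[OF plan_comp[OF pw(2) ps] pw(1)] by (simp add: sp_def)
      moreover have "cnj P * (\<omega> * d a) * P - (\<omega> * d a * d a) * cnj (- S * (\<omega> * d a)) * S
         = d a * (\<omega> * (P * cnj P) + (\<omega> * cnj \<omega>) * (d a * cnj (d a)) * (S * cnj S))" by (simp add: algebra_simps)
      moreover have "- S * (\<omega> * d a) * P + (\<omega> * d a * d a) * cnj (cnj P * (\<omega> * d a)) * S
         = d a * S * P * ((\<omega> * cnj \<omega>) * (d a * cnj (d a)) - \<omega>)" by (simp add: algebra_simps)
      ultimately show ?thesis unfolding sc by auto
    qed
    then obtain c' where psp: "plan a b sp (d a * (\<omega> * (P * cnj P) + S * cnj S)) (d a * S * P * (1 - \<omega>)) c'" by blast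
    have d0: "d a \<noteq> 0" using d(2)[of a] by auto
    \<comment> \<open>A zero would force \<open>cmod (\<omega> - 1) * (cmod P)\<^sup>2 = 1\<close>,
      which the bound on the reflection angle excludes.\<close>
    have nz1: "\<omega> * (P * cnj P) + S * cnj S \<noteq> 0"
    proof
      assume 0: "\<omega> * (P * cnj P) + S * cnj S = 0"
      have "P * cnj P + S * cnj S = 1" using PS unit_norm_cnj by blast
      then have "1 = (P * cnj P + S * cnj S) - (\<omega> * (P * cnj P) + S * cnj S)" unfolding 0 by simp
      also have "\<dots> = - (\<omega> - 1) * (P * cnj P)" by (simp add: algebra_simps)
      finally have "1 = - (\<omega> - 1) * (P * cnj P)" .
      then have "cmod 1 = cmod (- (\<omega> - 1) * (P * cnj P))" by (rule arg_cong)
      then have "1 = cmod (\<omega> - 1) * (cmod P)\<^sup>2"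
        by (simp only: norm_mult norm_minus_cancel complex_mod_cnj norm_one power2_eq_square)
      moreover have "cmod (\<omega> - 1) * (cmod P)\<^sup>2 < 1 * 1"
        using \<omega>(3) cP \<eta> by (intro mult_strict_mono) auto
      ultimately show False by simp
    qed
    have pl: "plG G' a b"
      using G'.plG_from_torus_conj[OF tor sG psp _ _ ab] nz1 d0 S0 P0 \<omega>(2) by simp
    show ?thesis unfolding plG_def
    proof (intro allI impI)
      fix X Y assume XY: "(cmod X)\<^sup>2 + (cmod Y)\<^sup>2 = 1"
      have nm: "\<exists>X' Y'. (cmod X')\<^sup>2 + (cmod Y')\<^sup>2 = 1 \<and> rot a b X1 Y1 \<circ> rot a b X2 Y2 = rot a b X' Y'"
        if "(cmod X1)\<^sup>2 + (cmod Y1)\<^sup>2 = 1" "(cmod X2)\<^sup>2 + (cmod Y2)\<^sup>2 = 1" for X1 Y1 X2 Y2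
        using cmod_mult_unit[OF that, of 1] rot_comp[OF ab(3)] by (intro exI conjI) auto
      have PS': "(cmod (cnj P))\<^sup>2 + (cmod (- S))\<^sup>2 = 1" using PS by simp
      obtain X1 Y1 where X1: "(cmod X1)\<^sup>2 + (cmod Y1)\<^sup>2 = 1" "inv w \<circ> rot a b X Y = rot a b X1 Y1"
        using nm[OF PS' XY] unfolding wi by blast
      obtain X' Y' where X': "(cmod X')\<^sup>2 + (cmod Y')\<^sup>2 = 1" "inv w \<circ> rot a b X Y \<circ> w = rot a b X' Y'"
        using nm[OF X1(1) PS] unfolding X1(2) unfolding w_def by blast
      then have "inv w \<circ> rot a b X Y \<circ> w \<in> G'" using pl by (simp add: plG_def)
      then obtain f where f: "f \<in> G" "inv w \<circ> rot a b X Y \<circ> w = inv w \<circ> f \<circ> w" by (auto simp: G'_def)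
      have un: "w \<circ> (inv w \<circ> h \<circ> w) \<circ> inv w = h" for h
      proof -
        have "w \<circ> (inv w \<circ> h \<circ> w) \<circ> inv w = (w \<circ> inv w) \<circ> h \<circ> (w \<circ> inv w)" by (simp only: comp_assoc)
        then show ?thesis unfolding wc by simp
      qed
      have "rot a b X Y = w \<circ> (inv w \<circ> rot a b X Y \<circ> w) \<circ> inv w" by (rule un[symmetric])
      also have "\<dots> = f" unfolding f(2) by (rule un)
      finally have "rot a b X Y = f" .
      then show "rot a b X Y \<in> G" using f by simp
    qed
  qed
qed

end

section \<open>Entrywise closure of a group of unitary operators\<close>

definition uclosure :: "'i set \<Rightarrow> (('i \<Rightarrow> complex) \<Rightarrow> 'i \<Rightarrow> complex) set \<Rightarrow> (('i \<Rightarrow> complex) \<Rightarrow> 'i \<Rightarrow> complex) set" where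
  "uclosure T G = {f \<in> uop T. \<forall>\<epsilon>>0. \<exists>g\<in>G. \<forall>i\<in>T. \<forall>j\<in>T. cmod (f (ket j) i - g (ket j) i) < \<epsilon>}"

lemma uop_entry_le:
  assumes "f \<in> uop T" "finite T" "i \<in> T" "j \<in> T"
  shows "cmod (f (ket j) i) \<le> 1"
proof -
  obtain M where M: "f = mop T M" using assms by (auto simp: uop_def)
  have "(cmod (M i j))\<^sup>2 \<le> (\<Sum>k\<in>T. (cmod (M k j))\<^sup>2)"
    using assms by (intro member_le_sum) auto
  also have "\<dots> = 1" using column_norm[of T M j] assms M by simp
  finally have "(cmod (M i j))\<^sup>2 \<le> 1\<^sup>2" by simp
  then have "cmod (M i j) \<le> 1" using power2_le_imp_le[of "cmod (M i j)" 1] by simp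
  then show ?thesis using mop_ket[OF assms(2-4), of M] unfolding M by simp
qed

lemma uop_apply:
  assumes "f \<in> uop T" "finite T" "i \<in> T"
  shows "f v i = (\<Sum>k\<in>T. f (ket k) i * v k)"
  using uop_eq_mop[OF assms(1,2)] assms(3) mop_def[of T "\<lambda>i j. f (ket j) i" v i] by simp

lemma uop_inv_entry:
  assumes "f \<in> uop T" "finite T" "i \<in> T" "j \<in> T"
  shows "inv f (ket j) i = cnj (f (ket i) j)"
proof -
  obtain M where M: "f = mop T M" using assms by (auto simp: uop_def)
  then show ?thesis using uop_inv(2)[of T M] assms by (simp add: mop_ket adj_def)
qed

lemma (in ugroup) uclosure_cgroup: "cgroup T (uclosure T G)"
proof
  show "finite T" by (rule fin)
  show "uclosure T G \<subseteq> uop T" by (auto simp: uclosure_def)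
  show "id \<in> uclosure T G" using id_in uop_id[OF fin] by (auto simp: uclosure_def intro!: bexI[of _ id])
  show "f \<circ> f' \<in> uclosure T G" if f: "f \<in> uclosure T G" "f' \<in> uclosure T G" for f f'
    unfolding uclosure_def
  proof (intro CollectI conjI allI impI)
    have u: "f \<in> uop T" "f' \<in> uop T" using f by (auto simp: uclosure_def)
    show "f \<circ> f' \<in> uop T" using uop_comp u by blast
    fix \<epsilon> :: real assume e: "\<epsilon> > 0"
    \<comment> \<open>Each of the \<open>card T\<close> terms in an entry of the product changes by
      at most \<open>2 * \<delta>\<close>, because entries of unitary operators have modulus at most
      1; the added 1 keeps the denominator positive and the estimate strict.\<close>
    define \<delta> where "\<delta> = \<epsilon> / (2 * real (card T) + 1)"
    have d: "\<delta> > 0" using e by (simp add: \<delta>_def)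
    obtain g where g: "g \<in> G" "\<And>i j. i \<in> T \<Longrightarrow> j \<in> T \<Longrightarrow> cmod (f (ket j) i - g (ket j) i) < \<delta>"
      using f(1) d unfolding uclosure_def by blast
    obtain g' where g': "g' \<in> G" "\<And>i j. i \<in> T \<Longrightarrow> j \<in> T \<Longrightarrow> cmod (f' (ket j) i - g' (ket j) i) < \<delta>"
      using f(2) d unfolding uclosure_def by blast
    have gu: "g \<in> uop T" "g' \<in> uop T" using g g' sub by auto
    have "cmod ((f \<circ> f') (ket j) i - (g \<circ> g') (ket j) i) < \<epsilon>" if ij: "i \<in> T" "j \<in> T" for i j
    proof -
      have "(f \<circ> f') (ket j) i - (g \<circ> g') (ket j) i =
          (\<Sum>k\<in>T. f (ket k) i * f' (ket j) k) - (\<Sum>k\<in>T. g (ket k) i * g' (ket j) k)"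
        unfolding comp_def uop_apply[OF u(1) fin ij(1), of "f' (ket j)"] uop_apply[OF gu(1) fin ij(1), of "g' (ket j)"] ..
      also have "\<dots> = (\<Sum>k\<in>T. f (ket k) i * (f' (ket j) k - g' (ket j) k) + (f (ket k) i - g (ket k) i) * g' (ket j) k)"
        unfolding sum_subtractf[symmetric] by (intro sum.cong) (auto simp: algebra_simps)
      also have "cmod \<dots> \<le> (\<Sum>k\<in>T. 2 * \<delta>)"
      proof (rule sum_norm_le)
        fix k assume k: "k \<in> T"
        have "cmod (f (ket k) i * (f' (ket j) k - g' (ket j) k)) \<le> 1 * \<delta>"
          unfolding norm_mult using uop_entry_le[OF u(1) fin ij(1) k] g'(2)[OF k ij(2)] by (intro mult_mono) auto
        moreover have "cmod ((f (ket k) i - g (ket k) i) * g' (ket j) k) \<le> \<delta> * 1"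
          unfolding norm_mult using uop_entry_le[OF gu(2) fin k ij(2)] g(2)[OF ij(1) k] d by (intro mult_mono) auto
        ultimately show "cmod (f (ket k) i * (f' (ket j) k - g' (ket j) k) + (f (ket k) i - g (ket k) i) * g' (ket j) k) \<le> 2 * \<delta>"
          by (intro norm_triangle_le) linarith
      qed
      also have "\<dots> < \<delta> * (2 * real (card T) + 1)" using d by (simp add: algebra_simps)
      also have "\<dots> = \<epsilon>" by (simp add: \<delta>_def add_pos_nonneg less_imp_neq[symmetric])
      finally show ?thesis .
    qed
    then show "\<exists>h\<in>G. \<forall>i\<in>T. \<forall>j\<in>T. cmod ((f \<circ> f') (ket j) i - h (ket j) i) < \<epsilon>"
      using comp_in[OF g(1) g'(1)] by blast
  qed
  show "inv f \<in> uclosure T G" if f: "f \<in> uclosure T G" for f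
    unfolding uclosure_def
  proof (intro CollectI conjI allI impI)
    have u: "f \<in> uop T" using f by (auto simp: uclosure_def)
    show "inv f \<in> uop T" using uop_bij u fin by blast
    fix \<epsilon> :: real assume e: "\<epsilon> > 0"
    obtain g where g: "g \<in> G" "\<And>i j. i \<in> T \<Longrightarrow> j \<in> T \<Longrightarrow> cmod (f (ket j) i - g (ket j) i) < \<epsilon>"
      using f e unfolding uclosure_def by blast
    have gu: "g \<in> uop T" using g sub by auto
    have "cmod (inv f (ket j) i - inv g (ket j) i) < \<epsilon>" if ij: "i \<in> T" "j \<in> T" for i j
      using g(2)[OF ij(2,1)]
      by (simp add: uop_inv_entry[OF u fin ij] uop_inv_entry[OF gu fin ij] complex_cnj_diff[symmetric] del: complex_cnj_diff)
    then show "\<exists>h\<in>G. \<forall>i\<in>T. \<forall>j\<in>T. cmod (inv f (ket j) i - h (ket j) i) < \<epsilon>"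
      using inv_in[OF g(1)] by blast
  qed
  show "f \<in> uclosure T G"
    if f: "f \<in> uop T" "\<And>\<epsilon>. \<epsilon> > 0 \<Longrightarrow> \<exists>g\<in>uclosure T G. \<forall>i\<in>T. \<forall>j\<in>T. cmod (f (ket j) i - g (ket j) i) < \<epsilon>" for f
    unfolding uclosure_def
  proof (intro CollectI conjI allI impI)
    show "f \<in> uop T" by (rule f)
    fix \<epsilon> :: real assume "\<epsilon> > 0"
    then have e: "\<epsilon> / 2 > 0" by simp
    obtain g where g: "g \<in> uclosure T G" "\<forall>i\<in>T. \<forall>j\<in>T. cmod (f (ket j) i - g (ket j) i) < \<epsilon> / 2"
      using f(2)[OF e] by blast
    obtain h where h: "h \<in> G" "\<forall>i\<in>T. \<forall>j\<in>T. cmod (g (ket j) i - h (ket j) i) < \<epsilon> / 2"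
      using g(1) e unfolding uclosure_def by blast
    have "\<forall>i\<in>T. \<forall>j\<in>T. cmod (f (ket j) i - h (ket j) i) < \<epsilon>"
      using g(2) h(2) norm_diff_triangle_less[where ?e1.0="\<epsilon> / 2" and ?e2.0="\<epsilon> / 2"] by (metis field_sum_of_halves)
    then show "\<exists>h\<in>G. \<forall>i\<in>T. \<forall>j\<in>T. cmod (f (ket j) i - h (ket j) i) < \<epsilon>" using h(1) by blast
  qed
qed

lemma (in ugroup) sub_uclosure: "G \<subseteq> uclosure T G"
proof
  fix f assume "f \<in> G"
  then show "f \<in> uclosure T G" unfolding uclosure_def using sub by (intro CollectI conjI allI impI bexI[of _ f]) auto
qed

section \<open>Lattice words and the tower of groups\<close>

text \<open>A standard tableau with two rows is encoded by the list of the rows of its boxes, the last box first;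
  \<open>True\<close> stands for the first row. Removing the last box is then removing the head of the list.\<close>

fun ht :: "bool list \<Rightarrow> int" where
  "ht [] = 0"
| "ht (b # w) = ht w + (if b then 1 else - 1)"

text \<open>\<open>A h\<close> is the diagonal entry of the last projection at a word \<open>True # False # u\<close> with \<open>ht u = h\<close>.\<close>

locale jones_data =
  fixes r :: nat and q :: complex and A :: "int \<Rightarrow> real"
  assumes r5: "r \<ge> 5" and q1: "cmod q = 1" and qI: "Im q \<noteq> 0"
    and A0: "A 0 = 0" and A1: "A (int r - 2) = 1"
    and A01: "\<And>h. 0 < h \<Longrightarrow> h < int r - 2 \<Longrightarrow> 0 < A h \<and> A h < 1"
    and braid: "(1 + q)\<^sup>2 * of_real (A 1) = q"
begin

text \<open>Walks from 0 on the segment 0, ..., r - 2, the truncated Bratteli diagram: the height is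
  the difference of the row lengths, and for k = 2 admissibility bounds it by r - 2.\<close>

fun path :: "bool list \<Rightarrow> bool" where
  "path [] = True"
| "path (b # w) \<longleftrightarrow> path w \<and> 0 \<le> ht (b # w) \<and> ht (b # w) \<le> int r - 2"

definition P :: "nat \<Rightarrow> bool list set" where
  "P n = {w. length w = n \<and> path w}"

definition B :: "int \<Rightarrow> real" where
  "B h = sqrt (A h * (1 - A h))"

fun sw :: "bool list \<Rightarrow> bool list" where
  "sw (b # c # u) = c # b # u"
| "sw w = w"

text \<open>Diagonal and, in \<open>cb\<close>, off-diagonal coefficients of z - (1 + z) E for the
  last projection E. With z free, the inverse generator is the same formula at \<open>cnj q\<close>.
  Words with fewer than two letters get the identity.\<close>

fun cf :: "complex \<Rightarrow> bool list \<Rightarrow> complex" where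
  "cf z (b # c # u) = (if b = c then z else z - (1 + z) * of_real (if b then A (ht u) else 1 - A (ht u)))"
| "cf z w = 1"

fun cb :: "complex \<Rightarrow> bool list \<Rightarrow> complex" where
  "cb z (b # c # u) = (if b = c then 0 else - (1 + z) * of_real (B (ht u)))"
| "cb z w = 0"

definition sgq :: "nat \<Rightarrow> complex \<Rightarrow> (bool list \<Rightarrow> complex) \<Rightarrow> bool list \<Rightarrow> complex" where
  "sgq n z v w = (if w \<in> P n then cf z w * v w + cb z w * v (sw w) else v w)"

text \<open>On n strands this is the generator with index n - 1, which acts on the last two steps of
  a path.\<close>

definition sg :: "nat \<Rightarrow> (bool list \<Rightarrow> complex) \<Rightarrow> bool list \<Rightarrow> complex" where
  "sg n = sgq n q"

text \<open>Inclusion of the braid group on one strand less. The result is only meaningful for operators that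
  preserve the height, because \<open>b # u'\<close> need not be a path.\<close>

definition lift :: "nat \<Rightarrow> ((bool list \<Rightarrow> complex) \<Rightarrow> bool list \<Rightarrow> complex) \<Rightarrow> (bool list \<Rightarrow> complex) \<Rightarrow> bool list \<Rightarrow> complex" where
  "lift n f v w = (case w of [] \<Rightarrow> v [] | b # u \<Rightarrow> if w \<in> P n then f (\<lambda>u'. v (b # u')) u else v w)"

primrec gen :: "nat \<Rightarrow> nat \<Rightarrow> (bool list \<Rightarrow> complex) \<Rightarrow> bool list \<Rightarrow> complex" where
  "gen 0 i = id"
| "gen (Suc n) i = (if i = n then sg (Suc n) else lift (Suc n) (gen n i))"

inductive_set Gam :: "nat \<Rightarrow> ((bool list \<Rightarrow> complex) \<Rightarrow> bool list \<Rightarrow> complex) set" for n where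
  one: "id \<in> Gam n"
| mul: "f \<in> Gam n \<Longrightarrow> 1 \<le> i \<Longrightarrow> i < n \<Longrightarrow> gen n i \<circ> f \<in> Gam n"
| mul_inv: "f \<in> Gam n \<Longrightarrow> 1 \<le> i \<Longrightarrow> i < n \<Longrightarrow> inv (gen n i) \<circ> f \<in> Gam n"

definition G :: "nat \<Rightarrow> ((bool list \<Rightarrow> complex) \<Rightarrow> bool list \<Rightarrow> complex) set" where
  "G n = uclosure (P n) (Gam n)"

definition blk :: "nat \<Rightarrow> (bool list \<Rightarrow> bool list \<Rightarrow> complex) \<Rightarrow> bool" where
  "blk n M \<longleftrightarrow> (\<forall>w\<in>P n. \<forall>u\<in>P n. ht w \<noteq> ht u \<longrightarrow> M w u = 0)"

text \<open>Unitary operators that preserve the height, hence the sectors; on them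
  \<open>lift\<close> is multiplicative and stays unitary.\<close>

definition UB :: "nat \<Rightarrow> ((bool list \<Rightarrow> complex) \<Rightarrow> bool list \<Rightarrow> complex) set" where
  "UB n = {mop (P n) M |M. mop (P n) M \<in> uop (P n) \<and> blk n M}"

lemma path_ht: "path w \<Longrightarrow> 0 \<le> ht w \<and> ht w \<le> int r - 2"
  using r5 by (cases w) auto

lemma ht_length: "\<bar>ht w\<bar> \<le> int (length w)" "even (ht w + int (length w))"
  by (induction w) auto

lemma finite_P: "finite (P n)"
proof -
  have "P n \<subseteq> {w. set w \<subseteq> UNIV \<and> length w = n}" by (auto simp: P_def)
  then show ?thesis using finite_lists_length_eq[of "UNIV :: bool set" n] finite_subset by auto
qed

lemma P_Cons: "b # w \<in> P (Suc n) \<longleftrightarrow> w \<in> P n \<and> 0 \<le> ht w + (if b then 1 else - 1) \<and> ht w + (if b then 1 else - 1) \<le> int r - 2"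
  by (auto simp: P_def)

lemma P_SucE:
  assumes "w \<in> P (Suc n)" obtains b u where "w = b # u" "u \<in> P n"
  using assms by (cases w) (auto simp: P_def)

lemma P_ht: "w \<in> P n \<Longrightarrow> 0 \<le> ht w \<and> ht w \<le> int r - 2 \<and> ht w \<le> int n \<and> even (ht w + int n)"
  using path_ht[of w] ht_length[of w] by (auto simp: P_def)

section \<open>Sector-preserving operators and their lifts\<close>

lemma UB_entry: "f \<in> UB n \<Longrightarrow> w \<in> P n \<Longrightarrow> u \<in> P n \<Longrightarrow> ht w \<noteq> ht u \<Longrightarrow> f (ket u) w = 0"
  by (auto simp: UB_def blk_def mop_ket finite_P)

lemma UB_uop: "UB n \<subseteq> uop (P n)" by (auto simp: UB_def)

lemma UB_I:
  assumes "f \<in> uop (P n)" "\<And>w u. w \<in> P n \<Longrightarrow> u \<in> P n \<Longrightarrow> ht w \<noteq> ht u \<Longrightarrow> f (ket u) w = 0"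
  shows "f \<in> UB n"
  using uop_eq_mop[OF assms(1) finite_P] assms unfolding UB_def blk_def by auto

text \<open>Entries between different heights vanish. This makes \<open>lift\<close> harmless on
  such operators: for u' of fixed length, whether a path u' can be extended by b depends on its
  height only.\<close>

lemma UB_local:
  assumes "f \<in> UB n" "w \<in> P n" "\<And>u. u \<in> P n \<Longrightarrow> ht u = ht w \<Longrightarrow> z u = z' u"
  shows "f z w = f z' w"
proof -
  have f: "f \<in> uop (P n)" using assms UB_uop by auto
  have "f (ket k) w * z k = f (ket k) w * z' k" if "k \<in> P n" for k
    using that assms UB_entry[OF assms(1,2)] by (cases "ht k = ht w") auto
  then have "(\<Sum>k\<in>P n. f (ket k) w * z k) = (\<Sum>k\<in>P n. f (ket k) w * z' k)" by (intro sum.cong) auto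
  then show ?thesis using uop_apply[OF f finite_P assms(2), of z] uop_apply[OF f finite_P assms(2), of z'] by simp
qed

lemma UB_ugroup: "ugroup (P n) (UB n)"
proof
  show "id \<in> UB n" using uop_id[OF finite_P] by (intro UB_I) (auto simp: ket_def)
  show "f \<circ> g \<in> UB n" if fg: "f \<in> UB n" "g \<in> UB n" for f g
  proof (rule UB_I)
    show "f \<circ> g \<in> uop (P n)" using fg UB_uop uop_comp by blast
    fix w u assume wu: "w \<in> P n" "u \<in> P n" "ht w \<noteq> ht u"
    have "f (g (ket u)) w = f (\<lambda>_. 0) w"
      using UB_local[OF fg(1) wu(1)] UB_entry[OF fg(2) _ wu(2)] wu(3) by metis
    moreover have "f \<in> uop (P n)" using fg UB_uop by blast
    ultimately show "(f \<circ> g) (ket u) w = 0" using uop_zero[of f "P n"] by simp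
  qed
  show "inv f \<in> UB n" if f: "f \<in> UB n" for f
  proof (rule UB_I)
    have u: "f \<in> uop (P n)" using f UB_uop by auto
    show "inv f \<in> uop (P n)" using u uop_bij finite_P by blast
    show "inv f (ket u) w = 0" if "w \<in> P n" "u \<in> P n" "ht w \<noteq> ht u" for w u
      using uop_inv_entry[OF u finite_P that(1,2)] UB_entry[OF f that(2,1)] that(3) by simp
  qed
qed (auto simp: finite_P UB_uop)

lemma lift_Cons: "b # u \<in> P n \<Longrightarrow> lift n f v (b # u) = f (\<lambda>u'. v (b # u')) u"
  by (simp add: lift_def)

lemma lift_out: "w \<notin> P n \<Longrightarrow> lift n f v w = v w"
  by (auto simp: lift_def split: list.split)

lemma lift_id: "lift n id = id"
  by (auto simp: lift_def fun_eq_iff split: list.split)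

lemma lift_comp:
  assumes f: "f \<in> UB n"
  shows "lift (Suc n) (f \<circ> g) = lift (Suc n) f \<circ> lift (Suc n) g"
proof (intro ext)
  fix v w
  show "lift (Suc n) (f \<circ> g) v w = (lift (Suc n) f \<circ> lift (Suc n) g) v w"
  proof (cases "w \<in> P (Suc n)")
    case True
    then obtain b u where w: "w = b # u" "u \<in> P n" using P_SucE by blast
    have "f (g (\<lambda>u'. v (b # u'))) u = f (\<lambda>u'. lift (Suc n) g v (b # u')) u"
    proof (rule UB_local[OF f w(2)])
      fix x assume "x \<in> P n" "ht x = ht u"
      then have "b # x \<in> P (Suc n)" using True w P_Cons by simp
      then show "g (\<lambda>u'. v (b # u')) x = lift (Suc n) g v (b # x)" by (simp add: lift_Cons)
    qed
    then show ?thesis using True w by (simp add: lift_Cons)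
  qed (simp add: lift_out)
qed

lemma lift_ket:
  assumes "f \<in> UB n" "b # w \<in> P (Suc n)"
  shows "lift (Suc n) f (ket (c # u)) (b # w) = (if b = c then f (ket u) w else 0)"
proof -
  have "f (\<lambda>_. 0) = (\<lambda>_. 0)" using assms UB_uop uop_zero by blast
  moreover have "(\<lambda>u'. ket (c # u) (b # u')) = (if b = c then ket u else (\<lambda>_. 0))"
    by (auto simp: ket_def fun_eq_iff)
  ultimately show ?thesis using assms by (simp add: lift_Cons)
qed

lemma lift_mop:
  assumes f: "f \<in> UB n"
  shows "lift (Suc n) f = mop (P (Suc n)) (\<lambda>i j. lift (Suc n) f (ket j) i)"
proof (intro ext)
  fix v w
  show "lift (Suc n) f v w = mop (P (Suc n)) (\<lambda>i j. lift (Suc n) f (ket j) i) v w"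
  proof (cases "w \<in> P (Suc n)")
    case True
    then obtain b u where w: "w = b # u" "u \<in> P n" using P_SucE by blast
    have fu: "f \<in> uop (P n)" using f UB_uop by auto
    have "(\<Sum>j\<in>P (Suc n). lift (Suc n) f (ket j) (b # u) * v j) = (\<Sum>j\<in>(#) b ` {x \<in> P n. b # x \<in> P (Suc n)}. lift (Suc n) f (ket j) (b # u) * v j)"
    proof (rule sum.mono_neutral_right[OF finite_P])
      show "\<forall>i\<in>P (Suc n) - (#) b ` {x \<in> P n. b # x \<in> P (Suc n)}. lift (Suc n) f (ket i) (b # u) * v i = 0"
      proof
        fix i assume i: "i \<in> P (Suc n) - (#) b ` {x \<in> P n. b # x \<in> P (Suc n)}"
        then obtain c x where x: "i = c # x" "x \<in> P n" using P_SucE by blast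
        then have "b \<noteq> c" using i by auto
        then show "lift (Suc n) f (ket i) (b # u) * v i = 0" using lift_ket[OF f] True w x by simp
      qed
    qed auto
    also have "\<dots> = (\<Sum>x\<in>{x \<in> P n. b # x \<in> P (Suc n)}. f (ket x) u * v (b # x))"
      using True w by (subst sum.reindex) (auto simp: lift_ket[OF f] inj_on_def intro!: sum.cong)
    also have "\<dots> = (\<Sum>x\<in>P n. f (ket x) u * v (b # x))"
    \<comment> \<open>A path that b cannot extend has a height different from that of u, so its
      coefficient is 0.\<close>
    proof (rule sum.mono_neutral_left[OF finite_P])
      show "\<forall>i\<in>P n - {x \<in> P n. b # x \<in> P (Suc n)}. f (ket i) u * v (b # i) = 0"
      proof
        fix i assume i: "i \<in> P n - {x \<in> P n. b # x \<in> P (Suc n)}"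
        then have "ht i \<noteq> ht u" using True w P_Cons by auto
        then show "f (ket i) u * v (b # i) = 0" using UB_entry[OF f w(2), of i] i by simp
      qed
    qed auto
    also have "\<dots> = lift (Suc n) f v (b # u)"
      using uop_apply[OF fu finite_P w(2), of "\<lambda>u'. v (b # u')"] lift_Cons[of b u "Suc n" f v] True
      unfolding w(1) by simp
    finally show ?thesis using True w by (simp add: mop_def)
  next
    case False
    then show ?thesis by (simp add: lift_out mop_def)
  qed
qed

lemma lift_UB:
  assumes f: "f \<in> UB n"
  shows "lift (Suc n) f \<in> UB (Suc n)" "inv (lift (Suc n) f) = lift (Suc n) (inv f)"
proof -
  interpret U: ugroup "P n" "UB n" by (rule UB_ugroup)
  have i: "inv f \<in> UB n" using U.inv_in f .
  have fu: "f \<in> uop (P n)" using f UB_uop by auto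
  have c: "lift (Suc n) f \<circ> lift (Suc n) (inv f) = id" "lift (Suc n) (inv f) \<circ> lift (Suc n) f = id"
    using lift_comp[OF f, of "inv f"] lift_comp[OF i, of f] U.inv_cancel[OF f] lift_id by auto
  then show "inv (lift (Suc n) f) = lift (Suc n) (inv f)" by (metis inv_unique_comp)
  let ?M = "\<lambda>i j. lift (Suc n) f (ket j) i"
  have "mop (P (Suc n)) (adj ?M) = mop (P (Suc n)) (\<lambda>i j. lift (Suc n) (inv f) (ket j) i)"
  proof (rule mop_cong)
    fix x y assume xy: "x \<in> P (Suc n)" "y \<in> P (Suc n)"
    obtain b u where x: "x = b # u" "u \<in> P n" using xy P_SucE by blast
    obtain c w where y: "y = c # w" "w \<in> P n" using xy P_SucE by blast
    show "adj ?M x y = lift (Suc n) (inv f) (ket y) x"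
      using xy uop_inv_entry[OF fu finite_P x(2) y(2)] unfolding adj_def x(1) y(1)
      by (simp add: lift_ket f i)
  qed
  then have e: "mop (P (Suc n)) (adj ?M) = lift (Suc n) (inv f)" using lift_mop[OF i] by simp
  have "lift (Suc n) f \<in> uop (P (Suc n))"
    unfolding uop_def using c lift_mop[OF f] e by (intro CollectI exI[of _ ?M]) simp
  then show "lift (Suc n) f \<in> UB (Suc n)"
  proof (rule UB_I)
    fix x y assume xy: "x \<in> P (Suc n)" "y \<in> P (Suc n)" "ht x \<noteq> ht y"
    obtain b u where x: "x = b # u" "u \<in> P n" using xy P_SucE by blast
    obtain c w where y: "y = c # w" "w \<in> P n" using xy P_SucE by blast
    show "lift (Suc n) f (ket y) x = 0"
      using xy UB_entry[OF f x(2) y(2)] unfolding x(1) y(1) by (auto simp: lift_ket f)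
  qed
qed

section \<open>The last generator\<close>

lemma Im_q_real: "q \<noteq> of_real t"
  using qI by auto

text \<open>Otherwise \<open>q * (1 - t) = t\<close> with t real, and q would be real. It keeps the
  diagonal entries of the last generator nonzero, as \<open>swapper\<close> and
  \<open>plG_bridge\<close> require.\<close>

lemma coef_nz: "q - (1 + q) * of_real t \<noteq> 0"
proof
  assume "q - (1 + q) * of_real t = 0"
  then have *: "q * of_real (1 - t) = of_real t" by (simp add: algebra_simps)
  show False
  proof (cases "t = 1")
    case True then show False using * by simp
  next
    case False
    then have "q = of_real (t / (1 - t))" using * by (simp add: field_simps)
    then show False using Im_q_real by blast
  qed
qed

lemma q_plus: "1 + q \<noteq> 0"
  using Im_q_real[of "-1"] by (metis add_eq_0_iff of_real_1 of_real_minus)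

lemma A_bounds: "0 \<le> h \<Longrightarrow> h \<le> int r - 2 \<Longrightarrow> 0 \<le> A h \<and> A h \<le> 1"
  using A0 A1 A01[of h] by (cases "h = 0"; cases "h = int r - 2") auto

lemma B_sq: "0 \<le> h \<Longrightarrow> h \<le> int r - 2 \<Longrightarrow> (B h)\<^sup>2 = A h * (1 - A h)"
  using A_bounds[of h] by (simp add: B_def)

lemma sg_coefs:
  assumes "0 \<le> t" "t \<le> 1"
  shows "(cmod (q - (1 + q) * of_real t))\<^sup>2 + (cmod (- (1 + q) * of_real (sqrt (t * (1 - t)))))\<^sup>2 = 1"
    "- ((- q) * cnj (- (1 + q) * of_real s)) = - (1 + q) * of_real s"
    "(- q) * cnj (q - (1 + q) * of_real t) = q - (1 + q) * of_real (1 - t)"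
proof -
  have qq: "q * cnj q = 1" using q1 unit_cnj by auto
  define b where "b = complex_of_real (sqrt (t * (1 - t)))"
  have "sqrt (t * (1 - t)) * sqrt (t * (1 - t)) = t * (1 - t)" using assms by simp
  then have bb: "b * b = of_real t * (1 - of_real t)"
    unfolding b_def of_real_mult[symmetric] by simp
  have cb: "cnj b = b" by (simp add: b_def)
  have "(q - (1 + q) * of_real t) * cnj (q - (1 + q) * of_real t) + (- (1 + q) * b) * cnj (- (1 + q) * b)
    = q * cnj q - of_real t * (q * (1 + cnj q) + (1 + q) * cnj q) + (1 + q) * (1 + cnj q) * (of_real t * of_real t + b * b)"
    by (simp add: cb algebra_simps)
  also have "\<dots> = q * cnj q + of_real t * (1 - q * cnj q)"
    unfolding bb by (simp add: algebra_simps)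
  finally show "(cmod (q - (1 + q) * of_real t))\<^sup>2 + (cmod (- (1 + q) * of_real (sqrt (t * (1 - t)))))\<^sup>2 = 1"
    unfolding unit_norm_cnj b_def using qq by simp
  have "- ((- q) * cnj (- (1 + q) * of_real s)) = - (q + q * cnj q) * of_real s" by (simp add: algebra_simps)
  then show "- ((- q) * cnj (- (1 + q) * of_real s)) = - (1 + q) * of_real s" using qq by (simp add: algebra_simps)
  have "(- q) * cnj (q - (1 + q) * of_real t) = - (q * cnj q) + (q + q * cnj q) * of_real t" by (simp add: algebra_simps)
  then show "(- q) * cnj (q - (1 + q) * of_real t) = q - (1 + q) * of_real (1 - t)" using qq by (simp add: algebra_simps)
qed

text \<open>In the plane the generator has eigenvalues q and - 1, whence the determinant - q. Both
  orders of the pair are recorded because later arguments start from either word.\<close>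

lemma sg_plan:
  assumes "True # False # u \<in> P n" "False # True # u \<in> P n"
  shows "plan (True # False # u) (False # True # u) (sg n) (q - (1 + q) * of_real (A (ht u))) (- (1 + q) * of_real (B (ht u))) (- q)"
    "plan (False # True # u) (True # False # u) (sg n) (q - (1 + q) * of_real (1 - A (ht u))) (- (1 + q) * of_real (B (ht u))) (- q)"
proof -
  have "path u" using assms by (auto simp: P_def)
  then have t: "0 \<le> A (ht u)" "A (ht u) \<le> 1" using A_bounds path_ht by auto
  have c1: "- (- q * cnj (- (1 + q) * of_real (B (ht u)))) = - (1 + q) * of_real (B (ht u))"
    using sg_coefs(2)[OF t] .
  note n1 = sg_coefs(1)[OF t, folded B_def]
  note d1 = sg_coefs(3)[OF t]
  have "(cmod (q - (1 + q) * of_real (1 - A (ht u))))\<^sup>2 + (cmod (- (1 + q) * of_real (B (ht u))))\<^sup>2 = 1"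
    using sg_coefs(1)[of "1 - A (ht u)"] t unfolding B_def by (simp add: mult.commute)
  note n2 = this
  have d2: "- q * cnj (q - (1 + q) * of_real (1 - A (ht u))) = q - (1 + q) * of_real (A (ht u))"
    using sg_coefs(3)[of "1 - A (ht u)"] t by simp
  show "plan (True # False # u) (False # True # u) (sg n) (q - (1 + q) * of_real (A (ht u))) (- (1 + q) * of_real (B (ht u))) (- q)"
    unfolding plan_def
  proof (intro conjI allI)
    show "sg n v (True # False # u) = (q - (1 + q) * of_real (A (ht u))) * v (True # False # u) - - q * cnj (- (1 + q) * of_real (B (ht u))) * v (False # True # u)" for v
      unfolding diff_conv_add_uminus[of "_ * v (True # False # u)"] mult_minus_left[symmetric, of "- q * _" "v _"] c1
      using assms by (simp add: sg_def sgq_def)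
    show "sg n v (False # True # u) = - (1 + q) * of_real (B (ht u)) * v (True # False # u) + - q * cnj (q - (1 + q) * of_real (A (ht u))) * v (False # True # u)" for v
      unfolding d1 using assms by (simp add: sg_def sgq_def)
  qed (use n1 q1 in auto)
  show "plan (False # True # u) (True # False # u) (sg n) (q - (1 + q) * of_real (1 - A (ht u))) (- (1 + q) * of_real (B (ht u))) (- q)"
    unfolding plan_def
  proof (intro conjI allI)
    show "sg n v (False # True # u) = (q - (1 + q) * of_real (1 - A (ht u))) * v (False # True # u) - - q * cnj (- (1 + q) * of_real (B (ht u))) * v (True # False # u)" for v
      unfolding diff_conv_add_uminus[of "_ * v (False # True # u)"] mult_minus_left[symmetric, of "- q * _" "v _"] c1
      using assms by (simp add: sg_def sgq_def)
    show "sg n v (True # False # u) = - (1 + q) * of_real (B (ht u)) * v (False # True # u) + - q * cnj (q - (1 + q) * of_real (1 - A (ht u))) * v (True # False # u)" for v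
      unfolding d2 using assms by (simp add: sg_def sgq_def)
  qed (use n2 q1 in auto)
qed

text \<open>For the second part: at the lower wall \<open>True # False # u\<close> is not a path and
  \<open>A 0 = 0\<close>, so the last projection is the identity on the remaining word.\<close>

lemma sg_scal:
  "b # b # u \<in> P n \<Longrightarrow> scal (sg n) (b # b # u) q"
  "False # True # u \<in> P n \<Longrightarrow> ht u = 0 \<Longrightarrow> scal (sg n) (False # True # u) (- 1)"
  using q1 A0 by (auto simp: scal_def sg_def sgq_def B_def)

lemma sw_simps: "sw (sw w) = w" "ht (sw w) = ht w" "length (sw w) = length w" "cb z (sw w) = cb z w"
  by (cases w rule: sw.cases; auto)+

text \<open>\<open>B\<close> vanishes at the walls 0 and r - 2, and strictly between them both
  orders of an up and a down step stay inside the strip.\<close>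

lemma cb_nz:
  assumes "w \<in> P n" "cb z w \<noteq> 0" shows "sw w \<in> P n" "sw w \<noteq> w"
proof -
  obtain b c u where w: "w = b # c # u" using assms by (cases w rule: sw.cases) auto
  then have bc: "b \<noteq> c" "B (ht u) \<noteq> 0" using assms by (auto split: if_splits)
  have pu: "path u" using assms w by (auto simp: P_def)
  have "A (ht u) \<noteq> 0" "A (ht u) \<noteq> 1" using bc(2) by (auto simp: B_def)
  then have "ht u \<noteq> 0" "ht u \<noteq> int r - 2" using A0 A1 by auto
  then have "0 < ht u" "ht u < int r - 2" using path_ht[OF pu] by auto
  then show "sw w \<in> P n" "sw w \<noteq> w" using assms(1) w bc(1) by (auto simp: P_def)
qed

text \<open>The two entries in a row of the product of z - (1 + z) E and z' - (1 + z') E, where E is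
  idempotent.\<close>

lemma cf_cb:
  assumes w: "w \<in> P n" and z: "z * z' = 1"
  shows "cf z w * cf z' w + cb z w * cb z' w = 1" "cf z w * cb z' w + cb z w * cf z' (sw w) = 0"
proof -
  have "(cf z w * cf z' w + cb z w * cb z' w = 1) \<and> (cf z w * cb z' w + cb z w * cf z' (sw w) = 0)"
  proof (cases w rule: sw.cases)
    case (1 b c u)
    have "path u" using w 1 by (auto simp: P_def)
    then have BB: "of_real (B (ht u)) * of_real (B (ht u)) = of_real (A (ht u)) * (1 - complex_of_real (A (ht u)))"
      using B_sq[of "ht u"] path_ht[of u] by (metis of_real_1 of_real_diff of_real_mult power2_eq_square)
    have *: "(z - (1 + z) * a) * (z' - (1 + z') * a) + (1 + z) * (1 + z') * (a * (1 - a)) = 1" for a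
    proof -
      have "(z - (1 + z) * a) * (z' - (1 + z') * a) + (1 + z) * (1 + z') * (a * (1 - a)) = z * z' + a * (1 - z * z')"
        by (simp add: algebra_simps)
      then show ?thesis by (simp add: z)
    qed
    have **: "(z - (1 + z) * a) * (- (1 + z') * b) + (- (1 + z) * b) * (z' - (1 + z') * (1 - a)) = 0" for a b
    proof -
      have "(z - (1 + z) * a) * (- (1 + z') * b) + (- (1 + z) * b) * (z' - (1 + z') * (1 - a)) = b * (1 - z * z')"
        by (simp add: algebra_simps)
      then show ?thesis by (simp add: z)
    qed
    show ?thesis
    proof (cases "b = c")
      case True then show ?thesis using 1 z by simp
    next
      case False
      have e1: "cb z w * cb z' w = (1 + z) * (1 + z') * (of_real (B (ht u)) * of_real (B (ht u)))"
        using 1 False by (simp add: algebra_simps)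
      show ?thesis
        unfolding e1 BB using *[of "of_real (A (ht u))"] *[of "1 - of_real (A (ht u))"]
          **[of "of_real (A (ht u))" "of_real (B (ht u))"] **[of "1 - of_real (A (ht u))" "of_real (B (ht u))"] 1 False
        by (cases b) (auto simp: mult.commute)
    qed
  qed auto
  then show "cf z w * cf z' w + cb z w * cb z' w = 1" "cf z w * cb z' w + cb z w * cf z' (sw w) = 0" by auto
qed

lemma sgq_inverse:
  assumes "z * z' = 1" shows "sgq n z \<circ> sgq n z' = id"
proof (intro ext)
  fix v w
  show "(sgq n z \<circ> sgq n z') v w = id v w"
  proof (cases "w \<in> P n")
    case w: True
    have "cb z w * sgq n z' v (sw w) = cb z w * (cf z' (sw w) * v (sw w) + cb z' w * v w)"
      using cb_nz[OF w, of z] by (cases "cb z w = 0") (auto simp: sgq_def sw_simps)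
    then have "(sgq n z \<circ> sgq n z') v w = (cf z w * cf z' w + cb z w * cb z' w) * v w
       + (cf z w * cb z' w + cb z w * cf z' (sw w)) * v (sw w)"
      using w by (simp add: sgq_def algebra_simps)
    then show ?thesis unfolding cf_cb[OF w assms] by simp
  qed (simp add: sgq_def)
qed

lemma sgq_mop: "sgq n z = mop (P n) (\<lambda>w x. sgq n z (ket x) w)"
proof (intro ext)
  fix v w
  show "sgq n z v w = mop (P n) (\<lambda>w x. sgq n z (ket x) w) v w"
  proof (cases "w \<in> P n")
    case w: True
    have "(\<Sum>x\<in>P n. sgq n z (ket x) w * v x) = (\<Sum>x\<in>P n. cf z w * (ket w x * v x)) + (\<Sum>x\<in>P n. cb z w * (ket (sw w) x * v x))"
      using w by (subst sum.distrib[symmetric]) (auto simp: sgq_def ket_def algebra_simps intro!: sum.cong)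
    also have "(\<Sum>x\<in>P n. cf z w * (ket w x * v x)) = cf z w * v w"
      using w finite_P by (simp add: ket_def sum_distrib_left[symmetric] if_distrib[of "\<lambda>x. x * _"] cong: if_cong)
    also have "(\<Sum>x\<in>P n. cb z w * (ket (sw w) x * v x)) = cb z w * v (sw w)"
      using cb_nz[OF w, of z] finite_P
      by (cases "cb z w = 0") (simp_all add: ket_def sum_distrib_left[symmetric] if_distrib[of "\<lambda>x. x * _"] cong: if_cong)
    finally show ?thesis using w by (simp add: mop_def sgq_def)
  qed (simp add: sgq_def mop_def)
qed

lemma cf_cnj: "cnj (cf z w) = cf (cnj z) w" "cnj (cb z w) = cb (cnj z) w"
  by (cases w rule: sw.cases; auto)+

lemma sg_UB: "sg n \<in> UB n"
proof (rule UB_I)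
  have qq: "q * cnj q = 1" "cnj q * q = 1" using q1 unit_cnj by auto
  have "adj (\<lambda>w x. sgq n q (ket x) w) w x = sgq n (cnj q) (ket x) w" if "w \<in> P n" "x \<in> P n" for w x
  proof -
    have "cb z w * ket x (sw w) = cb z x * ket w (sw x)" for z
      using sw_simps(1)[of w] sw_simps(1)[of x] sw_simps(4)[of z w] by (auto simp: ket_def)
    then show ?thesis using that
      by (auto simp: adj_def sgq_def cf_cnj ket_def sw_simps)
  qed
  then have "mop (P n) (adj (\<lambda>w x. sgq n q (ket x) w)) = sgq n (cnj q)"
    by (subst sgq_mop[of n "cnj q"], intro mop_cong) auto
  then show "sg n \<in> uop (P n)"
    unfolding sg_def uop_def using sgq_mop[of n q] sgq_inverse[OF qq(1), of n] sgq_inverse[OF qq(2), of n]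
    by (intro CollectI exI[of _ "\<lambda>w x. sgq n q (ket x) w"]) simp
  show "sg n (ket u) w = 0" if "w \<in> P n" "u \<in> P n" "ht w \<noteq> ht u" for w u
    using that sw_simps(2)[of w] by (auto simp: sg_def sgq_def ket_def)
qed

section \<open>The image of the braid group and its closure\<close>

lemma gen_UB: "gen n i \<in> UB n"
proof (induction n)
  case 0
  interpret ugroup "P 0" "UB 0" by (rule UB_ugroup)
  show ?case by (simp only: gen.simps id_in)
next
  case (Suc n)
  then show ?case using sg_UB lift_UB(1) by simp
qed

lemma Gam_UB: "f \<in> Gam n \<Longrightarrow> f \<in> UB n"
proof (induction rule: Gam.induct)
  case one
  interpret ugroup "P n" "UB n" by (rule UB_ugroup)
  show ?case by (rule id_in)
next
  case (mul f i)
  interpret ugroup "P n" "UB n" by (rule UB_ugroup)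
  show ?case using mul comp_in gen_UB by blast
next
  case (mul_inv f i)
  interpret ugroup "P n" "UB n" by (rule UB_ugroup)
  show ?case using mul_inv comp_in inv_in gen_UB by blast
qed

lemma Gam_comp: "f \<in> Gam n \<Longrightarrow> g \<in> Gam n \<Longrightarrow> f \<circ> g \<in> Gam n"
  by (induction rule: Gam.induct) (auto simp: comp_assoc intro: Gam.intros)

lemma gen_Gam: "1 \<le> i \<Longrightarrow> i < n \<Longrightarrow> gen n i \<in> Gam n" "1 \<le> i \<Longrightarrow> i < n \<Longrightarrow> inv (gen n i) \<in> Gam n"
  using Gam.mul[OF Gam.one] Gam.mul_inv[OF Gam.one] by (simp_all only: comp_id)

lemma Gam_inv: "f \<in> Gam n \<Longrightarrow> inv f \<in> Gam n"
proof (induction rule: Gam.induct)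
  case one
  then show ?case using Gam.one by (simp only: inv_id)
next
  case (mul f i)
  interpret ugroup "P n" "UB n" by (rule UB_ugroup)
  have "inv (gen n i \<circ> f) = inv f \<circ> inv (gen n i)"
    using bij_in gen_UB Gam_UB mul by (intro o_inv_distrib) auto
  then show ?case using Gam_comp mul gen_Gam by metis
next
  case (mul_inv f i)
  interpret ugroup "P n" "UB n" by (rule UB_ugroup)
  have "inv (inv (gen n i) \<circ> f) = inv f \<circ> inv (inv (gen n i))"
    using bij_in inv_in gen_UB Gam_UB mul_inv by (intro o_inv_distrib) auto
  also have "inv (inv (gen n i)) = gen n i" using bij_in[OF gen_UB] by (rule inv_inv_eq)
  finally show ?case using Gam_comp mul_inv gen_Gam by metis
qed

lemma Gam_ugroup: "ugroup (P n) (Gam n)"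
  using finite_P Gam_UB UB_uop Gam.one Gam_comp Gam_inv by unfold_locales blast+

lemma G_cgroup: "cgroup (P n) (G n)"
  unfolding G_def using ugroup.uclosure_cgroup[OF Gam_ugroup] .

lemma Gam_G: "f \<in> Gam n \<Longrightarrow> f \<in> G n"
  unfolding G_def using ugroup.sub_uclosure[OF Gam_ugroup] by blast

lemma G_UB: "f \<in> G n \<Longrightarrow> f \<in> UB n"
proof (rule UB_I)
  assume f: "f \<in> G n"
  then show "f \<in> uop (P n)" by (auto simp: G_def uclosure_def)
  fix w u assume wu: "w \<in> P n" "u \<in> P n" "ht w \<noteq> ht u"
  show "f (ket u) w = 0"
  proof (rule ccontr)
    assume "f (ket u) w \<noteq> 0"
    then have "cmod (f (ket u) w) > 0" by simp
    then obtain g where g: "g \<in> Gam n" "cmod (f (ket u) w - g (ket u) w) < cmod (f (ket u) w)"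
      using f wu(1,2) unfolding G_def uclosure_def by blast
    then show False using UB_entry[OF Gam_UB[OF g(1)] wu] by simp
  qed
qed

lemma lift_Gam: "f \<in> Gam n \<Longrightarrow> lift (Suc n) f \<in> Gam (Suc n)"
proof (induction rule: Gam.induct)
  case one
  then show ?case using Gam.one by (simp only: lift_id)
next
  case (mul f i)
  have "lift (Suc n) (gen n i \<circ> f) = gen (Suc n) i \<circ> lift (Suc n) f"
    using mul by (simp add: lift_comp[OF gen_UB])
  then show ?case using Gam.mul[of _ "Suc n" i] mul by (simp only:)
next
  case (mul_inv f i)
  interpret ugroup "P n" "UB n" by (rule UB_ugroup)
  have "lift (Suc n) (inv (gen n i) \<circ> f) = inv (gen (Suc n) i) \<circ> lift (Suc n) f"
    using mul_inv lift_UB(2)[OF gen_UB] by (simp add: lift_comp[OF inv_in[OF gen_UB]])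
  then show ?case using Gam.mul_inv[of _ "Suc n" i] mul_inv by (simp only:)
qed

lemma lift_G:
  assumes "f \<in> G n" shows "lift (Suc n) f \<in> G (Suc n)"
  unfolding G_def uclosure_def
proof (intro CollectI conjI allI impI)
  show "lift (Suc n) f \<in> uop (P (Suc n))" using lift_UB(1)[OF G_UB[OF assms]] UB_uop by blast
  fix \<epsilon> :: real assume e: "\<epsilon> > 0"
  obtain g where g: "g \<in> Gam n" "\<forall>i\<in>P n. \<forall>j\<in>P n. cmod (f (ket j) i - g (ket j) i) < \<epsilon>"
    using assms e unfolding G_def uclosure_def by blast
  have "cmod (lift (Suc n) f (ket j) i - lift (Suc n) g (ket j) i) < \<epsilon>" if ij: "i \<in> P (Suc n)" "j \<in> P (Suc n)" for i j
  proof -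
    obtain b u where x: "i = b # u" "u \<in> P n" using ij P_SucE by blast
    obtain c w where y: "j = c # w" "w \<in> P n" using ij P_SucE by blast
    show ?thesis using ij g(2) x(2) y(2) e unfolding x(1) y(1)
      by (simp add: lift_ket G_UB[OF assms] Gam_UB[OF g(1)])
  qed
  then show "\<exists>h\<in>Gam (Suc n). \<forall>i\<in>P (Suc n). \<forall>j\<in>P (Suc n). cmod (lift (Suc n) f (ket j) i - h (ket j) i) < \<epsilon>"
    using lift_Gam[OF g(1)] by blast
qed

lemma sg_G: "n \<ge> 2 \<Longrightarrow> sg n \<in> G n"
  using Gam_G[OF gen_Gam(1)[of "n - 1" n]] by (cases n) auto

text \<open>The sector of height h occurs in the sectors h + 1 and h - 1 on one strand more, so one
  rotation becomes two simultaneous ones; at a wall one of the two factors is missing.\<close>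

lemma lift_rot:
  assumes "u \<noteq> u'" "u \<in> P n" "u' \<in> P n" "ht u = ht u'"
  shows "lift (Suc n) (rot u u' x y) =
    (if True # u \<in> P (Suc n) then rot (True # u) (True # u') x y else id) \<circ>
    (if False # u \<in> P (Suc n) then rot (False # u) (False # u') x y else id)"
proof (intro ext)
  fix v w
  have P: "b # u \<in> P (Suc n) \<longleftrightarrow> b # u' \<in> P (Suc n)" for b using assms by (simp add: P_Cons)
  show "lift (Suc n) (rot u u' x y) v w = ((if True # u \<in> P (Suc n) then rot (True # u) (True # u') x y else id) \<circ>
    (if False # u \<in> P (Suc n) then rot (False # u) (False # u') x y else id)) v w"
  proof (cases "w \<in> P (Suc n)")
    case True
    then obtain b z where w: "w = b # z" "z \<in> P n" using P_SucE by blast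
    show ?thesis using True assms(1) P unfolding w(1) by (cases b) (auto simp: lift_Cons rot_def)
  next
    case False
    then have "b # u \<in> P (Suc n) \<Longrightarrow> w \<noteq> b # u \<and> w \<noteq> b # u'" for b using P by metis
    then show ?thesis using False by (auto simp: lift_out rot_def)
  qed
qed

end

section \<open>The inductive step\<close>

lemma plan_torus:
  assumes "a \<noteq> b" "\<And>v. t v a = cis \<phi> * v a" "\<And>v. t v b = v b"
  shows "plan a b t (cis \<phi>) 0 (cis \<phi>)" "\<exists>\<tau> c. plan a b t \<tau> 0 c \<and> \<tau> = cis \<phi> * (c * cnj \<tau>)"
proof -
  show 1: "plan a b t (cis \<phi>) 0 (cis \<phi>)" using assms by (auto simp: plan_def unit_cnj)
  show "\<exists>\<tau> c. plan a b t \<tau> 0 c \<and> \<tau> = cis \<phi> * (c * cnj \<tau>)"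
    using 1 by (intro exI[of _ "cis \<phi>"] conjI) (auto simp: unit_cnj)
qed

lemma (in ugroup) plG_star:
  assumes "c \<in> S" "S \<subseteq> T" "\<And>z. z \<in> S \<Longrightarrow> z \<noteq> c \<Longrightarrow> plG G z c" "z \<in> S" "z' \<in> S" "z \<noteq> z'"
  shows "plG G z z'"
proof (cases "z = c \<or> z' = c")
  case True
  then show ?thesis using assms plG_sym by metis
next
  case False
  have "plG G z c" "plG G c z'" using assms False plG_sym by metis+
  then show ?thesis using assms False plG_trans[of z c z'] by blast
qed

context jones_data
begin

text \<open>Heights that do not occur at level n satisfy this vacuously, so the inductive step can
  be stated for all integers.\<close>

definition full :: "nat \<Rightarrow> int \<Rightarrow> bool" where
  "full n h \<longleftrightarrow> (\<forall>u\<in>P n. \<forall>u'\<in>P n. ht u = h \<longrightarrow> ht u' = h \<longrightarrow> u \<noteq> u' \<longrightarrow> plG (G n) u u')"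

lemma word_exists:
  assumes "int h \<le> int r - 2"
  shows "\<exists>w\<in>P (h + 2 * m). ht w = int h"
proof (induction m)
  case 0
  have "replicate h True \<in> P h \<and> ht (replicate h True) = int h" using assms
    by (induction h) (auto simp: P_def)
  then show ?case by auto
next
  case (Suc m)
  then obtain w where w: "w \<in> P (h + 2 * m)" "ht w = int h" by blast
  show ?case
  proof (cases "h = 0")
    case True
    then have "False # True # w \<in> P (h + 2 * Suc m)" using w r5 by (auto simp: P_def)
    then show ?thesis using w by (intro bexI[of _ "False # True # w"]) auto
  next
    case False
    then have "True # False # w \<in> P (h + 2 * Suc m)" using w assms by (auto simp: P_def)
    then show ?thesis using w by (intro bexI[of _ "True # False # w"]) auto
  qed
qed

lemma word_exists':
  assumes "0 \<le> h" "h \<le> int r - 2" "h \<le> int n" "even (h + int n)"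
  obtains w where "w \<in> P n" "ht w = h"
proof -
  have "even (int (nat h + n))" using assms(1,4) by simp
  then have "even (nat h + n)" by (simp only: even_of_nat)
  then have "even (n - nat h)" by (simp add: even_diff_nat add.commute)
  then obtain m where "n - nat h = 2 * m" by blast
  then have "n = nat h + 2 * m" using assms by linarith
  then show ?thesis using word_exists[of "nat h" m] assms that by auto
qed

lemma second_word:
  assumes "a \<in> P n" "ht a = 1" "n \<ge> 3"
  obtains b where "b \<in> P n" "ht b = 1" "b \<noteq> a"
proof -
  have o: "odd n" using P_ht[OF assms(1)] assms(2) by auto
  define k where "k = n - 2"
  have n: "n = Suc (Suc k)" using assms(3) by (simp add: k_def)
  obtain w where w: "w \<in> P k" "ht w = 1"
    using word_exists'[of 1 k] o n r5 assms(3) by auto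
  have "True # False # w \<in> P n" "False # True # w \<in> P n" using w n r5 by (auto simp: P_def)
  then show ?thesis using that[of "True # False # w"] that[of "False # True # w"] w by (cases "a = True # False # w") auto
qed

lemma lift_in:
  assumes "full n h" "h = ht u" "ht u' = h" "u \<in> P n" "u' \<in> P n" "u \<noteq> u'" "(cmod x)\<^sup>2 + (cmod y)\<^sup>2 = 1"
  shows "lift (Suc n) (rot u u' x y) \<in> G (Suc n)"
  using assms lift_G unfolding full_def plG_def by blast

lemma G_ugroup: "ugroup (P n) (G n)"
  using G_cgroup cgroup.axioms(1) by blast

lemma B_pos: "0 < h \<Longrightarrow> h < int r - 2 \<Longrightarrow> B h > 0"
  using A01[of h] by (simp add: B_def)

lemma sg_plan':
  assumes "u \<in> P k" "0 < ht u" "ht u < int r - 2"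
  shows "\<exists>x y c. plan (True # False # u) (False # True # u) (sg (Suc (Suc k))) x y c \<and> x \<noteq> 0 \<and> y \<noteq> 0"
    "\<exists>x y c. plan (False # True # u) (True # False # u) (sg (Suc (Suc k))) x y c \<and> x \<noteq> 0 \<and> y \<noteq> 0"
proof -
  have p: "True # False # u \<in> P (Suc (Suc k))" "False # True # u \<in> P (Suc (Suc k))"
    using assms by (auto simp: P_Cons)
  have y: "- (1 + q) * complex_of_real (B (ht u)) \<noteq> 0"
    using q_plus B_pos[OF assms(2,3)] by (metis mult_eq_0_iff neg_equal_0_iff_equal of_real_eq_0_iff less_irrefl)
  show "\<exists>x y c. plan (True # False # u) (False # True # u) (sg (Suc (Suc k))) x y c \<and> x \<noteq> 0 \<and> y \<noteq> 0"
    using sg_plan(1)[OF p] y coef_nz by blast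
  show "\<exists>x y c. plan (False # True # u) (True # False # u) (sg (Suc (Suc k))) x y c \<and> x \<noteq> 0 \<and> y \<noteq> 0"
    using sg_plan(2)[OF p] y coef_nz by blast
qed

text \<open>Every word of height 0 comes down from height 1 in its last step. Rotations lifted from
  height 1 therefore reach all of these words, each with a twin in height 2 that is divided
  out.\<close>

lemma full_0:
  assumes "full (Suc k) 1" "full (Suc (Suc k)) 2" shows "full (Suc (Suc k)) 0"
  unfolding full_def
proof (intro ballI impI)
  fix w w' assume w: "w \<in> P (Suc (Suc k))" "w' \<in> P (Suc (Suc k))" "ht w = 0" "ht w' = 0" "w \<noteq> w'"
  interpret ugroup "P (Suc (Suc k))" "G (Suc (Suc k))" by (rule G_ugroup)
  obtain b z where z: "w = b # z" "z \<in> P (Suc k)" using w P_SucE by blast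
  obtain b' z' where z': "w' = b' # z'" "z' \<in> P (Suc k)" using w P_SucE by blast
  have b: "b = False" "ht z = 1" "b' = False" "ht z' = 1" using w z z' P_ht[OF z(2)] P_ht[OF z'(2)]
    by (auto split: if_splits)
  have ne: "z \<noteq> z'" using w z z' b by auto
  have P: "True # z \<in> P (Suc (Suc k))" "True # z' \<in> P (Suc (Suc k))" "False # z \<in> P (Suc (Suc k))"
    using z z' b r5 by (auto simp: P_Cons)
  show "plG (G (Suc (Suc k))) w w'"
    unfolding plG_def
  proof (intro allI impI)
    fix x y assume xy: "(cmod x)\<^sup>2 + (cmod y)\<^sup>2 = 1"
    let ?A = "rot (True # z) (True # z') x y" and ?B = "rot (False # z) (False # z') x y"
    have "?A \<circ> ?B \<in> G (Suc (Suc k))"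
      using lift_in[OF assms(1) b(2)[symmetric] b(4) z(2) z'(2) ne xy] lift_rot[OF ne z(2) z'(2)] b P by simp
    moreover have A: "?A \<in> G (Suc (Suc k))"
      using assms(2) P b ne xy unfolding full_def plG_def by auto
    ultimately have "inv ?A \<circ> (?A \<circ> ?B) \<in> G (Suc (Suc k))" using comp_in inv_in by blast
    also have "inv ?A \<circ> (?A \<circ> ?B) = ?B" using inv_cancel(1)[OF A] by (simp add: comp_assoc[symmetric])
    finally show "rot w w' x y \<in> G (Suc (Suc k))" using z z' b by simp
  qed
qed

text \<open>Rotations lifted from height j + 1 act in heights j and j + 2; dividing out the known
  part in j serves the words of height j + 2 whose last step goes up. Those that come down from
  height j + 3 are attached by the last generator through \<open>plG_bridge\<close>.\<close>

lemma full_next: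
  assumes f1: "full (Suc k) (j + 1)" and f3: "full (Suc k) (j + 3)" and fj: "full (Suc (Suc k)) j"
    and j: "0 \<le> j" "j + 2 \<le> int r - 2" "even (j + int k)"
  shows "full (Suc (Suc k)) (j + 2)"
proof -
  let ?T = "P (Suc (Suc k))" and ?G = "G (Suc (Suc k))"
  interpret ugroup ?T ?G by (rule G_ugroup)
  have C1: "plG ?G (True # z) (True # z')"
    if z: "z \<in> P (Suc k)" "z' \<in> P (Suc k)" "ht z = j + 1" "ht z' = j + 1" "z \<noteq> z'" for z z'
    unfolding plG_def
  proof (intro allI impI)
    fix x y assume xy: "(cmod x)\<^sup>2 + (cmod y)\<^sup>2 = 1"
    let ?A = "rot (True # z) (True # z') x y" and ?B = "rot (False # z) (False # z') x y"
    have P: "True # z \<in> ?T" "False # z \<in> ?T" "False # z' \<in> ?T" using z j by (auto simp: P_Cons)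
    have "?A \<circ> ?B \<in> ?G"
      using lift_in[OF f1 z(3)[symmetric] z(4,1,2,5) xy] lift_rot[OF z(5,1,2)] z P by simp
    moreover have B: "?B \<in> ?G"
      using fj P z xy unfolding full_def plG_def by auto
    ultimately have "(?A \<circ> ?B) \<circ> inv ?B \<in> ?G" using comp_in inv_in by blast
    then show "?A \<in> ?G" using inv_cancel(2)[OF B] by (simp add: comp_assoc)
  qed
  show ?thesis
  proof (cases "j + 2 \<le> int k")
    case False
    show ?thesis unfolding full_def
    proof (intro ballI impI)
      fix w w' assume w: "w \<in> ?T" "w' \<in> ?T" "ht w = j + 2" "ht w' = j + 2" "w \<noteq> w'"
      obtain b z where z: "w = b # z" "z \<in> P (Suc k)" using w P_SucE by blast
      obtain b' z' where z': "w' = b' # z'" "z' \<in> P (Suc k)" using w P_SucE by blast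
      \<comment> \<open>Height j + 3 exceeds the number k + 1 of steps, so no word comes down to
        height j + 2.\<close>
      have "ht z \<noteq> j + 3" "ht z' \<noteq> j + 3" using False P_ht[OF z(2)] P_ht[OF z'(2)] j(3) by auto
      then have "b" "b'" using w z z' by (auto split: if_splits)
      then show "plG ?G w w'" using C1[OF z(2) z'(2)] w z z' by auto
    qed
  next
    case True
    obtain a where a: "a \<in> P k" "ht a = j" using word_exists'[of j k] j True by auto
    \<comment> \<open>The last generator is scalar on this word, which makes it the fixed line of
      the bridge and the centre of the star.\<close>
    let ?c = "True # True # a"
    have cT: "?c \<in> ?T" "True # a \<in> P (Suc k)" using a j by (auto simp: P_Cons)
    have F: "plG ?G (False # z) ?c" if z: "z \<in> P (Suc k)" "ht z = j + 3" for z
    proof -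
      have j3: "j + 3 \<le> int r - 2" using P_ht[OF z(1)] z by simp
      obtain d where d: "d \<in> P k" "ht d = j + 2" using word_exists'[of "j + 2" k] j True by auto
      have dT: "False # d \<in> P (Suc k)" "True # d \<in> P (Suc k)" "True # False # d \<in> ?T" "False # True # d \<in> ?T"
        using d j j3 by (auto simp: P_Cons)
      obtain x y c where sgp: "plan (True # False # d) (False # True # d) (sg (Suc (Suc k))) x y c" "x \<noteq> 0" "y \<noteq> 0"
        using sg_plan'(1)[OF d(1)] d j j3 by auto
      have 1: "plG ?G (True # False # d) ?c"
        using C1[OF dT(1) cT(2)] d a by auto
      have 2: "plG ?G (False # True # d) ?c"
        using plG_bridge[OF 1 sg_G sgp sg_scal(1)[OF cT(1)]] dT cT by auto
      show ?thesis
      proof (cases "z = True # d")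
        case False
        \<comment> \<open>A quarter turn in height j + 3 carries \<open>True # d\<close> to z; its
          lift fixes ?c, whose tail has height j + 1.\<close>
        let ?f = "lift (Suc (Suc k)) (rot (True # d) z 0 1)"
        have fG: "?f \<in> ?G" using lift_in[OF f3, of "True # d" z 0 1] z dT d False by auto
        have zT: "False # z \<in> ?T" using z j j3 by (simp add: P_Cons)
        show ?thesis
          by (rule plG_transport[OF 2 fG, of _ _ 1 1]) (use zT dT cT d a z in \<open>auto simp: lift_Cons rot_def\<close>)
      qed (use 2 in simp)
    qed
    show ?thesis unfolding full_def
    proof (intro ballI impI)
      fix w w' assume w: "w \<in> ?T" "w' \<in> ?T" "ht w = j + 2" "ht w' = j + 2" "w \<noteq> w'"
      show "plG ?G w w'"
      proof (rule plG_star[of ?c "{w \<in> ?T. ht w = j + 2}"])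
        fix z assume z: "z \<in> {w \<in> ?T. ht w = j + 2}" "z \<noteq> ?c"
        obtain b x where x: "z = b # x" "x \<in> P (Suc k)" using z P_SucE by blast
        show "plG ?G z ?c"
          using x z C1[OF x(2) cT(2)] F[OF x(2)] a by (cases b) auto
      qed (use w cT a in auto)
    qed
  qed
qed

text \<open>In height 0 the last generator is diagonal: - 1 on \<open>False # True # a\<close> and q
  on \<open>False # False # d\<close>. The operator p of \<open>isolate_plane\<close>, built from it
  and a lifted torus, thus commutes with that torus in height 0, and the commutator lives in height
  2 alone.\<close>

lemma full_2:
  assumes f1: "full (Suc k) 1" and f3: "full (Suc k) 3" and k: "k \<ge> 2" "even k"
  shows "full (Suc (Suc k)) 2"
proof -
  let ?T = "P (Suc (Suc k))" and ?G = "G (Suc (Suc k))"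
  interpret ugroup ?T ?G by (rule G_ugroup)
  \<comment> \<open>Height 0 for a makes \<open>False # True # a\<close> an eigenvector of the last
    generator; height 2 for d puts \<open>False # d\<close> into the same sector as
    \<open>True # a\<close>.\<close>
  obtain a where a: "a \<in> P k" "ht a = 0" using word_exists'[of 0 k] k r5 by auto
  obtain d where d: "d \<in> P k" "ht d = 2" using word_exists'[of 2 k] k r5 by auto
  have m: "False # d \<in> P (Suc k)" "True # a \<in> P (Suc k)" "True # d \<in> P (Suc k)"
    "True # False # d \<in> ?T" "False # True # d \<in> ?T" "True # True # a \<in> ?T" "False # False # d \<in> ?T" "False # True # a \<in> ?T"
    using a d r5 by (auto simp: P_Cons)
  have ad: "d \<noteq> a" using a d by auto
  have ht: "ht (False # d) = 1" "ht (True # a) = 1" "ht (True # d) = 3" using a d by auto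
  obtain x y c where sgp: "plan (True # False # d) (False # True # d) (sg (Suc (Suc k))) x y c" "x \<noteq> 0" "y \<noteq> 0"
    using sg_plan'(1)[OF d(1)] d r5 by auto
  define Y where "Y \<phi> = rot (True # False # d) (True # True # a) (cis \<phi>) 0 \<circ> rot (False # False # d) (False # True # a) (cis \<phi>) 0" for \<phi>
  have Y: "Y \<phi> \<in> ?G" for \<phi>
    using lift_in[OF f1, of "False # d" "True # a" "cis \<phi>" 0] lift_rot[of "False # d" "True # a" "Suc k" "cis \<phi>" 0] m a d
    by (simp add: Y_def)
  have base: "plG ?G (True # False # d) (False # True # d)"
  proof (rule isolate_plane[OF Y[unfolded Y_def] _ sg_G _ sgp])
    show "frame (True # False # d) (False # True # d) {True # True # a, False # False # d, False # True # a} (sg (Suc (Suc k)))"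
      unfolding frame_def using sgp(1) sg_scal m a(2) by blast
    fix \<phi>
    have "plan (True # False # d) (False # True # d) (Y \<phi>) (cis \<phi>) 0 (cis \<phi>)"
      "\<exists>\<tau> c. plan (True # False # d) (False # True # d) (Y \<phi>) \<tau> 0 c \<and> \<tau> = cis \<phi> * (c * cnj \<tau>)"
      by (rule plan_torus; use ad in \<open>simp add: Y_def rot_def\<close>)+
    moreover have "scal (Y \<phi>) (True # True # a) (cnj (cis \<phi>))" "scal (Y \<phi>) (False # False # d) (cis \<phi>)"
      "scal (Y \<phi>) (False # True # a) (cnj (cis \<phi>))"
      by (simp_all add: scal_def Y_def rot_def)
    ultimately show "\<exists>t\<in>?G. frame (True # False # d) (False # True # d) {True # True # a, False # False # d, False # True # a} t \<and>
         (\<exists>\<tau> c. plan (True # False # d) (False # True # d) t \<tau> 0 c \<and> \<tau> = cis \<phi> * (c * cnj \<tau>))"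
      by (intro bexI[OF _ Y[of \<phi>]] conjI) (auto simp: frame_def)
  qed (use m ad in auto)
  \<comment> \<open>Quarter turns lifted from height 1 move \<open>True # False # d\<close> to any
    \<open>True # z\<close> and fix \<open>False # True # d\<close>, whose tail has height
    3.\<close>
  have E2: "plG ?G (True # z) (False # True # d)" if z: "z \<in> P (Suc k)" "ht z = 1" for z
  proof (cases "z = False # d")
    case False
    let ?f = "lift (Suc (Suc k)) (rot (False # d) z 0 1)"
    have fG: "?f \<in> ?G" using lift_in[OF f1, of "False # d" z 0 1] z m ht False by auto
    have zT: "True # z \<in> ?T" using z r5 by (simp add: P_Cons)
    show ?thesis
      by (rule plG_transport[OF base fG, of _ _ 1 1]) (use zT z m d in \<open>auto simp: lift_Cons rot_def\<close>)
  qed (use base in simp)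
  have E3: "plG ?G (False # z') (True # False # d)" if z': "z' \<in> P (Suc k)" "ht z' = 3" for z'
  proof (cases "z' = True # d")
    case False
    let ?f = "lift (Suc (Suc k)) (rot (True # d) z' 0 1)"
    have fG: "?f \<in> ?G" using lift_in[OF f3, of "True # d" z' 0 1] z' m ht False by auto
    have zT: "False # z' \<in> ?T" using z' r5 by (simp add: P_Cons)
    show ?thesis
      by (rule plG_transport[OF plG_sym[OF base] fG, of _ _ 1 1]) (use zT z' m d in \<open>auto simp: lift_Cons rot_def\<close>)
  qed (use plG_sym[OF base] in simp)
  show ?thesis unfolding full_def
  proof (intro ballI impI)
    fix w w' assume w: "w \<in> ?T" "w' \<in> ?T" "ht w = 2" "ht w' = 2" "w \<noteq> w'"
    show "plG ?G w w'"
    proof (rule plG_star[of "True # False # d" "{w \<in> ?T. ht w = 2}"])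
      fix z assume z: "z \<in> {w \<in> ?T. ht w = 2}" "z \<noteq> True # False # d"
      obtain b x where x: "z = b # x" "x \<in> P (Suc k)" using z P_SucE by blast
      show "plG ?G z (True # False # d)"
      proof (cases b)
        case True
        then have "plG ?G z (False # True # d)" using E2[OF x(2)] x z by simp
        then show ?thesis using plG_trans[OF _ plG_sym[OF base]] z m True x by auto
      next
        case False
        then show ?thesis using E3[OF x(2)] x z by simp
      qed
    qed (use w m d in auto)
  qed
qed

text \<open>For every a of height 1 the last generator mixes \<open>False # True # a\<close> with
  \<open>True # False # a\<close>, so it has no eigenline at a second word
  \<open>False # True # b\<close>. A conjugate g of a diagonal element t takes its place: t is
  trivial on both words of height 1 over b, hence so is g on
  \<open>False # True # b\<close>.\<close>

lemma full_1:
  assumes f2: "full (Suc k) 2" and k: "k \<ge> 3" "odd k"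
  shows "full (Suc (Suc k)) 1"
proof -
  let ?T = "P (Suc (Suc k))" and ?G = "G (Suc (Suc k))"
  interpret ugroup ?T ?G by (rule G_ugroup)
  \<comment> \<open>\<open>False # d\<close> is a word of height 2 different from all
    \<open>True # a\<close> with a of height 1; it is the partner of \<open>True # a\<close> in the
    torus t, so that t avoids the words over b.\<close>
  obtain d where d: "d \<in> P k" "ht d = 3" using word_exists'[of 3 k] k r5 by auto
  have base: "plG ?G (False # True # a) (True # False # a)" if a: "a \<in> P k" "ht a = 1" for a
  proof -
    obtain b where b: "b \<in> P k" "ht b = 1" "b \<noteq> a" using second_word[OF a k(1)] by blast
    have m: "True # a \<in> P (Suc k)" "True # b \<in> P (Suc k)" "False # d \<in> P (Suc k)"
      "False # True # a \<in> ?T" "True # False # a \<in> ?T" "False # True # b \<in> ?T" "True # False # b \<in> ?T"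
      "True # True # a \<in> ?T" "True # True # b \<in> ?T" "False # False # d \<in> ?T" "True # False # d \<in> ?T"
      using a b d r5 by (auto simp: P_Cons)
    let ?pa = "False # True # a" and ?pb = "True # False # a"
    let ?C = "{False # True # b, True # True # a, True # True # b}"
    have Y: "rot ?pa (False # True # b) (cis \<phi>) 0 \<circ> rot (True # True # a) (True # True # b) (cis \<phi>) 0 \<in> ?G" for \<phi>
    proof -
      have "rot (True # True # a) (True # True # b) (cis \<phi>) 0 \<circ> rot ?pa (False # True # b) (cis \<phi>) 0 \<in> ?G"
        using lift_in[OF f2, of "True # a" "True # b" "cis \<phi>" 0] lift_rot[of "True # a" "True # b" "Suc k" "cis \<phi>" 0] m a b
        by simp
      moreover have "rot (True # True # a) (True # True # b) (cis \<phi>) 0 \<circ> rot ?pa (False # True # b) (cis \<phi>) 0 =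
         rot ?pa (False # True # b) (cis \<phi>) 0 \<circ> rot (True # True # a) (True # True # b) (cis \<phi>) 0"
        using b(3) by (auto simp: rot_def fun_eq_iff)
      ultimately show ?thesis by simp
    qed
    define t where "t \<phi> = rot (True # True # a) (True # False # d) (cis \<phi>) 0 \<circ> rot ?pa (False # False # d) (cis \<phi>) 0" for \<phi>
    have t: "t \<phi> \<in> ?G" for \<phi>
      using lift_in[OF f2, of "True # a" "False # d" "cis \<phi>" 0] lift_rot[of "True # a" "False # d" "Suc k" "cis \<phi>" 0] m a d
      by (simp add: t_def)
    have ab: "d \<noteq> a" "d \<noteq> b" using a b d by auto
    have tp: "plan ?pa ?pb (t \<phi>) (cis \<phi>) 0 (cis \<phi>)"
      "\<exists>\<tau> c. plan ?pa ?pb (t \<phi>) \<tau> 0 c \<and> \<tau> = cis \<phi> * (c * cnj \<tau>)" for \<phi>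
      by (rule plan_torus; use ab in \<open>simp add: t_def rot_def\<close>)+
    have ts: "scal (t \<phi>) (False # True # b) 1" "scal (t \<phi>) (True # True # a) (cis \<phi>)" "scal (t \<phi>) (True # True # b) 1" for \<phi>
      using b(3) ab by (simp_all add: scal_def t_def rot_def)
    let ?s = "sg (Suc (Suc k))"
    have s: "?s \<in> ?G" by (rule sg_G) simp
    obtain x y c where sgp: "plan ?pa ?pb ?s x y c" "x \<noteq> 0" "y \<noteq> 0"
      using sg_plan'(2)[OF a(1)] a r5 by auto
    \<comment> \<open>The angle pi / 2 gives the block entries
      \<open>x * cnj x * \<i> + y * cnj y\<close> and \<open>y * cnj x * (\<i> - 1)\<close>, both
      nonzero.\<close>
    define g where "g = ?s \<circ> t (pi / 2) \<circ> inv ?s"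
    have g: "g \<in> ?G" unfolding g_def using s t comp_in inv_in by blast
    have u: "cmod c = 1" "c * cnj c = 1" "x * cnj x + y * cnj y = 1"
      using sgp(1) unit_cnj unit_norm_cnj by (auto simp: plan_def)
    define i0 where "i0 = cis (pi / 2)"
    have i0: "i0 = \<i>" by (simp add: i0_def complex_eq_iff)
    have ii: "i0 * cnj i0 = 1" by (simp add: i0)
    have "(x * i0) * cnj x - (c * i0) * cnj (y * i0) * (- cnj c * y) = x * cnj x * i0 + (c * cnj c) * (i0 * cnj i0) * (y * cnj y)"
      by (simp add: algebra_simps)
    also have "\<dots> = x * cnj x * \<i> + y * cnj y" unfolding u(2) ii by (simp add: i0)
    finally have e1: "(x * i0) * cnj x - (c * i0) * cnj (y * i0) * (- cnj c * y) = x * cnj x * \<i> + y * cnj y" .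
    have "(y * i0) * cnj x + (c * i0) * cnj (x * i0) * (- cnj c * y) = y * cnj x * (i0 - (c * cnj c) * (i0 * cnj i0))"
      by (simp add: algebra_simps)
    also have "\<dots> = y * cnj x * (\<i> - 1)" unfolding u(2) ii by (simp add: i0)
    finally have e2: "(y * i0) * cnj x + (c * i0) * cnj (x * i0) * (- cnj c * y) = y * cnj x * (\<i> - 1)" .
    have "plan ?pa ?pb g ((x * i0) * cnj x - (c * i0) * cnj (y * i0) * (- cnj c * y))
       ((y * i0) * cnj x + (c * i0) * cnj (x * i0) * (- cnj c * y)) ((c * i0) * cnj c)"
      using plan_comp[OF plan_comp[OF sgp(1) tp(1)[of "pi / 2"]] plan_inv[OF sgp(1) bij_in[OF s]]]
      unfolding g_def i0_def by simp
    then have gp: "plan ?pa ?pb g (x * cnj x * \<i> + y * cnj y) (y * cnj x * (\<i> - 1)) ((c * i0) * cnj c)"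
      unfolding e1 e2 .
    have gx: "x * cnj x * \<i> + y * cnj y \<noteq> 0"
    proof
      assume "x * cnj x * \<i> + y * cnj y = 0"
      then have "of_real ((cmod x)\<^sup>2) * \<i> + of_real ((cmod y)\<^sup>2) = 0" by (simp only: complex_norm_square)
      then have "Im (of_real ((cmod x)\<^sup>2) * \<i> + of_real ((cmod y)\<^sup>2)) = 0" by simp
      then show False using sgp(2) by simp
    qed
    have gy: "y * cnj x * (\<i> - 1) \<noteq> 0" 
    proof -
      have "\<i> - 1 \<noteq> (0 :: complex)" by (simp add: complex_eq_iff)
      then show ?thesis using sgp(2,3) by simp
    qed
    have gsb: "scal g (False # True # b) 1"
    proof -
      have "g v (False # True # b) = v (False # True # b)" for v
      proof -
        have "?s (t (pi / 2) (inv ?s v)) (False # True # b) = ?s (inv ?s v) (False # True # b)"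
          using b(3) ab by (simp add: sg_def sgq_def t_def rot_def)
        also have "\<dots> = v (False # True # b)" using inv_cancel(2)[OF s] by (metis comp_apply id_apply)
        finally show ?thesis by (simp add: g_def)
      qed
      then show ?thesis by (simp add: scal_def)
    qed
    have gs: "\<exists>d. scal g w d" if "w = True # True # a \<or> w = True # True # b" for w
      using that scal_comp[OF scal_comp[OF sg_scal(1) ts(2)] scal_inv[OF sg_scal(1) bij_in[OF s]]]
        scal_comp[OF scal_comp[OF sg_scal(1) ts(3)] scal_inv[OF sg_scal(1) bij_in[OF s]]] m unfolding g_def by blast
    show ?thesis
    proof (rule isolate_plane[OF Y _ g _ gp gx gy])
      show "frame ?pa ?pb ?C g" unfolding frame_def using gp gsb gs by blast
      show "\<exists>t\<in>?G. frame ?pa ?pb ?C t \<and> (\<exists>\<tau> c. plan ?pa ?pb t \<tau> 0 c \<and> \<tau> = cis \<phi> * (c * cnj \<tau>))" for \<phi>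
        using t[of \<phi>] tp[of \<phi>] ts[of \<phi>] unfolding frame_def by blast
    qed (use m b(3) in auto)
  qed
  have star: "plG ?G (False # z) (True # False # a)" if z: "z \<in> P (Suc k)" "ht z = 2" and a: "a \<in> P k" "ht a = 1" for z a
  proof (cases "z = True # a")
    case False
    let ?f = "lift (Suc (Suc k)) (rot (True # a) z 0 1)"
    have m: "True # a \<in> P (Suc k)" "False # True # a \<in> ?T" "True # False # a \<in> ?T" "False # z \<in> ?T"
      using a z r5 by (auto simp: P_Cons)
    have fG: "?f \<in> ?G" using lift_in[OF f2, of "True # a" z 0 1] z m a False by auto
    show ?thesis
      by (rule plG_transport[OF base[OF a] fG, of _ _ 1 1]) (use z a m in \<open>auto simp: lift_Cons rot_def\<close>)
  qed (use base[OF a] in simp)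
  obtain a where a: "a \<in> P k" "ht a = 1" using word_exists'[of 1 k] k r5 by auto
  let ?c = "True # False # a"
  have c: "?c \<in> ?T" "False # True # a \<in> ?T" "True # a \<in> P (Suc k)" using a r5 by (auto simp: P_Cons)
  show ?thesis unfolding full_def
  proof (intro ballI impI)
    fix w w' assume w: "w \<in> ?T" "w' \<in> ?T" "ht w = 1" "ht w' = 1" "w \<noteq> w'"
    show "plG ?G w w'"
    proof (rule plG_star[of ?c "{w \<in> ?T. ht w = 1}"])
      fix z assume z: "z \<in> {w \<in> ?T. ht w = 1}" "z \<noteq> ?c"
      obtain b x where x: "z = b # x" "x \<in> P (Suc k)" using z P_SucE by blast
      show "plG ?G z ?c"
      proof (cases b)
        case True
        obtain b' e where e: "x = b' # e" "e \<in> P k" using x P_SucE by blast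
        \<comment> \<open>A word of height 1 whose last step goes up comes from height 0, which is
          entered only from height 1.\<close>
        have "\<not> b'" "ht e = 1" using True x z e P_ht[OF e(2)] by (auto split: if_splits)
        then have ze: "z = True # False # e" using True x e by simp
        have "plG ?G z (False # True # a)"
          using plG_sym[OF star[OF c(3) _ e(2) \<open>ht e = 1\<close>]] a ze by simp
        then show ?thesis using plG_trans[OF _ base[OF a]] z c ze by auto
      next
        case False
        then show ?thesis using star[OF x(2) _ a] x z by simp
      qed
    qed (use w c a in auto)
  qed
qed

text \<open>Height \<open>0\<close> is left out of the hypothesis because for \<open>r = 10\<close> the group on four strands is finite
  modulo scalars in that sector.\<close>

lemma full_step:
  assumes f: "\<And>h. h \<ge> 1 \<Longrightarrow> full (Suc k) h" and k: "k \<ge> 2"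
  shows "full (Suc (Suc k)) h"
proof -
  have chain: "full (Suc (Suc k)) (int j0 + 2 * int m)" if "full (Suc (Suc k)) (int j0)" "even (j0 + k)" for j0 m
  proof (induction m)
    case 0 then show ?case using that by simp
  next
    case (Suc m)
    let ?j = "int j0 + 2 * int m"
    show ?case
    proof (cases "?j + 2 \<le> int r - 2")
      case True
      have "full (Suc (Suc k)) (?j + 2)"
        by (rule full_next[OF f f Suc _ True]) (use that(2) in auto)
      then show ?thesis by (simp add: algebra_simps)
    next
      case False
      have "ht w \<noteq> int j0 + 2 * int (Suc m)" if "w \<in> P (Suc (Suc k))" for w
        using P_ht[OF that] False by auto
      then show ?thesis unfolding full_def by blast
    qed
  qed
  have start: "full (Suc (Suc k)) 0 \<and> full (Suc (Suc k)) 1"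
  proof (cases "even k")
    case True
    \<comment> \<open>For even k height 2 comes first, because \<open>full_0\<close> divides it
      out.\<close>
    have 0: "full (Suc (Suc k)) 0" by (rule full_0[OF f full_2[OF f f k True]]) auto
    have "ht w \<noteq> 1" if "w \<in> P (Suc (Suc k))" for w using P_ht[OF that] True by auto
    then show ?thesis using 0 unfolding full_def by blast
  next
    case False
    have 1: "full (Suc (Suc k)) 1" by (rule full_1[OF f]) (use k False in \<open>auto simp: le_less Suc_le_eq\<close>)
    have "ht w \<noteq> 0" if "w \<in> P (Suc (Suc k))" for w using P_ht[OF that] False by auto
    then show ?thesis using 1 unfolding full_def by blast
  qed
  show ?thesis
  proof (cases "h \<ge> 0 \<and> even (h + int k)")
    case False
    have "ht w \<noteq> h" if "w \<in> P (Suc (Suc k))" for w using P_ht[OF that] False by auto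
    then show ?thesis unfolding full_def by blast
  next
    case True
    define j0 where "j0 = (if even k then 0 else 1 :: nat)"
    have "h - int j0 = 2 * ((h - int j0) div 2)" using True by (auto simp: j0_def)
    moreover have "h - int j0 \<ge> 0" using True by (cases "h = 0") (auto simp: j0_def)
    then have "(h - int j0) div 2 \<ge> 0" by simp
    ultimately have "h = int j0 + 2 * int (nat ((h - int j0) div 2))" by simp
    then show ?thesis using chain[of j0 "nat ((h - int j0) div 2)"] start by (auto simp: j0_def split: if_splits)
  qed
qed

text \<open>The base level may lack height 0; one step restores all heights, hence the strict
  inequality \<open>n0 < n\<close>.\<close>

lemma full_all:
  assumes "\<And>h. h \<ge> 1 \<Longrightarrow> full n0 h" "n0 \<ge> 3" "n0 < n"
  shows "full n h"
  using assms(3)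
proof (induction n arbitrary: h)
  case 0
  then show ?case by simp
next
  case (Suc n h)
  have "full n h" if "h \<ge> 1" for h using Suc assms(1) that by (cases "n = n0") auto
  moreover have "Suc (n - 1) = n" "n - 1 \<ge> 2" using Suc assms(2) by auto
  ultimately show ?case using full_step[of "n - 1" h] by simp
qed

end

section \<open>Three and four strands\<close>

lemma (in ugroup) funpow_in: "f \<in> G \<Longrightarrow> f ^^ k \<in> G"
  by (induction k) (use id_in comp_in in auto)

lemma funpow_diag:
  fixes e :: "'i \<Rightarrow> complex"
  assumes "\<And>v w. f v w = e w * v w"
  shows "(f ^^ k) v w = e w ^ k * v w"
  by (induction k arbitrary: v w) (auto simp: assms)

context jones_data
begin

lemma P_3: "P 3 = {[True, False, True], [False, True, True], [True, True, True]}"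
proof -
  have "w \<in> P 3 \<Longrightarrow> w \<in> {[True, False, True], [False, True, True], [True, True, True]}" for w
    using r5 by (auto simp: P_def length_Suc_conv numeral_3_eq_3 split: if_splits)
  then show ?thesis using r5 by (auto simp: P_def)
qed

lemma P_4: "P 4 \<subseteq> {[True, True, False, True], [True, False, True, True], [False, True, True, True], [True, True, True, True],
    [False, True, False, True], [False, False, True, True]}"
proof
  fix w assume w: "w \<in> P 4"
  then obtain b u where "w = b # u" "u \<in> P 3" using P_SucE[of w 3] by auto
  then show "w \<in> {[True, True, False, True], [True, False, True, True], [False, True, True, True], [True, True, True, True],
    [False, True, False, True], [False, False, True, True]}"
    unfolding P_3 by (cases b) auto
qed

lemma sg_diag_op:
  assumes "\<And>w. w \<in> P n \<Longrightarrow> sw w \<in> P n \<Longrightarrow> d (sw w) = d w"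
  shows "sg n \<circ> diag_op d = diag_op d \<circ> sg n"
proof (intro ext)
  fix v w
  have "cb q w * d (sw w) = d w * cb q w" if "w \<in> P n"
    using that assms[OF that] cb_nz[OF that, of q] by (cases "cb q w = 0") auto
  then show "(sg n \<circ> diag_op d) v w = (diag_op d \<circ> sg n) v w"
    by (simp add: sg_def sgq_def diag_op_def algebra_simps)
qed

lemma sg2_values: "sg 2 v [False, True] = - v [False, True]" "sg 2 v [True, True] = q * v [True, True]"
proof -
  have "[False, True] \<in> P 2" "[True, True] \<in> P 2" using r5 by (auto simp: P_def)
  then show "sg 2 v [False, True] = - v [False, True]" "sg 2 v [True, True] = q * v [True, True]"
    by (auto simp: sg_def sgq_def A0 B_def)
qed

definition sigma1 :: "(bool list \<Rightarrow> complex) \<Rightarrow> bool list \<Rightarrow> complex" where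
  "sigma1 = lift 3 (sg 2)"

lemma sigma1_G: "sigma1 \<in> G 3"
proof -
  have "gen 3 1 = sigma1" by (simp add: sigma1_def numeral_3_eq_3 numeral_2_eq_2)
  then show ?thesis using Gam_G[OF gen_Gam(1)[of 1 3]] by simp
qed

lemma sigma1_values:
  "sigma1 v w = (if w \<in> P 3 then (if w = [True, False, True] then - 1 else q) else 1) * v w"
proof (cases "w \<in> P 3")
  case True
  then show ?thesis
    unfolding P_3 by (auto simp: sigma1_def lift_Cons P_3 sg2_values)
next
  case False
  then show ?thesis by (simp add: sigma1_def lift_out)
qed

text \<open>On the two words of height 1 the first generator has eigenvalues - 1 and q, so its k-th
  power is \<open>q ^ k\<close> times a reflection with eigenvalue \<open>(- cnj q) ^ k\<close>; the
  last generator moves its root.\<close>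

lemma full_3:
  assumes k: "(- cnj q) ^ k \<noteq> 1" "cmod ((- cnj q) ^ k - 1) < 1"
  shows "full 3 h"
proof -
  let ?a = "[True, False, True]" and ?b = "[False, True, True]"
  interpret cgroup "P 3" "G 3" by (rule G_cgroup)
  define d where "d w = (if w \<in> P 3 then q ^ k else 1)" for w :: "bool list"
  have T: "?a \<in> P 3" "?b \<in> P 3" by (auto simp: P_3)
  have qq: "q * cnj q = 1" using q1 unit_cnj by auto
  then have "q ^ k * cnj q ^ k = 1" by (metis power_mult_distrib power_one)
  then have qk: "(- cnj q) ^ k * q ^ k = (- 1) ^ k" by (subst power_minus) (simp add: mult.assoc mult.commute)
  have "(sigma1 ^^ k) = diag_op d \<circ> creflect ?a ?b ((- cnj q) ^ k) 1 0"
  proof (intro ext)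
    fix v w
    have "(sigma1 ^^ k) v w = (if w \<in> P 3 then (if w = ?a then - 1 else q) else 1) ^ k * v w"
      by (rule funpow_diag) (rule sigma1_values)
    also have "\<dots> = (diag_op d \<circ> creflect ?a ?b ((- cnj q) ^ k) 1 0) v w"
      using T qk by (auto simp: diag_op_def creflect_def d_def algebra_simps)
    finally show "(sigma1 ^^ k) v w = (diag_op d \<circ> creflect ?a ?b ((- cnj q) ^ k) 1 0) v w" .
  qed
  then have s: "diag_op d \<circ> creflect ?a ?b ((- cnj q) ^ k) 1 0 \<in> G 3"
    using funpow_in[OF sigma1_G, of k] by simp
  have T1: "[True] \<in> P 1" using r5 by (simp add: P_def)
  obtain x y c where g: "plan ?a ?b (sg 3) x y c" "x \<noteq> 0" "y \<noteq> 0"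
    using sg_plan'(1)[OF T1] r5 by (auto simp: numeral_3_eq_3)
  have ab: "plG (G 3) ?a ?b"
  proof (rule plG_from_reflection[OF T _ _ k _ _ s sg_G g])
    show "cmod ((- cnj q) ^ k) = 1" using q1 by (simp add: norm_power)
    show "cmod (d i) = 1" for i using q1 by (simp add: d_def norm_power)
    show "d ?a = d ?b" using T by (simp add: d_def)
    show "sg 3 \<circ> diag_op d = diag_op d \<circ> sg 3" by (rule sg_diag_op) (simp add: d_def)
  qed auto
  then have "plG (G 3) ?b ?a" by (rule plG_sym) simp
  then show ?thesis using ab unfolding full_def P_3 by auto
qed

text \<open>By Cayley--Hamilton: the product of the two generators has trace \<open>- q\<close> and determinant \<open>q\<^sup>2\<close>
  in the two-dimensional sector.\<close>

lemma full_twist_3: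
  "((sigma1 \<circ> sg 3) ^^ 3) v w = (if w \<in> P 3 then (if w = [True, True, True] then q ^ 6 else q ^ 3) else 1) * v w"
proof -
  let ?a = "[True, False, True]" and ?b = "[False, True, True]" and ?c = "[True, True, True]"
  define \<alpha> \<beta> where "\<alpha> = complex_of_real (A 1)" and "\<beta> = complex_of_real (B 1)"
  have T: "?a \<in> P 3" "?b \<in> P 3" "?c \<in> P 3" by (auto simp: P_3)
  have BB: "\<beta> * \<beta> = \<alpha> * (1 - \<alpha>)"
  proof -
    have "B 1 * B 1 = A 1 * (1 - A 1)" using B_sq[of 1] r5 by (simp add: power2_eq_square)
    then have "complex_of_real (B 1 * B 1) = of_real (A 1 * (1 - A 1))" by (simp only:)
    then show ?thesis by (simp add: \<alpha>_def \<beta>_def)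
  qed
  have br: "(1 + q)\<^sup>2 * \<alpha> = q" using braid by (simp add: \<alpha>_def)
  let ?X = "sigma1 \<circ> sg 3"
  have Xa: "?X v ?a = - (q - (1 + q) * \<alpha>) * v ?a + (1 + q) * \<beta> * v ?b" for v
    using T by (simp add: sigma1_values sg_def sgq_def \<alpha>_def \<beta>_def algebra_simps)
  have Xb: "?X v ?b = - q * (1 + q) * \<beta> * v ?a + q * (q - (1 + q) * (1 - \<alpha>)) * v ?b" for v
    using T by (simp add: sigma1_values sg_def sgq_def \<alpha>_def \<beta>_def algebra_simps)
  have Xc: "?X v ?c = q\<^sup>2 * v ?c" for v
    using T by (simp add: sigma1_values sg_def sgq_def power2_eq_square)
  have Xo: "?X v w = v w" if "w \<notin> P 3" for v w
    using that by (simp add: sigma1_values sg_def sgq_def)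
  have 3: "(?X ^^ 3) v = ?X (?X (?X v))" by (simp add: numeral_3_eq_3)
  define x11 x12 x21 x22 where x: "x11 = - (q - (1 + q) * \<alpha>)" "x12 = (1 + q) * \<beta>" "x21 = - q * (1 + q) * \<beta>"
    "x22 = q * (q - (1 + q) * (1 - \<alpha>))"
  \<comment> \<open>The value of \<open>A 1\<close> prescribed by \<open>braid\<close> gives the
    trace.\<close>
  have tr: "x11 + x22 = - q"
  proof -
    have "x11 + x22 = - 2 * q + (1 + q)\<^sup>2 * \<alpha>" by (simp add: x power2_eq_square algebra_simps)
    then show ?thesis using br by simp
  qed
  have det: "x11 * x22 - x12 * x21 = q\<^sup>2"
  proof -
    have "x11 * x22 - x12 * x21 = - (q - (1 + q) * \<alpha>) * (q * (q - (1 + q) * (1 - \<alpha>))) + q * (1 + q)\<^sup>2 * (\<beta> * \<beta>)"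
      by (simp add: x power2_eq_square algebra_simps)
    also have "\<dots> = q\<^sup>2" unfolding BB by (simp add: power2_eq_square algebra_simps)
    finally show ?thesis .
  qed
  have t2: "x22 = - q - x11" using tr by (simp add: algebra_simps)
  have d2: "x12 * x21 = x11 * (- q - x11) - q\<^sup>2" using det unfolding t2 by (simp add: algebra_simps)
  have cube: "x11 * (x11 * (x11 * p + x12 * s) + x12 * (x21 * p + x22 * s)) + x12 * (x21 * (x11 * p + x12 * s) + x22 * (x21 * p + x22 * s)) = q ^ 3 * p"
    "x21 * (x11 * (x11 * p + x12 * s) + x12 * (x21 * p + x22 * s)) + x22 * (x21 * (x11 * p + x12 * s) + x22 * (x21 * p + x22 * s)) = q ^ 3 * s" for p s
  proof -
    have 1: "x11 * (x11 * p + x12 * s) + x12 * (x21 * p + x22 * s) = - q * (x11 * p + x12 * s) - q\<^sup>2 * p" for p s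
    proof -
      have "x11 * (x11 * p + x12 * s) + x12 * (x21 * p + x22 * s) = (x11 * x11 + x12 * x21) * p + x12 * (x11 + x22) * s"
        by (simp add: algebra_simps)
      also have "\<dots> = - q * (x11 * p + x12 * s) - q\<^sup>2 * p" unfolding d2 tr by (simp add: algebra_simps)
      finally show ?thesis .
    qed
    have 2: "x21 * (x11 * p + x12 * s) + x22 * (x21 * p + x22 * s) = - q * (x21 * p + x22 * s) - q\<^sup>2 * s" for p s
    proof -
      have "x21 * (x11 * p + x12 * s) + x22 * (x21 * p + x22 * s) = x21 * (x11 + x22) * p + (x22 * x22 + x12 * x21) * s"
        by (simp add: algebra_simps)
      also have "\<dots> = - q * (x21 * p + x22 * s) - q\<^sup>2 * s" unfolding d2 tr t2 by (simp add: algebra_simps)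
      finally show ?thesis .
    qed
    define p1 s1 where "p1 = x11 * p + x12 * s" and "s1 = x21 * p + x22 * s"
    define p2 s2 where "p2 = x11 * p1 + x12 * s1" and "s2 = x21 * p1 + x22 * s1"
    have h: "p2 = - q * p1 - q\<^sup>2 * p" "s2 = - q * s1 - q\<^sup>2 * s"
      using 1[of p s] 2[of p s] by (simp_all add: p1_def s1_def p2_def s2_def)
    have "x11 * p2 + x12 * s2 = - q * p2 - q\<^sup>2 * p1"
    proof -
      have "x11 * p2 + x12 * s2 = - q * (x11 * p1 + x12 * s1) - q\<^sup>2 * (x11 * p + x12 * s)"
        unfolding h by (simp add: algebra_simps)
      then show ?thesis by (simp add: p2_def p1_def)
    qed
    also have "\<dots> = q ^ 3 * p" unfolding h(1) by (simp add: power2_eq_square power3_eq_cube algebra_simps)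
    finally show "x11 * (x11 * (x11 * p + x12 * s) + x12 * (x21 * p + x22 * s)) + x12 * (x21 * (x11 * p + x12 * s) + x22 * (x21 * p + x22 * s)) = q ^ 3 * p"
      by (simp add: p2_def s2_def p1_def s1_def)
    have "x21 * p2 + x22 * s2 = - q * s2 - q\<^sup>2 * s1"
    proof -
      have "x21 * p2 + x22 * s2 = - q * (x21 * p1 + x22 * s1) - q\<^sup>2 * (x21 * p + x22 * s)"
        unfolding h by (simp add: algebra_simps)
      then show ?thesis by (simp add: s2_def s1_def)
    qed
    also have "\<dots> = q ^ 3 * s" unfolding h(2) by (simp add: power2_eq_square power3_eq_cube algebra_simps)
    finally show "x21 * (x11 * (x11 * p + x12 * s) + x12 * (x21 * p + x22 * s)) + x22 * (x21 * (x11 * p + x12 * s) + x22 * (x21 * p + x22 * s)) = q ^ 3 * s"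
      by (simp add: p2_def s2_def p1_def s1_def)
  qed
  show ?thesis
  proof (cases "w \<in> P 3")
    case True
    have "?X v ?a = x11 * v ?a + x12 * v ?b" "?X v ?b = x21 * v ?a + x22 * v ?b" for v
      unfolding Xa Xb x by simp_all
    then have "(?X ^^ 3) v ?a = q ^ 3 * v ?a" "(?X ^^ 3) v ?b = q ^ 3 * v ?b"
      unfolding 3 using cube by simp_all
    moreover have "(?X ^^ 3) v ?c = q ^ 6 * v ?c"
      unfolding 3 Xc by (simp add: power2_eq_square eval_nat_numeral)
    ultimately show ?thesis using True unfolding P_3 by auto
  next
    case False
    then show ?thesis unfolding 3 Xo[OF False] by simp
  qed
qed

text \<open>The full twist of the first three strands is \<open>q ^ 6\<close> on words with tail
  \<open>[True, True, True]\<close> and \<open>q ^ 3\<close> on the others. In height 2 this is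
  \<open>q ^ 3\<close> times a reflection with root \<open>ket ?a\<close> and eigenvalue
  \<open>q ^ 3\<close>. The third word of that height is attached by a bridge.\<close>

lemma full_4:
  assumes m: "q ^ (3 * m) \<noteq> 1" "cmod (q ^ (3 * m) - 1) < 1" and h: "h \<ge> 1"
  shows "full 4 h"
proof -
  let ?a = "[False, True, True, True]" and ?b = "[True, False, True, True]" and ?e = "[True, True, False, True]"
    and ?t = "[True, True, True, True]"
  interpret cgroup "P 4" "G 4" by (rule G_cgroup)
  interpret G3: ugroup "P 3" "G 3" by (rule G_ugroup)
  \<comment> \<open>The word ?t has the tail \<open>[True, True, True]\<close> too, but height 4;
    the diagonal factor absorbs its eigenvalue.\<close>
  define d where "d w = (if w \<in> P 4 then (if w = ?t then q ^ (6 * m) else q ^ (3 * m)) else 1)" for w :: "bool list"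
  have T: "?a \<in> P 4" "?b \<in> P 4" "?e \<in> P 4" using r5 by (auto simp: P_def)
  define s where "s = lift 4 ((sigma1 \<circ> sg 3) ^^ 3) ^^ m"
  have "(sigma1 \<circ> sg 3) ^^ 3 \<in> G 3" using G3.funpow_in G3.comp_in sigma1_G sg_G[of 3] by simp
  then have "lift 4 ((sigma1 \<circ> sg 3) ^^ 3) \<in> G 4" using lift_G[of _ 3] by simp
  then have sG: "s \<in> G 4" unfolding s_def by (rule funpow_in)
  have "s = diag_op d \<circ> creflect ?a ?b (q ^ (3 * m)) 1 0"
  proof (intro ext)
    fix v w
    define e where "e w = (if w \<in> P 4 then (if tl w = [True, True, True] then q ^ 6 else q ^ 3) else 1)" for w :: "bool list"
    have "lift 4 ((sigma1 \<circ> sg 3) ^^ 3) v w = e w * v w" for v w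
    proof (cases "w \<in> P 4")
      case True
      then obtain b u where w: "w = b # u" "u \<in> P 3" using P_SucE[of w 3] by auto
      then show ?thesis using True by (simp add: lift_Cons full_twist_3 e_def)
    qed (simp add: lift_out e_def)
    then have "s v w = e w ^ m * v w" unfolding s_def by (rule funpow_diag)
    also have "\<dots> = (diag_op d \<circ> creflect ?a ?b (q ^ (3 * m)) 1 0) v w"
    proof (cases "w \<in> P 4")
      case True
      have "(q ^ 6) ^ m = q ^ (6 * m)" "(q ^ 3) ^ m = q ^ (3 * m)" by (simp_all add: power_mult)
      moreover have "q ^ (6 * m) = q ^ (3 * m) * q ^ (3 * m)" by (simp add: power_add[symmetric])
      moreover have "w \<in> {?e, ?b, ?a, ?t, [False, True, False, True], [False, False, True, True]}"
        using True P_4 by blast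
      ultimately show ?thesis using True T
        by (auto simp: diag_op_def creflect_def d_def e_def algebra_simps)
    next
      case False
      then show ?thesis using T by (auto simp: diag_op_def creflect_def d_def e_def)
    qed
    finally show "s v w = (diag_op d \<circ> creflect ?a ?b (q ^ (3 * m)) 1 0) v w" .
  qed
  then have s: "diag_op d \<circ> creflect ?a ?b (q ^ (3 * m)) 1 0 \<in> G 4" using sG by simp
  have TT: "[True, True] \<in> P 2" "[True] \<in> P 1" using r5 by (auto simp: P_def)
  have "\<exists>x y c. plan ?a ?b (sg 4) x y c \<and> x \<noteq> 0 \<and> y \<noteq> 0"
    using sg_plan'(2)[OF TT(1)] r5 by (simp add: eval_nat_numeral)
  then obtain x y c where g: "plan ?a ?b (sg 4) x y c" "x \<noteq> 0" "y \<noteq> 0" by blast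
  have ab: "plG (G 4) ?a ?b"
  proof (rule plG_from_reflection[OF T(1,2) _ _ m _ _ s sg_G g])
    show "cmod (q ^ (3 * m)) = 1" using q1 by (simp add: norm_power)
    show "cmod (d i) = 1" for i using q1 by (simp add: d_def norm_power)
    show "d ?a = d ?b" using T by (simp add: d_def)
    have "sw w = ?t \<longleftrightarrow> w = ?t" for w by (cases w rule: sw.cases) auto
    then show "sg 4 \<circ> diag_op d = diag_op d \<circ> sg 4" by (intro sg_diag_op) (simp add: d_def)
  qed auto
  have ea: "plG (G 4) ?e ?a"
  proof -
    have "\<exists>x y c. plan [False, True, True] [True, False, True] (sg 3) x y c \<and> x \<noteq> 0 \<and> y \<noteq> 0"
      using sg_plan'(2)[OF TT(2)] r5 by (simp add: eval_nat_numeral)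
    then obtain x y c where g: "plan [False, True, True] [True, False, True] (sg 3) x y c" "x \<noteq> 0" "y \<noteq> 0" by blast
    have "plan ?b ?e (lift 4 (sg 3)) x y c"
      using g(1) T unfolding plan_def by (simp add: lift_Cons)
    moreover have "scal (lift 4 (sg 3)) ?a q"
      using T q1 P_3 by (simp add: scal_def lift_Cons sg_def sgq_def)
    moreover have "lift 4 (sg 3) \<in> G 4" using lift_G[OF sg_G[of 3]] by simp
    ultimately show ?thesis using plG_bridge[OF plG_sym[OF ab], of "lift 4 (sg 3)" ?e x y c q] g T by auto
  qed
  show ?thesis unfolding full_def
  proof (intro ballI impI)
    fix w w' assume w: "w \<in> P 4" "w' \<in> P 4" "ht w = h" "ht w' = h" "w \<noteq> w'"
    have c: "w \<in> {?e, ?b, ?a, ?t, [False, True, False, True], [False, False, True, True]}"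
      "w' \<in> {?e, ?b, ?a, ?t, [False, True, False, True], [False, False, True, True]}" using w P_4 by blast+
    have "w \<in> {?e, ?b, ?a}" "w' \<in> {?e, ?b, ?a}" using c w h by auto
    then show "plG (G 4) w w'"
      using w(5) plG_star[of ?a "{?e, ?b, ?a}" w w'] T ea plG_sym[OF ab] by auto
  qed
qed

end

section \<open>Special unitary matrices as products of plane rotations\<close>

definition det_sum :: "'i set \<Rightarrow> ('i \<Rightarrow> 'i \<Rightarrow> complex) \<Rightarrow> complex" where
  "det_sum S M = (\<Sum>p | p permutes S. of_int (sign p) * (\<Prod>a\<in>S. M (p a) a))"

definition rowrot :: "'i \<Rightarrow> 'i \<Rightarrow> complex \<Rightarrow> complex \<Rightarrow> ('i \<Rightarrow> 'i \<Rightarrow> complex) \<Rightarrow> 'i \<Rightarrow> 'i \<Rightarrow> complex" where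
  "rowrot a b x y M i j = (if i = a then x * M a j - cnj y * M b j
     else if i = b then y * M a j + cnj x * M b j else M i j)"

definition orthcols :: "'i set \<Rightarrow> ('i \<Rightarrow> 'i \<Rightarrow> complex) \<Rightarrow> bool" where
  "orthcols S M \<longleftrightarrow> (\<forall>a\<in>S. \<forall>c\<in>S. (\<Sum>b\<in>S. cnj (M b a) * M b c) = (if a = c then 1 else 0))"

lemma rot_mop:
  assumes "finite S" "a \<in> S" "b \<in> S" "a \<noteq> b"
  shows "rot a b x y \<circ> mop S M = mop S (rowrot a b x y M)"
proof (intro ext)
  fix v i
  show "(rot a b x y \<circ> mop S M) v i = mop S (rowrot a b x y M) v i"
    using assms by (auto simp: rot_def mop_def rowrot_def sum_distrib_left sum_subtractf sum.distrib
      left_diff_distrib distrib_right mult.assoc)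
qed

lemma orthcols_rowrot:
  assumes "finite S" "a \<in> S" "b \<in> S" "a \<noteq> b" "(cmod x)\<^sup>2 + (cmod y)\<^sup>2 = 1" "orthcols S M"
  shows "orthcols S (rowrot a b x y M)"
proof -
  have n: "x * cnj x + y * cnj y = 1" using assms unit_norm_cnj by blast
  let ?N = "rowrot a b x y M"
  have "(\<Sum>i\<in>S. cnj (?N i j) * ?N i k) = (\<Sum>i\<in>S. cnj (M i j) * M i k)" for j k
  proof -
    have s: "sum f S = f a + (f b + sum f (S - {a} - {b}))" for f :: "'a \<Rightarrow> complex"
      using assms by (simp add: sum.remove[of S a] sum.remove[of "S - {a}" b])
    have "cnj (?N a j) * ?N a k + cnj (?N b j) * ?N b k = (x * cnj x + y * cnj y) * (cnj (M a j) * M a k + cnj (M b j) * M b k)"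
      using assms(4) by (simp add: rowrot_def algebra_simps)
    moreover have "(\<Sum>i\<in>S - {a} - {b}. cnj (?N i j) * ?N i k) = (\<Sum>i\<in>S - {a} - {b}. cnj (M i j) * M i k)"
      by (intro sum.cong) (auto simp: rowrot_def)
    ultimately show ?thesis unfolding s[of "\<lambda>i. cnj (?N i j) * ?N i k"] s[of "\<lambda>i. cnj (M i j) * M i k"]
      by (simp add: n add.assoc[symmetric])
  qed
  then show ?thesis using assms(6) by (simp add: orthcols_def)
qed

text \<open>As a function of the rows a and b the permutation sum is bilinear and alternating, so
  the rotation multiplies it by its own determinant \<open>x * cnj x + y * cnj y\<close>.\<close>

lemma det_sum_rowrot:
  assumes S: "finite S" "a \<in> S" "b \<in> S" "a \<noteq> b" and xy: "(cmod x)\<^sup>2 + (cmod y)\<^sup>2 = 1"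
  shows "det_sum S (rowrot a b x y M) = det_sum S M"
proof -
  define W where "W p = (\<Prod>c\<in>S - {inv p a} - {inv p b}. M (p c) c)" for p
  \<comment> \<open>The two rows a and b become free arguments, evaluated in the columns
    \<open>inv p a\<close> and \<open>inv p b\<close>; W collects the other factors.\<close>
  define F where "F f g = (\<Sum>p | p permutes S. of_int (sign p) * (f (inv p a) * g (inv p b) * W p))" for f g
  have split: "(\<Prod>c\<in>S. N (p c) c) = N a (inv p a) * N b (inv p b) * (\<Prod>c\<in>S - {inv p a} - {inv p b}. N (p c) c)"
    if p: "p permutes S" for p and N :: "'a \<Rightarrow> 'a \<Rightarrow> complex"
  proof -
    have i: "inv p a \<in> S" "inv p b \<in> S" "inv p b \<noteq> inv p a" "p (inv p a) = a" "p (inv p b) = b"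
      using p S permutes_inv[OF p] permutes_in_image[of "inv p" S] permutes_inverses[OF p]
      by (auto dest: injD[OF permutes_inj[OF permutes_inv[OF p]]])
    then show ?thesis using S(1)
      by (simp add: prod.remove[of S "inv p a"] prod.remove[of "S - {inv p a}" "inv p b"])
  qed
  have off: "p c \<noteq> a \<and> p c \<noteq> b" if "p permutes S" "c \<in> S - {inv p a} - {inv p b}" for p c
    using that permutes_inverses[OF that(1)] by auto
  have dF: "det_sum S N = F (N a) (N b)" if "\<And>i j. i \<noteq> a \<Longrightarrow> i \<noteq> b \<Longrightarrow> N i j = M i j" for N
  proof -
    have "(\<Prod>c\<in>S - {inv p a} - {inv p b}. N (p c) c) = W p" if "p permutes S" for p
      unfolding W_def using off[OF that] \<open>\<And>i j. i \<noteq> a \<Longrightarrow> i \<noteq> b \<Longrightarrow> N i j = M i j\<close> by (intro prod.cong) auto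
    then show ?thesis unfolding det_sum_def F_def by (intro sum.cong) (simp_all add: split)
  qed
  have anti: "F f g = - F g f" for f g
  proof -
    let ?t = "Transposition.transpose a b"
    have tp: "?t permutes S" using S by (simp add: permutes_swap_id)
    have inv_t: "inv (?t \<circ> p) a = inv p b" "inv (?t \<circ> p) b = inv p a" if "p permutes S" for p
    proof -
      have "inv (?t \<circ> p) = inv p \<circ> ?t"
        using permutes_bij[OF that] by (simp add: o_inv_distrib)
      then show "inv (?t \<circ> p) a = inv p b" "inv (?t \<circ> p) b = inv p a" by auto
    qed
    have W: "W (?t \<circ> p) = W p" if "p permutes S" for p
    proof -
      have "S - {inv p b} - {inv p a} = S - {inv p a} - {inv p b}" by auto
      then show ?thesis unfolding W_def inv_t[OF that]
        using off[OF that] by (intro prod.cong) (auto simp: transpose_apply_other)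
    qed
    have sg: "sign (?t \<circ> p) = - sign p" if "p permutes S" for p
    proof -
      have "permutation p" using that S(1) permutation_permutes by blast
      then show ?thesis using S(4) by (simp add: sign_compose permutation_swap_id sign_swap_id)
    qed
    have "F f g = (\<Sum>p | p permutes S. of_int (sign (?t \<circ> p)) * (f (inv (?t \<circ> p) a) * g (inv (?t \<circ> p) b) * W (?t \<circ> p)))"
      unfolding F_def
      by (rule sum.reindex_bij_witness[of _ "\<lambda>p. ?t \<circ> p" "\<lambda>p. ?t \<circ> p"])
        (auto simp: comp_assoc[symmetric] intro: permutes_compose[OF _ tp])
    also have "\<dots> = (\<Sum>p | p permutes S. - (of_int (sign p) * (g (inv p a) * f (inv p b) * W p)))"
      by (intro sum.cong) (simp_all add: inv_t W sg algebra_simps)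
    also have "\<dots> = - F g f" by (simp add: F_def sum_negf)
    finally show ?thesis .
  qed
  have z: "F f f = 0" for f using anti[of f f] by simp
  let ?N = "rowrot a b x y M"
  have n: "x * cnj x + y * cnj y = 1" using xy unit_norm_cnj by blast
  have "det_sum S ?N = F (?N a) (?N b)" by (rule dF) (simp add: rowrot_def)
  also have "\<dots> = x * y * F (M a) (M a) + x * cnj x * F (M a) (M b) - cnj y * y * F (M b) (M a) - cnj y * cnj x * F (M b) (M b)"
    unfolding F_def sum_distrib_left sum.distrib[symmetric] sum_subtractf[symmetric]
    by (intro sum.cong) (use S(4) in \<open>auto simp: rowrot_def algebra_simps\<close>)
  also have "\<dots> = (x * cnj x + y * cnj y) * F (M a) (M b)"
    unfolding z anti[of "M b" "M a"] by (simp add: algebra_simps)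
  also have "\<dots> = det_sum S M" unfolding n using dF[of M] by simp
  finally show ?thesis .
qed

text \<open>Column a is a unit vector, so only permutations that fix a contribute.\<close>

lemma det_sum_insert:
  assumes "finite S" "a \<notin> S" "\<And>i. i \<in> S \<Longrightarrow> M i a = 0" "M a a = 1"
  shows "det_sum (insert a S) M = det_sum S M"
  unfolding det_sum_def
proof (rule sum.mono_neutral_cong_right)
  show "finite {p. p permutes insert a S}" using assms by (simp add: finite_permutations)
  show "{p. p permutes S} \<subseteq> {p. p permutes insert a S}" by (auto intro: permutes_subset)
  show "\<forall>p\<in>{p. p permutes insert a S} - {p. p permutes S}. of_int (sign p) * (\<Prod>c\<in>insert a S. M (p c) c) = 0"
  proof
    fix p assume p: "p \<in> {p. p permutes insert a S} - {p. p permutes S}"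
    have "p a \<noteq> a"
    proof
      assume "p a = a"
      have pi: "p permutes insert a S" using p by blast
      have "p permutes S" by (rule permutes_superset[OF pi]) (use \<open>p a = a\<close> in blast)
      then show False using p by blast
    qed
    moreover have "p a \<in> insert a S" using p permutes_in_image[of p "insert a S" a] by blast
    ultimately have "M (p a) a = 0" using assms(3) by blast
    then have "(\<Prod>c\<in>insert a S. M (p c) c) = 0" using assms(1) by (intro prod_zero) auto
    then show "of_int (sign p) * (\<Prod>c\<in>insert a S. M (p c) c) = 0" by simp
  qed
  show "of_int (sign p) * (\<Prod>c\<in>insert a S. M (p c) c) = of_int (sign p) * (\<Prod>c\<in>S. M (p c) c)" if "p \<in> {p. p permutes S}" for p
  proof -
    have "p a = a" using that assms(2) permutes_not_in by fastforce
    then show ?thesis using assms by simp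
  qed
qed

text \<open>Besides clearing t, the pivot is made real and nonnegative, so that a column of norm 1
  ends with pivot 1 and not merely with a phase.\<close>

lemma givens_rotation:
  fixes s t :: complex
  obtains x y where "(cmod x)\<^sup>2 + (cmod y)\<^sup>2 = 1" "y * s + cnj x * t = 0" "x * s - cnj y * t = of_real (sqrt ((cmod s)\<^sup>2 + (cmod t)\<^sup>2))"
proof (cases "(cmod s)\<^sup>2 + (cmod t)\<^sup>2 = 0")
  case True
  then have "s = 0" "t = 0" by (auto simp: sum_power2_eq_zero_iff)
  then show ?thesis using that[of 1 0] by simp
next
  case False
  define \<rho> where "\<rho> = sqrt ((cmod s)\<^sup>2 + (cmod t)\<^sup>2)"
  have \<rho>: "\<rho> > 0" "\<rho>\<^sup>2 = (cmod s)\<^sup>2 + (cmod t)\<^sup>2"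
    using False by (auto simp: \<rho>_def less_le)
  show ?thesis
  proof (rule that[of "cnj s / of_real \<rho>" "- t / of_real \<rho>"])
    show "(cmod (cnj s / of_real \<rho>))\<^sup>2 + (cmod (- t / of_real \<rho>))\<^sup>2 = 1"
    proof -
      have "(cmod (cnj s / of_real \<rho>))\<^sup>2 + (cmod (- t / of_real \<rho>))\<^sup>2 = ((cmod s)\<^sup>2 + (cmod t)\<^sup>2) / \<rho>\<^sup>2"
        by (simp add: norm_divide power_divide add_divide_distrib)
      then show ?thesis using \<rho>(1) unfolding \<rho>(2)[symmetric] by simp
    qed
    show "- t / of_real \<rho> * s + cnj (cnj s / of_real \<rho>) * t = 0" by simp
    have "cnj s * s + cnj t * t = of_real (\<rho>\<^sup>2)"
      unfolding \<rho>(2) of_real_add complex_norm_square by (simp add: mult.commute)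
    then have "(cnj s * s + cnj t * t) / of_real \<rho> = of_real \<rho>" using \<rho>(1) by (simp add: power2_eq_square)
    then show "cnj s / of_real \<rho> * s - cnj (- t / of_real \<rho>) * t = of_real (sqrt ((cmod s)\<^sup>2 + (cmod t)\<^sup>2))"
      by (simp add: add_divide_distrib \<rho>_def[symmetric])
  qed
qed

lemma (in ugroup) SU_in_group:
  assumes "finite S" "S \<subseteq> T" "\<And>a b. a \<in> S \<Longrightarrow> b \<in> S \<Longrightarrow> a \<noteq> b \<Longrightarrow> plG G a b" "orthcols S M" "det_sum S M = 1"
  shows "mop S M \<in> G"
  using assms
proof (induction S arbitrary: M rule: finite_induct)
  case empty
  have "mop {} M = id" by (auto simp: mop_def fun_eq_iff)
  then show ?case using id_in by (simp only:)
next
  case (insert a S)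
  let ?S = "insert a S"
  have fS: "finite ?S" using insert by simp
  show ?case
  \<comment> \<open>In dimension 1 there is no rotation that could normalise the phase; the
    determinant does it.\<close>
  proof (cases "S = {}")
    case True
    have "M a a = 1" using insert.prems(4) True by (simp add: det_sum_def)
    then have "mop ?S M = id" using True by (auto simp: mop_def fun_eq_iff)
    then show ?thesis using id_in by (simp only:)
  next
    case False
    \<comment> \<open>The entries of column a indexed by F are cleared one at a time; the pivot is
      real only after at least one rotation.\<close>
    have "\<exists>u\<in>G. \<exists>N. u \<circ> mop ?S M = mop ?S N \<and> orthcols ?S N \<and> det_sum ?S N = 1 \<and> (\<forall>b\<in>F. N b a = 0) \<and>
        (F \<noteq> {} \<longrightarrow> (\<exists>t\<ge>0. N a a = of_real t))" if "finite F" "F \<subseteq> S" for F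
      using that
    proof (induction F rule: finite_induct)
      case empty
      show ?case using insert.prems by (intro bexI[OF _ id_in] exI[of _ M]) auto
    next
      case (insert b F)
      have "F \<subseteq> S" using insert.prems by simp
      from insert.IH[OF this] obtain u N where uN: "u \<in> G" "u \<circ> mop ?S M = mop ?S N" "orthcols ?S N" "det_sum ?S N = 1" "\<forall>b\<in>F. N b a = 0"
        by blast
      have b: "b \<in> S" "a \<noteq> b" using insert.prems \<open>a \<notin> S\<close> by auto
      obtain x y where xy: "(cmod x)\<^sup>2 + (cmod y)\<^sup>2 = 1" "y * N a a + cnj x * N b a = 0"
        "x * N a a - cnj y * N b a = of_real (sqrt ((cmod (N a a))\<^sup>2 + (cmod (N b a))\<^sup>2))"
        using givens_rotation by blast
      have "plG G a b" using \<open>\<And>a b. a \<in> ?S \<Longrightarrow> b \<in> ?S \<Longrightarrow> a \<noteq> b \<Longrightarrow> plG G a b\<close> b by auto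
      then have r: "rot a b x y \<in> G" using xy by (simp add: plG_def)
      let ?N = "rowrot a b x y N"
      have "(rot a b x y \<circ> u) \<circ> mop ?S M = mop ?S ?N"
        using uN(2) rot_mop[OF fS, of a b x y N] b by (simp add: comp_assoc)
      moreover have "orthcols ?S ?N" using orthcols_rowrot[OF fS _ _ b(2) xy(1) uN(3)] b by simp
      moreover have "det_sum ?S ?N = 1" using det_sum_rowrot[OF fS _ _ b(2) xy(1), of N] b uN(4) by simp
      moreover have "\<forall>c\<in>insert b F. ?N c a = 0"
        using uN(5) xy(2) b insert.prems insert.hyps \<open>a \<notin> S\<close> by (auto simp: rowrot_def)
      moreover have "\<exists>t\<ge>0. ?N a a = of_real t"
        using xy(3) by (intro exI[of _ "sqrt ((cmod (N a a))\<^sup>2 + (cmod (N b a))\<^sup>2)"]) (simp add: rowrot_def)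
      ultimately show ?case using comp_in[OF r uN(1)] by blast
    qed
    then obtain u N where uN: "u \<in> G" "u \<circ> mop ?S M = mop ?S N" "orthcols ?S N" "det_sum ?S N = 1" "\<forall>b\<in>S. N b a = 0"
      "\<exists>t\<ge>0. N a a = of_real t" using insert.hyps(1) False by (metis order_refl)
    obtain t where t: "t \<ge> 0" "N a a = of_real t" using uN(6) by blast
    have "(\<Sum>b\<in>?S. cnj (N b a) * N b a) = 1" using uN(3) by (auto simp: orthcols_def)
    then have "cnj (N a a) * N a a = 1" using insert.hyps uN(5) by simp
    then have "complex_of_real (t * t) = of_real 1" using t by simp
    then have "t * t = 1" by (simp only: of_real_eq_iff)
    then have "t = 1" using t(1) by (metis abs_of_nonneg abs_square_eq_1 power2_eq_square)
    then have Na: "N a a = 1" using t by simp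
    \<comment> \<open>Column a is now a unit vector, and orthogonality of the other columns to it
      clears row a.\<close>
    have row: "N a j = 0" if "j \<in> S" for j
    proof -
      have "(\<Sum>b\<in>?S. cnj (N b a) * N b j) = 0" using uN(3) that insert.hyps by (auto simp: orthcols_def)
      then show ?thesis using insert.hyps uN(5) Na by simp
    qed
    have e: "mop ?S N = mop S N"
    proof (intro ext)
      fix v i
      show "mop ?S N v i = mop S N v i" using row Na uN(5) insert.hyps by (auto simp: mop_def)
    qed
    have "orthcols S N" unfolding orthcols_def
    proof (intro ballI)
      fix j k assume jk: "j \<in> S" "k \<in> S"
      have "(\<Sum>b\<in>?S. cnj (N b j) * N b k) = (if j = k then 1 else 0)" using uN(3) jk by (auto simp: orthcols_def)
      then show "(\<Sum>b\<in>S. cnj (N b j) * N b k) = (if j = k then 1 else 0)" using insert.hyps row jk by simp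
    qed
    moreover have "det_sum S N = 1" using det_sum_insert[OF insert.hyps(1,2), of N] uN(4,5) Na by simp
    ultimately have "mop S N \<in> G" using insert.IH insert.prems(1,2) by auto
    then have "inv u \<circ> (u \<circ> mop ?S M) \<in> G" unfolding uN(2) e using comp_in inv_in uN(1) by blast
    moreover have "inv u \<circ> (u \<circ> mop ?S M) = mop ?S M"
      using inv_cancel(1)[OF uN(1)] by (simp add: comp_assoc[symmetric])
    ultimately show ?thesis by simp
  qed
qed

lemma mop_union:
  assumes "finite S" "finite S'" "S \<inter> S' = {}" "\<And>i j. i \<in> S \<Longrightarrow> j \<in> S' \<Longrightarrow> M i j = 0" "\<And>i j. i \<in> S' \<Longrightarrow> j \<in> S \<Longrightarrow> M i j = 0"
  shows "mop (S \<union> S') M = mop S M \<circ> mop S' M"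
proof (intro ext)
  fix v i
  have *: "(\<Sum>j\<in>S \<union> S'. M i j * v j) = (\<Sum>j\<in>S. M i j * v j) + (\<Sum>j\<in>S'. M i j * v j)"
    using assms by (intro sum.union_disjoint) auto
  have "(\<Sum>j\<in>S. M i j * mop S' M v j) = (\<Sum>j\<in>S. M i j * v j)"
    using assms(3) by (intro sum.cong) (auto simp: mop_def)
  then show "mop (S \<union> S') M v i = (mop S M \<circ> mop S' M) v i"
    using assms by (auto simp: mop_def * sum.neutral)
qed

section \<open>Two-row tableaux as words\<close>

definition rix :: "bool \<Rightarrow> nat" where
  "rix b = (if b then 0 else 1)"

definition addbox :: "nat \<Rightarrow> bool \<Rightarrow> tableau \<Rightarrow> tableau" where
  "addbox n b t = ((fst t)[rix b := Suc (fst t ! rix b)], (snd t)((rix b, fst t ! rix b) := Suc n))"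

text \<open>Defined on all words: one that leaves the strip still gives a filling by 1, ..., n, so
  the counting lemmas carry no path hypothesis.\<close>

fun tab :: "bool list \<Rightarrow> tableau" where
  "tab [] = ([0, 0], \<lambda>_. 0)"
| "tab (b # w) = addbox (length w) b (tab w)"

text \<open>The invariant behind \<open>addbox_inj\<close>: the entry \<open>Suc n\<close> is still
  free. Unlike standardness it survives swaps of two adjacent entries.\<close>

definition bounded_tab :: "nat \<Rightarrow> tableau \<Rightarrow> bool" where
  "bounded_tab n t \<longleftrightarrow> length (fst t) = 2 \<and> (\<forall>x. snd t x \<le> n) \<and> (\<forall>x. x \<notin> boxes (fst t) \<longrightarrow> snd t x = 0)"

lemma rix_lt: "rix b < 2" by (simp add: rix_def)

lemma rix_inj: "rix b = rix c \<longleftrightarrow> b = c" by (auto simp: rix_def)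

lemma less_2_rix: "i < 2 \<Longrightarrow> \<exists>b. i = rix b"
proof -
  assume "i < 2"
  then have "i = rix True \<or> i = rix False" by (auto simp: rix_def)
  then show ?thesis by blast
qed

lemma fst_tab: "fst (tab w) = [count_list w True, count_list w False]"
  by (induction w) (auto simp: addbox_def rix_def)

lemma fst_tab_nth: "fst (tab w) ! rix b = count_list w b"
  by (cases b) (auto simp: fst_tab rix_def)

lemma ht_count: "ht w = int (count_list w True) - int (count_list w False)"
  by (induction w) auto

lemma length_count: "length w = count_list w True + count_list w False"
  by (induction w) auto

lemma snd_tab_Cons: "snd (tab (b # w)) = (snd (tab w))((rix b, count_list w b) := Suc (length w))"
  by (simp add: addbox_def fst_tab_nth)

lemma boxes_tab: "(i, j) \<in> boxes (fst (tab w)) \<longleftrightarrow> (\<exists>b. i = rix b \<and> j < count_list w b)"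
proof -
  have "length (fst (tab w)) = 2" by (simp add: fst_tab)
  then show ?thesis using less_2_rix[of i] fst_tab_nth[of w] rix_lt
    by (auto simp: boxes_def rix_inj)
qed

lemma boxes_tab_Cons: "boxes (fst (tab (b # w))) = insert (rix b, count_list w b) (boxes (fst (tab w)))"
  by (auto simp: boxes_tab rix_inj less_Suc_eq simp del: tab.simps split: if_splits)

lemma new_box: "(rix b, count_list w b) \<notin> boxes (fst (tab w))"
  by (auto simp: boxes_tab rix_inj)

lemma boxes_00 [simp]: "boxes [0, 0] = {}"
  by (auto simp: boxes_def nth_Cons split: nat.splits)

lemma tab_bij: "bij_betw (snd (tab w)) (boxes (fst (tab w))) {1..length w}"
proof (induction w)
  case Nil
  then show ?case by (simp add: bij_betw_def)
next
  case (Cons b w)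
  let ?x = "(rix b, count_list w b)"
  have "bij_betw ((snd (tab w))(?x := Suc (length w))) (boxes (fst (tab w))) {1..length w}"
    using Cons new_box[of b w] by (subst bij_betw_cong[of _ _ "snd (tab w)"]) auto
  then have "bij_betw (snd (tab (b # w))) (boxes (fst (tab w)) \<union> {?x}) ({1..length w} \<union> {Suc (length w)})"
    unfolding snd_tab_Cons using new_box[of b w] by (intro bij_betw_combine) (auto simp: bij_betw_def)
  moreover have "{1..length w} \<union> {Suc (length w)} = {1..length (b # w)}" by auto
  ultimately show ?case unfolding boxes_tab_Cons by simp
qed

lemma tab_zero: "x \<notin> boxes (fst (tab w)) \<Longrightarrow> snd (tab w) x = 0"
  by (induction w) (auto simp: boxes_tab_Cons snd_tab_Cons simp del: tab.simps(2))

lemma tab_le: "snd (tab w) x \<le> length w"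
proof (cases "x \<in> boxes (fst (tab w))")
  case True
  then show ?thesis using tab_bij[of w] by (auto simp: bij_betw_def)
qed (simp add: tab_zero)

lemma bounded_tab_tab: "bounded_tab (length w) (tab w)"
  by (simp add: bounded_tab_def tab_le tab_zero) (simp add: fst_tab)

lemma addbox_inj:
  assumes "bounded_tab n t" "bounded_tab n t'" "addbox n b t = addbox n c t'"
  shows "b = c" "t = t'"
proof -
  let ?x = "(rix b, fst t ! rix b)" and ?y = "(rix c, fst t' ! rix c)"
  have e: "(fst t)[rix b := Suc (fst t ! rix b)] = (fst t')[rix c := Suc (fst t' ! rix c)]"
    "(snd t)(?x := Suc n) = (snd t')(?y := Suc n)" using assms(3) by (auto simp: addbox_def)
  have "((snd t')(?y := Suc n)) ?x = Suc n" using e(2) by (metis fun_upd_same)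
  moreover have "snd t' ?x \<noteq> Suc n" using assms(2) by (auto simp: bounded_tab_def) (metis not_less_eq_eq order_refl)
  ultimately have xy: "?x = ?y" by (metis fun_upd_other)
  then show bc: "b = c" by (simp add: rix_inj)
  have "fst t = (fst t')"
  proof (rule nth_equalityI)
    show "length (fst t) = length (fst t')" using assms by (simp add: bounded_tab_def)
    fix i assume i: "i < length (fst t)"
    have "(fst t)[rix b := Suc (fst t ! rix b)] ! i = (fst t')[rix c := Suc (fst t' ! rix c)] ! i" using e(1) by simp
    then show "fst t ! i = fst t' ! i" using xy bc i by (cases "i = rix b") auto
  qed
  moreover have "snd t = snd t'"
  proof
    fix z
    have "?x \<notin> boxes (fst t)" "?x \<notin> boxes (fst t')" using xy by (auto simp: boxes_def)
    then have "snd t ?x = 0" "snd t' ?x = 0" using assms by (auto simp: bounded_tab_def)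
    then show "snd t z = snd t' z" using fun_cong[OF e(2), of z] xy by (cases "z = ?x") auto
  qed
  ultimately show "t = t'" by (rule prod_eqI)
qed

lemma tab_inj: "length w = length u \<Longrightarrow> tab w = tab u \<Longrightarrow> w = u"
proof (induction w u rule: list_induct2)
  case (Cons b w c u)
  then show ?case using addbox_inj[of "length w" "tab w" "tab u" b c] bounded_tab_tab[of w] bounded_tab_tab[of u] by simp
qed simp

section \<open>Positions, axial distances and swaps\<close>

lemma pos_eq:
  assumes "x \<in> boxes (fst (tab w))" "snd (tab w) x = m"
  shows "pos (tab w) m = x"
  unfolding pos_def using assms tab_bij[of w] by (intro the_equality) (auto simp: bij_betw_def inj_on_def)

lemma pos_new: "pos (tab (b # w)) (Suc (length w)) = (rix b, count_list w b)"
  by (rule pos_eq) (auto simp: boxes_tab_Cons snd_tab_Cons simp del: tab.simps(2))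

lemma pos_old:
  assumes "1 \<le> m" "m \<le> length w" shows "pos (tab (b # w)) m = pos (tab w) m"
proof -
  have "m \<in> snd (tab w) ` boxes (fst (tab w))" using tab_bij[of w] assms by (auto simp: bij_betw_def)
  then obtain x where x: "x \<in> boxes (fst (tab w))" "snd (tab w) x = m" by auto
  have "x \<noteq> (rix b, count_list w b)" using x new_box by metis
  then have "x \<in> boxes (fst (tab (b # w)))" "snd (tab (b # w)) x = m" using x
    by (auto simp: boxes_tab_Cons snd_tab_Cons simp del: tab.simps(2))
  then show ?thesis using pos_eq x by metis
qed

lemma dist_old: "1 \<le> i \<Longrightarrow> Suc i \<le> length w \<Longrightarrow> dist_tab (tab (b # w)) i (i + 1) = dist_tab (tab w) i (i + 1)"
  using pos_old[of i w b] pos_old[of "i + 1" w b] by (simp add: dist_tab_def del: tab.simps(2))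

text \<open>The content of a new box is \<open>count_list u True\<close> in the first row and
  \<open>count_list u False - 1\<close> in the second, with difference \<open>ht u + 1\<close>. Two
  boxes added to one row are neighbours.\<close>

lemma dist_new: "dist_tab (tab (b # c # u)) (Suc (length u)) (Suc (length u) + 1) =
    (if b = c then - 1 else if b then - (ht u + 1) else ht u + 1)"
proof -
  have "pos (tab (b # c # u)) (Suc (length u)) = (rix c, count_list u c)"
    using pos_old[of "Suc (length u)" "c # u" b] pos_new[of c u] by simp
  moreover have "pos (tab (b # c # u)) (Suc (length u) + 1) = (rix b, count_list (c # u) b)"
    using pos_new[of b "c # u"] by simp
  ultimately show ?thesis by (auto simp: dist_tab_def ht_count rix_def)
qed

lemma swap_new:
  assumes "b \<noteq> c" shows "swap_tab (Suc (length u)) (tab (b # c # u)) = tab (c # b # u)"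
proof (rule prod_eqI)
  show "fst (swap_tab (Suc (length u)) (tab (b # c # u))) = fst (tab (c # b # u))"
    by (auto simp: swap_tab_def fst_tab simp del: tab.simps)
  show "snd (swap_tab (Suc (length u)) (tab (b # c # u))) = snd (tab (c # b # u))"
  proof
    fix x
    have "snd (tab u) x \<le> length u" by (rule tab_le)
    then show "snd (swap_tab (Suc (length u)) (tab (b # c # u))) x = snd (tab (c # b # u)) x"
      using assms by (auto simp: swap_tab_def snd_tab_Cons rix_inj simp del: tab.simps)
  qed
qed

lemma swap_old:
  assumes "1 \<le> i" "Suc i \<le> length u"
  shows "swap_tab i (tab (c # u)) = addbox (length u) c (swap_tab i (tab u))" "bounded_tab (length u) (swap_tab i (tab u))"
proof -
  show "swap_tab i (tab (c # u)) = addbox (length u) c (swap_tab i (tab u))"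
    using assms by (auto simp: swap_tab_def addbox_def fun_eq_iff)
  show "bounded_tab (length u) (swap_tab i (tab u))"
    using bounded_tab_tab[of u] assms by (auto simp: bounded_tab_def swap_tab_def)
qed

lemma sub_shape_old:
  assumes "m \<le> length w" shows "sub_shape (tab (b # w)) m = sub_shape (tab w) m"
proof -
  have "{j. (i, j) \<in> boxes (fst (tab (b # w))) \<and> snd (tab (b # w)) (i, j) \<le> m} = {j. (i, j) \<in> boxes (fst (tab w)) \<and> snd (tab w) (i, j) \<le> m}" for i
    using assms new_box[of b w] by (auto simp: boxes_tab_Cons snd_tab_Cons simp del: tab.simps)
  then show ?thesis by (simp add: sub_shape_def fst_tab del: tab.simps)
qed

lemma sub_shape_full: "sub_shape (tab w) (length w) = fst (tab w)"
proof (rule nth_equalityI)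
  show "length (sub_shape (tab w) (length w)) = length (fst (tab w))" by (simp add: sub_shape_def)
  fix i assume "i < length (sub_shape (tab w) (length w))"
  then have i: "i < length (fst (tab w))" by (simp add: sub_shape_def)
  have "{j. (i, j) \<in> boxes (fst (tab w)) \<and> snd (tab w) (i, j) \<le> length w} = {..<fst (tab w) ! i}"
    using i tab_le by (auto simp: boxes_def)
  then show "sub_shape (tab w) (length w) ! i = fst (tab w) ! i" using i by (simp add: sub_shape_def)
qed

lemma young_2: "young_diagram 2 [a, b] \<longleftrightarrow> b \<le> a"
  by (auto simp: young_diagram_def)

section \<open>Admissible tableaux correspond to paths\<close>

context jones_data
begin

lemma adm_diagram_tab: "admissible_diagram 2 r (fst (tab w)) \<longleftrightarrow> 0 \<le> ht w \<and> ht w \<le> int r - 2"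
  by (auto simp: admissible_diagram_def fst_tab young_2 ht_count)

lemma admissible_tab: "admissible_tableau 2 r (length w) (tab w) \<longleftrightarrow> path w"
proof -
  \<comment> \<open>Counting deleted boxes is exchanged for counting the remaining ones.\<close>
  have "(\<forall>i\<le>n. Q (n - i)) \<longleftrightarrow> (\<forall>m\<le>n. Q m)" for n :: nat and Q
    by (metis diff_diff_cancel diff_le_self)
  then have *: "admissible_tableau 2 r (length w) (tab w) \<longleftrightarrow> (\<forall>m\<le>length w. admissible_diagram 2 r (sub_shape (tab w) m))" for w
    by (simp add: admissible_tableau_def)
  show ?thesis unfolding *
  proof (induction w)
    case Nil
    have "sub_shape (tab []) 0 = fst (tab [])" using sub_shape_full[of "[]"] by simp
    then show ?case using adm_diagram_tab[of "[]"] r5 by simp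
  next
    case (Cons b w)
    have "(\<forall>m\<le>length (b # w). admissible_diagram 2 r (sub_shape (tab (b # w)) m)) \<longleftrightarrow>
       (\<forall>m\<le>length w. admissible_diagram 2 r (sub_shape (tab w) m)) \<and> admissible_diagram 2 r (fst (tab (b # w)))"
      using sub_shape_old[of _ w b] sub_shape_full[of "b # w"] by (auto simp: le_Suc_eq simp del: tab.simps)
    then show ?case using Cons adm_diagram_tab[of "b # w"] by simp
  qed
qed

lemma standard_tab: "path w \<Longrightarrow> standard_tableau 2 (length w) (tab w)"
proof -
  assume p: "path w"
  have "\<forall>i j j'. (i, j') \<in> boxes (fst (tab w)) \<and> j < j' \<longrightarrow> snd (tab w) (i, j) < snd (tab w) (i, j')"
  proof (induction w)
    case (Cons b w)
    show ?case
    proof (intro allI impI)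
      fix i j j' assume h: "(i, j') \<in> boxes (fst (tab (b # w))) \<and> j < j'"
      show "snd (tab (b # w)) (i, j) < snd (tab (b # w)) (i, j')"
      proof (cases "(i, j') = (rix b, count_list w b)")
        case True
        then have "(i, j) \<noteq> (rix b, count_list w b)" using h by auto
        then show ?thesis using True tab_le[of w "(i, j)"] by (auto simp: snd_tab_Cons simp del: tab.simps)
      next
        case False
        then have b: "(i, j') \<in> boxes (fst (tab w))" using h by (auto simp: boxes_tab_Cons simp del: tab.simps)
        then have "(i, j) \<in> boxes (fst (tab w))" using h by (auto simp: boxes_def)
        then have "(i, j) \<noteq> (rix b, count_list w b)" using new_box by metis
        then show ?thesis using False Cons b h by (auto simp: snd_tab_Cons simp del: tab.simps)
      qed
    qed
  qed simp
  moreover have "\<forall>i i' j. (i', j) \<in> boxes (fst (tab w)) \<and> i < i' \<longrightarrow> snd (tab w) (i, j) < snd (tab w) (i', j)"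
    using p
  proof (induction w)
    case (Cons b w)
    then have pw: "path w" by simp
    show ?case
    proof (intro allI impI)
      fix i i' j assume h: "(i', j) \<in> boxes (fst (tab (b # w))) \<and> i < i'"
      then have ii: "i = rix True" "i' = rix False" by (auto simp: boxes_tab rix_def split: if_splits simp del: tab.simps)
      show "snd (tab (b # w)) (i, j) < snd (tab (b # w)) (i', j)"
      proof (cases "(i', j) = (rix b, count_list w b)")
        case True
        then have "(i, j) \<noteq> (rix b, count_list w b)" using h by auto
        then show ?thesis using True tab_le[of w "(i, j)"] by (auto simp: snd_tab_Cons simp del: tab.simps)
      next
        case False
        then have b: "(i', j) \<in> boxes (fst (tab w))" using h by (auto simp: boxes_tab_Cons simp del: tab.simps)
        then have "j < count_list w False" using ii by (auto simp: boxes_tab rix_inj)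
        then have "j < count_list w True" using path_ht[OF pw] by (simp add: ht_count)
        then have "(i, j) \<in> boxes (fst (tab w))" using ii by (auto simp: boxes_tab)
        then have "(i, j) \<noteq> (rix b, count_list w b)" using new_box by metis
        then show ?thesis using False Cons.IH[OF pw] b h by (auto simp: snd_tab_Cons simp del: tab.simps)
      qed
    qed
  qed simp
  moreover have "young_diagram 2 (fst (tab w))" using path_ht[OF p] by (simp add: fst_tab young_2 ht_count)
  moreover have "sum_list (fst (tab w)) = length w" by (simp add: fst_tab length_count)
  ultimately show ?thesis using tab_bij[of w] tab_zero[of _ w] by (simp add: standard_tableau_def Let_def)
qed

lemma tab_adm: "w \<in> P n \<Longrightarrow> tab w \<in> adm_tableaux 2 r n"
  using standard_tab[of w] admissible_tab[of w] by (auto simp: P_def adm_tableaux_def)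

text \<open>The box with the largest entry is a corner of the diagram; its removal leaves an
  admissible tableau with one box less, and its row is the head of the word.\<close>

lemma adm_tab: "t \<in> adm_tableaux 2 r n \<Longrightarrow> \<exists>w\<in>P n. t = tab w"
proof (induction n arbitrary: t)
  case 0
  then have s: "length (fst t) = 2" "sum_list (fst t) = 0" "\<forall>b. b \<notin> boxes (fst t) \<longrightarrow> snd t b = 0"
    by (auto simp: adm_tableaux_def standard_tableau_def young_diagram_def Let_def)
  then have "fst t = [0, 0]" by (auto simp: length_Suc_conv numeral_2_eq_2)
  then have "t = tab []" using s by (intro prod_eqI) auto
  then show ?case by (intro bexI[of _ "[]"]) (auto simp: P_def)
next
  case (Suc n)
  obtain lam f where t: "t = (lam, f)" by (cases t)
  have st: "young_diagram 2 lam" "sum_list lam = Suc n" "bij_betw f (boxes lam) {1..Suc n}"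
    "\<And>b. b \<notin> boxes lam \<Longrightarrow> f b = 0" "\<And>i j j'. (i, j') \<in> boxes lam \<Longrightarrow> j < j' \<Longrightarrow> f (i, j) < f (i, j')"
    "\<And>i i' j. (i', j) \<in> boxes lam \<Longrightarrow> i < i' \<Longrightarrow> f (i, j) < f (i', j)"
    and adm: "\<And>m. m \<le> Suc n \<Longrightarrow> admissible_diagram 2 r (sub_shape t m)"
    using Suc.prems t by (auto simp: adm_tableaux_def standard_tableau_def admissible_tableau_def Let_def)
      (metis diff_diff_cancel diff_le_self)
  obtain a c where lam: "lam = [a, c]" "c \<le> a" using st(1) by (auto simp: young_diagram_def length_Suc_conv numeral_2_eq_2)
  have le: "f x \<le> Suc n" for x using st(3,4) by (cases "x \<in> boxes lam") (auto simp: bij_betw_def)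
  have "Suc n \<in> f ` boxes lam" using st(3) by (auto simp: bij_betw_def)
  then obtain i j where ij: "(i, j) \<in> boxes lam" "f (i, j) = Suc n" by auto
  then have i2: "i < 2" "j < lam ! i" using lam by (auto simp: boxes_def)
  then obtain b where b: "i = rix b" using less_2_rix by blast
  have j: "lam ! i = Suc j"
  proof (rule ccontr)
    assume "lam ! i \<noteq> Suc j"
    then have "(i, Suc j) \<in> boxes lam" using i2 lam by (auto simp: boxes_def)
    then have "f (i, j) < f (i, Suc j)" using st(5) by blast
    then show False using le[of "(i, Suc j)"] ij by simp
  qed
  define lam' where "lam' = lam[i := j]"
  define f' where "f' = f((i, j) := 0)"
  have il: "i < length lam" using i2 lam by simp
  have "lam' ! i = j" unfolding lam'_def by (rule nth_list_update_eq[OF il])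
  moreover have "lam'[i := Suc j] = lam" using list_update_id[of lam i] j by (simp add: lam'_def)
  moreover have "f'((i, j) := Suc n) = f" using ij(2) by (auto simp: f'_def fun_eq_iff)
  ultimately have t_eq: "t = addbox n b (lam', f')" by (simp add: addbox_def b[symmetric] t)
  have bx: "boxes lam' = boxes lam - {(i, j)}"
    using j il by (auto simp: boxes_def lam'_def nth_list_update split: if_splits)
  have young: "young_diagram 2 lam'"
  proof -
    \<comment> \<open>With equal rows the largest entry cannot end the first row: the box below it
      would carry a larger one.\<close>
    have "\<not> (i = 0 \<and> a = c)"
    proof
      assume h: "i = 0 \<and> a = c"
      then have "(1, j) \<in> boxes lam" using i2 lam by (auto simp: boxes_def)
      then have "f (0, j) < f (1, j)" using st(6) by simp
      then show False using le[of "(1, j)"] ij h by simp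
    qed
    then show ?thesis using i2 j lam by (auto simp: lam'_def young_2 less_2_cases_iff)
  qed
  have "sum_list lam' = n" using i2 j lam st(2) by (auto simp: lam'_def less_2_cases_iff)
  moreover have "bij_betw f' (boxes lam') {1..n}"
  proof -
    have "f ` (boxes lam - {(i, j)}) = f ` boxes lam - f ` {(i, j)}"
      using st(3) ij(1) by (intro inj_on_image_set_diff[of f "boxes lam"]) (auto simp: bij_betw_def)
    then have "bij_betw f (boxes lam - {(i, j)}) ({1..Suc n} - {Suc n})"
      using st(3) ij(2) by (auto simp: bij_betw_def intro: inj_on_subset)
    moreover have "{1..Suc n} - {Suc n} = {1..n}" by auto
    ultimately show ?thesis unfolding bx f'_def by (subst bij_betw_cong[of _ _ f]) auto
  qed
  moreover have "f' x = 0" if "x \<notin> boxes lam'" for x using that st(4)[of x] bx by (auto simp: f'_def)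
  moreover have "f' (k, l) < f' (k, l')" if "(k, l') \<in> boxes lam'" "l < l'" for k l l'
  proof -
    have "(k, l) \<in> boxes lam'" using that by (auto simp: boxes_def)
    then show ?thesis using that bx st(5)[of k l' l] by (auto simp: f'_def)
  qed
  moreover have "f' (k, l) < f' (k', l)" if "(k', l) \<in> boxes lam'" "k < k'" for k k' l
  proof -
    have "(k, l) \<in> boxes lam'"
    proof -
      have "length lam' = 2" "sorted_wrt (\<ge>) lam'" using young by (auto simp: young_diagram_def)
      then have "k < 2" "lam' ! k' \<le> lam' ! k" using that by (auto simp: boxes_def sorted_wrt_iff_nth_less)
      then show ?thesis using that by (auto simp: boxes_def)
    qed
    then show ?thesis using that bx st(6)[of k' l k] by (auto simp: f'_def)
  qed
  ultimately have std: "standard_tableau 2 n (lam', f')"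
    using young by (auto simp: standard_tableau_def)
  have sub: "sub_shape (lam', f') m = sub_shape t m" if "m \<le> n" for m
  proof -
    have "((k, l) \<in> boxes lam' \<and> f' (k, l) \<le> m) = ((k, l) \<in> boxes lam \<and> f (k, l) \<le> m)" for k l
      by (cases "(k, l) = (i, j)") (use that bx ij in \<open>simp_all add: f'_def\<close>)
    then show ?thesis by (simp add: sub_shape_def t lam'_def)
  qed
  have "(lam', f') \<in> adm_tableaux 2 r n"
    using std adm sub by (auto simp: adm_tableaux_def admissible_tableau_def)
  then obtain w where w: "w \<in> P n" "(lam', f') = tab w" using Suc.IH by blast
  then have tw: "t = tab (b # w)" using t_eq by (simp add: P_def)
  have lw: "length (b # w) = Suc n" using w by (simp add: P_def)
  have "admissible_diagram 2 r (fst (tab (b # w)))"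
    using adm[of "Suc n"] sub_shape_full[of "b # w"] unfolding tw lw by simp
  then have "b # w \<in> P (Suc n)" using adm_diagram_tab[of "b # w"] w by (auto simp: P_def)
  then show ?case using tw by blast
qed

lemma adm_eq: "adm_tableaux 2 r n = tab ` P n"
  using tab_adm adm_tab by blast

lemma tab_inj_on: "inj_on tab (P n)"
  using tab_inj by (auto simp: inj_on_def P_def)

end

section \<open>Transfer to tableaux\<close>

text \<open>On functions the topology is the product topology: a basic neighbourhood constrains
  finitely many coordinates, so a sufficiently good uniform approximation enters it.\<close>

lemma closure_pointwise:
  fixes X :: "'i \<Rightarrow> 'b::metric_space"
  assumes "\<And>e. e > 0 \<Longrightarrow> \<exists>Y\<in>S. \<forall>i. dist (X i) (Y i) < e"
  shows "X \<in> closure S"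
  unfolding closure_iff_nhds_not_empty
proof (intro allI impI)
  fix A U assume U: "U \<subseteq> A" "open U" "X \<in> U"
  have "openin (product_topology (\<lambda>i. euclidean) UNIV) U" using U(2) unfolding open_fun_def .
  with product_topology_open_contains_basis[OF this U(3)]
  obtain V where V: "\<And>i. X i \<in> V i" "\<And>i. open (V i)" "finite {i. V i \<noteq> UNIV}" "Pi\<^sub>E UNIV V \<subseteq> U"
    by (auto simp: PiE_iff)
  have "\<exists>e>0. \<forall>y. dist (X i) y < e \<longrightarrow> y \<in> V i" for i
    using V(1,2)[of i] by (metis open_dist dist_commute)
  then obtain e where e: "\<And>i. e i > 0" "\<And>i y. dist (X i) y < e i \<Longrightarrow> y \<in> V i" by metis
  define m where "m = Min (insert 1 (e ` {i. V i \<noteq> UNIV}))"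
  have "m > 0" using V(3) e(1) by (auto simp: m_def)
  then obtain Y where Y: "Y \<in> S" "\<And>i. dist (X i) (Y i) < m" using assms by blast
  have "Y i \<in> V i" for i
  proof (cases "V i = UNIV")
    case False
    then have "m \<le> e i" using V(3) by (auto simp: m_def)
    then show ?thesis using e(2)[of i "Y i"] Y(2)[of i] by simp
  qed simp
  then have "Y \<in> U" using V(4) by (auto simp: PiE_iff)
  then show "S \<inter> A \<noteq> {}" using Y(1) U(1) by blast
qed

lemma det_on_det_sum:
  assumes "finite S" "inj_on f S"
  shows "det_on (f ` S) X = det_sum S (\<lambda>w x. X (f w, f x))"
proof -
  let ?m = "\<lambda>p. map_permutation S f p"
  have b: "bij_betw f S (f ` S)" using assms by (simp add: bij_betw_def)
  have mp: "?m p (f a) = f (p a)" if "p permutes S" "a \<in> S" for p a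
    using that assms by (simp add: map_permutation_def restrict_id_def)
  have "bij_betw ?m {p. p permutes S} {p. p permutes f ` S}"
  proof -
    have "?m p = (\<lambda>x. if x \<in> f ` S then f (p (inv_into S f x)) else x)" for p
      by (auto simp: map_permutation_def restrict_id_def fun_eq_iff)
    then show ?thesis using bij_betw_permutations[OF b] by simp
  qed
  then have "det_on (f ` S) X = (\<Sum>p | p permutes S. of_int (sign (?m p)) * (\<Prod>a\<in>f ` S. X (?m p a, a)))"
    unfolding det_on_def by (rule sum.reindex_bij_betw[symmetric])
  also have "\<dots> = det_sum S (\<lambda>w x. X (f w, f x))"
    unfolding det_sum_def
    by (intro sum.cong refl) (use assms mp in \<open>auto simp: sign_map_permutation prod.reindex intro!: prod.cong\<close>)
  finally show ?thesis .
qed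

text \<open>The two conditions on \<open>qint\<close> are the values of \<open>alpha\<close> at the
  axial distances - (h + 1) and h + 1, for the last two steps down-up and up-down after a path of
  height h.\<close>

locale jones_rep = jones_data +
  fixes qh :: complex
  assumes q_def: "q = qh\<^sup>2"
    and qint0: "qint qh 0 = 0"
    and alpha_T: "\<And>h. 0 \<le> h \<Longrightarrow> h \<le> int r - 2 \<Longrightarrow> qint qh (- h) / (qint qh 2 * qint qh (- (h + 1))) = of_real (A h)"
    and alpha_F: "\<And>h. 0 \<le> h \<Longrightarrow> h \<le> int r - 2 \<Longrightarrow> qint qh (h + 2) / (qint qh 2 * qint qh (h + 1)) = of_real (1 - A h)"
begin

lemma alpha_new:
  assumes "path (b # c # u)"
  shows "alpha qh (tab (b # c # u)) (Suc (length u)) = of_real (if b = c then 0 else if b then A (ht u) else 1 - A (ht u))"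
proof -
  have h: "0 \<le> ht u" "ht u \<le> int r - 2" using assms path_ht[of u] by auto
  show ?thesis
    using alpha_T[OF h] alpha_F[OF h] qint0 unfolding alpha_def dist_new Let_def
    by (auto simp: algebra_simps)
qed

lemma beta_new:
  assumes "path (b # c # u)"
  shows "beta qh (tab (b # c # u)) (Suc (length u)) = of_real (if b = c then 0 else B (ht u))"
proof -
  have h: "0 \<le> ht u" "ht u \<le> int r - 2" using assms path_ht[of u] by auto
  then have "0 \<le> A (ht u) * (1 - A (ht u))" using A_bounds[of "ht u"] by simp
  then have "csqrt (of_real (A (ht u) * (1 - A (ht u)))) = of_real (B (ht u))"
    unfolding B_def by (rule of_real_sqrt[symmetric])
  then show ?thesis unfolding beta_def alpha_new[OF assms] by (auto simp: mult.commute)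
qed

lemma alpha_beta_old:
  assumes "1 \<le> i" "Suc i \<le> length w"
  shows "alpha qh (tab (b # w)) i = alpha qh (tab w) i" "beta qh (tab (b # w)) i = beta qh (tab w) i"
  using dist_old[OF assms] by (simp_all add: alpha_def beta_def del: tab.simps)

text \<open>Induction on the strands: for the last generator the entries are compared directly; for
  the others the last box is untouched and is removed from both tableaux.\<close>

lemma rho_entry:
  assumes "1 \<le> i" "i < n" "w \<in> P n" "x \<in> P n"
  shows "rho_gen 2 r n qh i (tab w, tab x) = gen n i (ket x) w"
  using assms
proof (induction n arbitrary: w x)
  case 0
  then show ?case by simp
next
  case (Suc n)
  have T: "tab w \<in> adm_tableaux 2 r (Suc n)" "tab x \<in> adm_tableaux 2 r (Suc n)" using tab_adm Suc.prems by auto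
  have weq: "tab w = tab x \<longleftrightarrow> w = x" using tab_inj_on[of "Suc n"] Suc.prems by (auto simp: inj_on_def)
  have L: "rho_gen 2 r (Suc n) qh i (tab w, tab x) = q * (if w = x then 1 else 0)
     - (1 + q) * ((if w = x then alpha qh (tab x) i else 0) + (if tab w = swap_tab i (tab x) then beta qh (tab x) i else 0))"
    using T weq by (simp add: rho_gen_def E_mat_def idm_def q_def)
  show ?case
  proof (cases "i = n")
    case True
    then obtain m where m: "n = Suc m" using Suc.prems by (cases n) auto
    obtain b x' where x': "x = b # x'" "x' \<in> P n" using Suc.prems P_SucE by blast
    obtain c u where u: "x' = c # u" "u \<in> P m" using x' m P_SucE by blast
    have x: "x = b # c # u" using x' u by simp
    have i: "i = Suc (length u)" using True m u by (simp add: P_def)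
    have px: "path (b # c # u)" using Suc.prems x by (simp add: P_def)
    have R: "gen (Suc n) i (ket x) w = cf q w * ket x w + cb q w * ket x (sw w)"
      using True Suc.prems by (simp add: sg_def sgq_def)
    have swx: "sw x = c # b # u" using x by simp
    have swe: "sw w = x \<longleftrightarrow> w = sw x" using sw_simps(1) by metis
    have dsw: "ket x (sw w) = (if w = sw x then 1 else 0)" using swe by (auto simp: ket_def)
    show ?thesis
    proof (cases "b = c")
      case True
      \<comment> \<open>With both boxes in one row the swapped filling is not standard, and its
        coefficient \<open>beta\<close> is 0.\<close>
      have "sw x = x" using x True by simp
      moreover have "cb q x = 0" using x True by simp
      moreover have "cf q x = q" using x True by simp
      moreover have "alpha qh (tab x) i = 0" "beta qh (tab x) i = 0"
        using alpha_new[OF px] beta_new[OF px] True unfolding x i by (simp_all del: tab.simps)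
      ultimately show ?thesis unfolding L R dsw by (auto simp: ket_def)
    next
      case False
      have a: "alpha qh (tab x) i = of_real (if b then A (ht u) else 1 - A (ht u))" "beta qh (tab x) i = of_real (B (ht u))"
        using alpha_new[OF px] beta_new[OF px] False unfolding x i by (simp_all del: tab.simps)
      have "swap_tab i (tab x) = tab (sw x)" using swap_new[OF False, of u] unfolding x i swx[unfolded x] by simp
      moreover have "length w = length (sw x)" using Suc.prems sw_simps(3) by (simp add: P_def)
      ultimately have s: "tab w = swap_tab i (tab x) \<longleftrightarrow> w = sw x" using tab_inj[of w "sw x"] by auto
      have ne: "sw x \<noteq> x" using x False by simp
      have c: "cf q x = q - (1 + q) * of_real (if b then A (ht u) else 1 - A (ht u))" "cb q (sw x) = - (1 + q) * of_real (B (ht u))"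
        using x False by auto
      show ?thesis unfolding L R dsw s a using c ne by (auto simp: ket_def algebra_simps)
    qed
  next
    case False
    then have i: "i < n" "1 \<le> i" using Suc.prems by auto
    obtain b w' where w: "w = b # w'" "w' \<in> P n" using Suc.prems P_SucE by blast
    obtain c u where x: "x = c # u" "u \<in> P n" using Suc.prems P_SucE by blast
    have len: "length w' = n" "length u = n" using w x by (auto simp: P_def)
    have ab: "alpha qh (tab x) i = alpha qh (tab u) i" "beta qh (tab x) i = beta qh (tab u) i"
      using alpha_beta_old[of i u c] i len unfolding x by auto
    have sw: "tab w = swap_tab i (tab x) \<longleftrightarrow> b = c \<and> tab w' = swap_tab i (tab u)"
      using swap_old(1)[of i u c] swap_old(2)[of i u] i len bounded_tab_tab[of w'] addbox_inj[of n "tab w'" "swap_tab i (tab u)" b c]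
      unfolding w(1) x(1) by auto
    have T': "tab w' \<in> adm_tableaux 2 r n" "tab u \<in> adm_tableaux 2 r n" using tab_adm w x by auto
    have weq': "tab w' = tab u \<longleftrightarrow> w' = u" using tab_inj_on[of n] w x by (auto simp: inj_on_def)
    have L': "rho_gen 2 r n qh i (tab w', tab u) = q * (if w' = u then 1 else 0)
     - (1 + q) * ((if w' = u then alpha qh (tab u) i else 0) + (if tab w' = swap_tab i (tab u) then beta qh (tab u) i else 0))"
      using T' weq' by (simp add: rho_gen_def E_mat_def idm_def q_def)
    have "gen (Suc n) i (ket x) w = (if b = c then gen n i (ket u) w' else 0)"
      using False lift_ket[OF gen_UB] Suc.prems w x by simp
    also have "\<dots> = (if b = c then rho_gen 2 r n qh i (tab w', tab u) else 0)"
      using Suc.IH[OF i(2,1) w(2) x(2)] by simp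
    also have "\<dots> = rho_gen 2 r (Suc n) qh i (tab w, tab x)"
      unfolding L L' sw ab using w x by auto
    finally show ?thesis by simp
  qed
qed

lemma mmult_tab:
  "mmult (adm_tableaux 2 r n) X Y (tab w, tab x) = (\<Sum>z\<in>P n. X (tab w, tab z) * Y (tab z, tab x))"
  unfolding mmult_def adm_eq by (simp add: sum.reindex[OF tab_inj_on])

lemma idm_tab: "w \<in> P n \<Longrightarrow> x \<in> P n \<Longrightarrow> idm (adm_tableaux 2 r n) (tab w, tab x) = (if w = x then 1 else 0)"
  using tab_inj_on[of n] tab_adm by (auto simp: idm_def inj_on_def)

lemma tmat_eqI:
  assumes "supported (adm_tableaux 2 r n) X" "supported (adm_tableaux 2 r n) Y"
    "\<And>w x. w \<in> P n \<Longrightarrow> x \<in> P n \<Longrightarrow> X (tab w, tab x) = Y (tab w, tab x)"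
  shows "X = Y"
proof
  fix p :: "tableau \<times> tableau"
  obtain s t where p: "p = (s, t)" by (cases p)
  show "X p = Y p"
  proof (cases "s \<in> adm_tableaux 2 r n \<and> t \<in> adm_tableaux 2 r n")
    case True
    then show ?thesis using assms(3) unfolding p adm_eq by auto
  next
    case False
    then have "X (s, t) = 0 \<and> Y (s, t) = 0" using assms(1,2) unfolding supported_def by blast
    then show ?thesis by (simp add: p)
  qed
qed

lemma supported_idm: "supported T (idm T)" by (auto simp: supported_def idm_def)

lemma supported_mmult: "supported T X \<Longrightarrow> supported T Y \<Longrightarrow> supported T (mmult T X Y)"
  by (auto simp: supported_def mmult_def intro!: sum.neutral)

lemma supported_rho: "supported (adm_tableaux k r n) (rho_gen k r n qh i)"
  by (auto simp: supported_def rho_gen_def E_mat_def idm_def)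

text \<open>\<open>minv\<close> is a choice. The transported inverse K shows that a suitable matrix
  exists, and being a left inverse of the generator then determines the entries of the chosen
  one.\<close>

lemma minv_rho:
  assumes "1 \<le> i" "i < n"
  shows "supported (adm_tableaux 2 r n) (minv (adm_tableaux 2 r n) (rho_gen 2 r n qh i))"
    "\<And>w x. w \<in> P n \<Longrightarrow> x \<in> P n \<Longrightarrow> minv (adm_tableaux 2 r n) (rho_gen 2 r n qh i) (tab w, tab x) = inv (gen n i) (ket x) w"
proof -
  let ?T = "adm_tableaux 2 r n" and ?R = "rho_gen 2 r n qh i" and ?g = "gen n i"
  interpret ugroup "P n" "UB n" by (rule UB_ugroup)
  have g: "?g \<in> UB n" "inv ?g \<in> UB n" using gen_UB inv_in by auto
  then have gu: "?g \<in> uop (P n)" "inv ?g \<in> uop (P n)" using UB_uop by auto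
  define K where "K = (\<lambda>(s, t). if s \<in> ?T \<and> t \<in> ?T then inv ?g (ket (inv_into (P n) tab t)) (inv_into (P n) tab s) else 0)"
  have K: "K (tab w, tab x) = inv ?g (ket x) w" if "w \<in> P n" "x \<in> P n" for w x
    using that tab_adm inv_into_f_f[OF tab_inj_on] by (simp add: K_def)
  have sK: "supported ?T K" by (auto simp: supported_def K_def)
  have pr: "(\<Sum>z\<in>P n. f (ket z) w * h (ket x) z) = (f \<circ> h) (ket x) w" if "f \<in> uop (P n)" "w \<in> P n" for f h w x
    using uop_apply[OF that(1) finite_P that(2), of "h (ket x)"] by simp
  have idl: "id (ket x) w = (if w = x then 1 else 0)" for w x :: "bool list" by (simp add: ket_def)
  have 1: "mmult ?T ?R K = idm ?T"
  proof (rule tmat_eqI)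
    fix w x assume wx: "w \<in> P n" "x \<in> P n"
    have "mmult ?T ?R K (tab w, tab x) = (\<Sum>z\<in>P n. ?g (ket z) w * inv ?g (ket x) z)"
      unfolding mmult_tab using wx by (intro sum.cong) (simp_all add: K rho_entry[OF assms])
    then show "mmult ?T ?R K (tab w, tab x) = idm ?T (tab w, tab x)"
      unfolding pr[OF gu(1) wx(1)] inv_cancel(2)[OF g(1)] idl idm_tab[OF wx] .
  qed (use supported_idm supported_mmult supported_rho sK in auto)
  have 2: "mmult ?T K ?R = idm ?T"
  proof (rule tmat_eqI)
    fix w x assume wx: "w \<in> P n" "x \<in> P n"
    have "mmult ?T K ?R (tab w, tab x) = (\<Sum>z\<in>P n. inv ?g (ket z) w * ?g (ket x) z)"
      unfolding mmult_tab using wx by (intro sum.cong) (simp_all add: K rho_entry[OF assms])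
    then show "mmult ?T K ?R (tab w, tab x) = idm ?T (tab w, tab x)"
      unfolding pr[OF gu(2) wx(1)] inv_cancel(1)[OF g(1)] idl idm_tab[OF wx] .
  qed (use supported_idm supported_mmult supported_rho sK in auto)
  have ex: "\<exists>B. supported ?T B \<and> mmult ?T ?R B = idm ?T \<and> mmult ?T B ?R = idm ?T" using sK 1 2 by blast
  have M: "supported ?T (minv ?T ?R)" "mmult ?T (minv ?T ?R) ?R = idm ?T"
    using someI_ex[OF ex] unfolding minv_def by auto
  show "supported ?T (minv ?T ?R)" by (rule M)
  fix w x assume wx: "w \<in> P n" "x \<in> P n"
  let ?m = "\<lambda>w x. minv ?T ?R (tab w, tab x)"
  have "mop (P n) ?m \<circ> ?g = id"
  proof -
    have e: "?g = mop (P n) (\<lambda>w x. ?g (ket x) w)" using uop_eq_mop[OF gu(1) finite_P] .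
    have "mop (P n) ?m \<circ> mop (P n) (\<lambda>w x. ?g (ket x) w) = mop (P n) (\<lambda>w x. if w = x then 1 else 0)"
      unfolding mop_comp
    proof (rule mop_cong)
      fix w x assume wx: "w \<in> P n" "x \<in> P n"
      have "(\<Sum>z\<in>P n. ?m w z * ?g (ket x) z) = mmult ?T (minv ?T ?R) ?R (tab w, tab x)"
        unfolding mmult_tab using wx by (intro sum.cong) (simp_all add: rho_entry[OF assms])
      then show "(\<Sum>z\<in>P n. ?m w z * ?g (ket x) z) = (if w = x then 1 else 0)"
        unfolding M(2) idm_tab[OF wx] .
    qed
    then show ?thesis unfolding mop_one[OF finite_P] using e by simp
  qed
  then have "mop (P n) ?m \<circ> (?g \<circ> inv ?g) = inv ?g" by (simp add: comp_assoc[symmetric])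
  then have "mop (P n) ?m = inv ?g" using inv_cancel(2)[OF g(1)] by simp
  then show "?m w x = inv ?g (ket x) w" using mop_ket[OF finite_P wx, of ?m] by simp
qed

lemma Gam_jones_image:
  assumes "f \<in> Gam n"
  shows "\<exists>Y\<in>jones_image 2 r n qh. supported (adm_tableaux 2 r n) Y \<and> (\<forall>w\<in>P n. \<forall>x\<in>P n. Y (tab w, tab x) = f (ket x) w)"
  using assms
proof (induction rule: Gam.induct)
  case one
  show ?case
    by (rule bexI[OF _ jones_image.one]) (auto simp: supported_idm idm_tab ket_def)
next
  case (mul f i)
  then obtain Y where Y: "Y \<in> jones_image 2 r n qh" "supported (adm_tableaux 2 r n) Y"
    "\<forall>w\<in>P n. \<forall>x\<in>P n. Y (tab w, tab x) = f (ket x) w" by blast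
  have gu: "gen n i \<in> uop (P n)" using gen_UB UB_uop by blast
  have "mmult (adm_tableaux 2 r n) (rho_gen 2 r n qh i) Y \<in> jones_image 2 r n qh"
    using mul Y by (intro jones_image.gen) auto
  moreover have "mmult (adm_tableaux 2 r n) (rho_gen 2 r n qh i) Y (tab w, tab x) = (gen n i \<circ> f) (ket x) w"
    if wx: "w \<in> P n" "x \<in> P n" for w x
  proof -
    have "mmult (adm_tableaux 2 r n) (rho_gen 2 r n qh i) Y (tab w, tab x) = (\<Sum>z\<in>P n. gen n i (ket z) w * f (ket x) z)"
      unfolding mmult_tab using wx Y mul by (intro sum.cong) (simp_all add: rho_entry[OF mul.hyps(2,3)])
    then show ?thesis using uop_apply[OF gu finite_P wx(1), of "f (ket x)"] by simp
  qed
  moreover have "supported (adm_tableaux 2 r n) (mmult (adm_tableaux 2 r n) (rho_gen 2 r n qh i) Y)"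
    using supported_mmult supported_rho Y by blast
  ultimately show ?case by blast
next
  case (mul_inv f i)
  then obtain Y where Y: "Y \<in> jones_image 2 r n qh" "supported (adm_tableaux 2 r n) Y"
    "\<forall>w\<in>P n. \<forall>x\<in>P n. Y (tab w, tab x) = f (ket x) w" by blast
  interpret ugroup "P n" "UB n" by (rule UB_ugroup)
  have gu: "inv (gen n i) \<in> uop (P n)" using gen_UB UB_uop inv_in by blast
  let ?m = "minv (adm_tableaux 2 r n) (rho_gen 2 r n qh i)"
  have "mmult (adm_tableaux 2 r n) ?m Y \<in> jones_image 2 r n qh"
    using mul_inv Y by (intro jones_image.gen_inv) auto
  moreover have "mmult (adm_tableaux 2 r n) ?m Y (tab w, tab x) = (inv (gen n i) \<circ> f) (ket x) w"
    if wx: "w \<in> P n" "x \<in> P n" for w x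
  proof -
    have "mmult (adm_tableaux 2 r n) ?m Y (tab w, tab x) = (\<Sum>z\<in>P n. inv (gen n i) (ket z) w * f (ket x) z)"
      unfolding mmult_tab using wx Y mul_inv by (intro sum.cong) (simp_all add: minv_rho(2)[OF mul_inv.hyps(2,3)])
    then show ?thesis using uop_apply[OF gu finite_P wx(1), of "f (ket x)"] by simp
  qed
  moreover have "supported (adm_tableaux 2 r n) (mmult (adm_tableaux 2 r n) ?m Y)"
    using supported_mmult minv_rho(1) Y mul_inv by blast
  ultimately show ?case by blast
qed

lemma fst_tab_ht: "w \<in> P n \<Longrightarrow> x \<in> P n \<Longrightarrow> fst (tab w) = fst (tab x) \<longleftrightarrow> ht w = ht x"
  using length_count[of w] length_count[of x] by (auto simp: fst_tab ht_count P_def)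

theorem density:
  assumes full: "\<And>h. full n h"
  shows "prod_SU 2 r n \<subseteq> closure (jones_image 2 r n qh)"
proof
  fix X assume X: "X \<in> prod_SU 2 r n"
  let ?T = "adm_tableaux 2 r n"
  have sX: "supported ?T X" and "\<forall>a b. X (a, b) \<noteq> 0 \<longrightarrow> fst a = fst b"
    and uX: "\<And>lam. unitary_on {t \<in> ?T. fst t = lam} X" "\<And>lam. det_on {t \<in> ?T. fst t = lam} X = 1"
    using X unfolding prod_SU_def Let_def by blast+
  then have bX: "\<And>a b. X (a, b) \<noteq> 0 \<Longrightarrow> fst a = fst b" by blast
  interpret ugroup "P n" "G n" by (rule G_ugroup)
  define M where "M w x = X (tab w, tab x)" for w x
  define S where "S h = {w \<in> P n. ht w = h}" for h
  have M0: "M w x = 0" if "w \<in> P n" "x \<in> P n" "ht w \<noteq> ht x" for w x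
    using that bX[of "tab w" "tab x"] fst_tab_ht[of w n x] by (auto simp: M_def)
  have fS: "finite (S h)" for h using finite_P by (simp add: S_def)
  have sec: "mop (S h) M \<in> G n" for h
  proof (cases "S h = {}")
    case True
    then have "mop (S h) M = id" by (auto simp: mop_def fun_eq_iff)
    then show ?thesis using id_in by (simp only:)
  next
    case False
    then obtain w0 where w0: "w0 \<in> P n" "ht w0 = h" by (auto simp: S_def)
    \<comment> \<open>For fixed n a two-row shape is determined by its height, so the tableaux of
      one shape are the image of one sector.\<close>
    have im: "{t \<in> ?T. fst t = fst (tab w0)} = tab ` S h"
      unfolding adm_eq S_def using fst_tab_ht[OF _ w0(1)] w0(2) by auto
    have inj: "inj_on tab (S h)" using tab_inj_on[of n] by (rule inj_on_subset) (auto simp: S_def)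
    have "orthcols (S h) M" unfolding orthcols_def
    proof (intro ballI)
      fix a c assume ac: "a \<in> S h" "c \<in> S h"
      have "(\<Sum>b\<in>tab ` S h. cnj (X (b, tab a)) * X (b, tab c)) = (if tab a = tab c then 1 else 0)"
        using uX(1)[of "fst (tab w0)"] ac unfolding im unitary_on_def by blast
      moreover have "tab a = tab c \<longleftrightarrow> a = c" using inj ac by (auto simp: inj_on_def)
      ultimately show "(\<Sum>b\<in>S h. cnj (M b a) * M b c) = (if a = c then 1 else 0)"
        by (simp add: sum.reindex[OF inj] M_def)
    qed
    moreover have "det_sum (S h) M = 1"
      using uX(2)[of "fst (tab w0)"] det_on_det_sum[OF fS inj, of X] unfolding im M_def[abs_def] by simp
    moreover have "plG (G n) a b" if "a \<in> S h" "b \<in> S h" "a \<noteq> b" for a b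
      using full[of h] that unfolding full_def S_def by auto
    ultimately show ?thesis by (intro SU_in_group[OF fS]) (auto simp: S_def)
  qed
  have "mop (\<Union>h\<in>H. S h) M \<in> G n" if "finite H" for H
    using that
  proof (induction H rule: finite_induct)
    case empty
    have 1: "mop {} M = id" by (auto simp: mop_def fun_eq_iff)
    have 2: "(\<Union>h\<in>{}. S h) = {}" by simp
    show ?case unfolding 2 1 by (rule id_in)
  next
    case (insert h H)
    have "mop (S h \<union> (\<Union>h\<in>H. S h)) M = mop (S h) M \<circ> mop (\<Union>h\<in>H. S h) M"
      using insert.hyps fS by (intro mop_union) (auto simp: S_def intro!: M0)
    moreover have "(\<Union>h\<in>insert h H. S h) = S h \<union> (\<Union>h\<in>H. S h)" by simp
    ultimately show ?case using comp_in[OF sec insert.IH] by (simp only:)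
  qed
  moreover have "P n = (\<Union>h\<in>ht ` P n. S h)" by (auto simp: S_def)
  ultimately have MG: "mop (P n) M \<in> G n" using finite_P by (metis finite_imageI)
  show "X \<in> closure (jones_image 2 r n qh)"
  proof (rule closure_pointwise)
    fix e :: real assume e: "e > 0"
    obtain g where g: "g \<in> Gam n" "\<And>w x. w \<in> P n \<Longrightarrow> x \<in> P n \<Longrightarrow> cmod (mop (P n) M (ket x) w - g (ket x) w) < e"
      using MG e unfolding G_def uclosure_def by blast
    obtain Y where Y: "Y \<in> jones_image 2 r n qh" "supported ?T Y" "\<forall>w\<in>P n. \<forall>x\<in>P n. Y (tab w, tab x) = g (ket x) w"
      using Gam_jones_image[OF g(1)] by blast
    have "dist (X p) (Y p) < e" for p
    proof (cases "fst p \<in> ?T \<and> snd p \<in> ?T")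
      case True
      then obtain w x where p: "p = (tab w, tab x)" "w \<in> P n" "x \<in> P n" unfolding adm_eq by (cases p) auto
      then show ?thesis using g(2)[of w x] Y(3) mop_ket[OF finite_P, of w n x M] by (simp add: dist_norm M_def)
    next
      case False
      then have "X p = 0" "Y p = 0" using sX Y(2) unfolding supported_def by (cases p; auto)+
      then show ?thesis using e by simp
    qed
    then show "\<exists>Y\<in>jones_image 2 r n qh. \<forall>i. dist (X i) (Y i) < e" using Y(1) by blast
  qed
qed

end

section \<open>Roots of unity\<close>

text \<open>The distance of \<open>cis \<phi>\<close> from 1 is
  \<open>2 * sin (\<bar>\<phi>\<bar> / 2)\<close> in this range, which reaches 1 at pi / 3.\<close>

lemma cis_small_angle:
  assumes "0 < \<bar>\<phi>\<bar>" "\<bar>\<phi>\<bar> < pi / 3"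
  shows "cis \<phi> \<noteq> 1" "cmod (cis \<phi> - 1) < 1"
proof -
  have r: "0 < \<bar>\<phi>\<bar> / 2" "\<bar>\<phi>\<bar> / 2 < pi / 6" using assms by auto
  have "\<bar>sin (\<phi> / 2)\<bar> = sin (\<bar>\<phi>\<bar> / 2)"
  proof -
    have "0 \<le> sin (\<bar>\<phi>\<bar> / 2)" using r pi_gt_zero by (intro sin_ge_zero) auto
    then show ?thesis by (cases "\<phi> \<ge> 0") auto
  qed
  moreover have "0 < sin (\<bar>\<phi>\<bar> / 2)" using r pi_gt_zero by (intro sin_gt_zero) auto
  moreover have "sin (\<bar>\<phi>\<bar> / 2) < sin (pi / 6)" using r pi_gt_zero by (intro sin_monotone_2pi) auto
  ultimately have *: "0 < cmod (cis \<phi> - 1)" "cmod (cis \<phi> - 1) < 1" by (simp_all add: cmod_cis_m1 sin_30)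
  then show "cis \<phi> \<noteq> 1" "cmod (cis \<phi> - 1) < 1" by auto
qed

context
  fixes r :: nat and s :: real
  assumes r5: "r \<ge> 5" and s: "s = 1 \<or> s = - 1"
begin

definition "th = pi / real r"

lemma th: "0 < th" "real r * th = pi" "th < pi / 3" "4 * th < pi"
  using r5 pi_gt_zero by (auto simp: th_def field_simps)

text \<open>The sign s changes numerator and denominator alike, so the quantum integers agree for
  both choices of q.\<close>

lemma qint_sin: "qint (cis (s * th)) m = of_real (sin (of_int m * th) / sin th)"
proof -
  have "sin th > 0" using th by (intro sin_gt_zero) auto
  have d: "cis t - cis (- t) = 2 * \<i> * of_real (sin t)" for t by (simp add: complex_eq_iff)
  have p: "cis t powi m = cis (of_int m * t)" for t m by (simp add: Complex.cis_power_int)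
  have "qint (cis (s * th)) m = (2 * \<i> * of_real (sin (of_int m * (s * th)))) / (2 * \<i> * of_real (sin (s * th)))"
    unfolding qint_def p cis_inverse d[symmetric] by (simp add: mult.commute)
  also have "\<dots> = of_real (sin (of_int m * (s * th)) / sin (s * th))" by simp
  also have "sin (of_int m * (s * th)) / sin (s * th) = sin (of_int m * th) / sin th"
    using s by auto
  finally show ?thesis .
qed

text \<open>In quantum integers this is [h] / ([2] [h + 1]).\<close>

definition "Af h = sin (of_int h * th) / (2 * cos th * sin (of_int (h + 1) * th))"

text \<open>The second part is [h] + [h + 2] = [2] [h + 1], an addition theorem for the
  sine.\<close>

lemma Af_pos:
  assumes "0 \<le> h" "h \<le> int r - 2"
  shows "0 < sin (of_int (h + 1) * th)" "1 - Af h = sin (of_int (h + 2) * th) / (2 * cos th * sin (of_int (h + 1) * th))"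
proof -
  have "of_int (h + 1) * th < real r * th" using assms th by (intro mult_strict_right_mono) linarith+
  then show p: "0 < sin (of_int (h + 1) * th)" using assms th by (intro sin_gt_zero) auto
  have c: "cos th > 0" using th pi_gt_zero by (intro cos_gt_zero) auto
  have "sin (of_int h * th) + sin (of_int (h + 2) * th) = 2 * cos th * sin (of_int (h + 1) * th)"
  proof -
    have "of_int h * th = of_int (h + 1) * th - th" "of_int (h + 2) * th = of_int (h + 1) * th + th"
      by (simp_all add: algebra_simps)
    then show ?thesis by (simp only: sin_diff sin_add) (simp add: algebra_simps)
  qed
  then have "sin (of_int (h + 2) * th) = 2 * cos th * sin (of_int (h + 1) * th) - sin (of_int h * th)" by simp
  then show "1 - Af h = sin (of_int (h + 2) * th) / (2 * cos th * sin (of_int (h + 1) * th))"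
    unfolding Af_def using p c by (simp add: field_simps)
qed

lemma jones_rep_cis: "jones_rep r ((cis (s * th))\<^sup>2) Af (cis (s * th))"
proof
  have c: "cos th > 0" using th pi_gt_zero by (intro cos_gt_zero) auto
  have sn: "sin th > 0" using th by (intro sin_gt_zero) auto
  have s2: "sin (2 * th) > 0" using th by (intro sin_gt_zero) auto
  have q: "(cis (s * th))\<^sup>2 = cis (2 * (s * th))" by (simp add: power2_eq_square cis_mult)
  have dbl: "sin (2 * th) = 2 * cos th * sin th" by (simp add: sin_double)
  show "5 \<le> r" by (rule r5)
  show "cmod ((cis (s * th))\<^sup>2) = 1" by (simp add: norm_power)
  show "Im ((cis (s * th))\<^sup>2) \<noteq> 0" unfolding q using s s2 by auto
  show "Af 0 = 0" by (simp add: Af_def)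
  \<comment> \<open>At the upper wall [r - 2] = [2] and [r - 1] = [1].\<close>
  show "Af (int r - 2) = 1"
  proof -
    have "of_int (int r - 2) * th = pi - 2 * th" "of_int (int r - 2 + 1) * th = pi - th"
      using th(2) by (simp_all add: algebra_simps)
    then show ?thesis unfolding Af_def using c sn by (simp add: dbl)
  qed
  show "0 < Af h \<and> Af h < 1" if h: "0 < h" "h < int r - 2" for h
  proof -
    have "of_int h * th < real r * th" "of_int (h + 2) * th < real r * th"
      using h th by (intro mult_strict_right_mono; linarith)+
    then have "0 < sin (of_int h * th)" "0 < sin (of_int (h + 2) * th)" using h th by (auto intro!: sin_gt_zero)
    moreover have "0 < sin (of_int (h + 1) * th)" using Af_pos(1)[of h] h by simp
    ultimately have "0 < Af h" "0 < 1 - Af h" using Af_pos(2)[of h] h c by (auto simp: Af_def)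
    then show ?thesis by simp
  qed
  show "(1 + (cis (s * th))\<^sup>2)\<^sup>2 * of_real (Af 1) = (cis (s * th))\<^sup>2"
  proof -
    have "1 + (cis (s * th))\<^sup>2 = cis (s * th) * (cis (- (s * th)) + cis (s * th))"
      by (simp add: distrib_left cis_mult power2_eq_square)
    also have "cis (- (s * th)) + cis (s * th) = of_real (2 * cos th)" using s by (auto simp: complex_eq_iff)
    finally have "(1 + (cis (s * th))\<^sup>2)\<^sup>2 = (cis (s * th))\<^sup>2 * of_real ((2 * cos th)\<^sup>2)"
      by (simp add: power_mult_distrib)
    then have "(1 + (cis (s * th))\<^sup>2)\<^sup>2 * of_real (Af 1) = (cis (s * th))\<^sup>2 * of_real ((2 * cos th)\<^sup>2 * Af 1)"
      by (simp only: of_real_mult mult.assoc)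
    also have "(2 * cos th)\<^sup>2 * Af 1 = 1" using c sn by (simp add: Af_def dbl power2_eq_square)
    finally show ?thesis by simp
  qed
  show "(cis (s * th))\<^sup>2 = (cis (s * th))\<^sup>2" ..
  show "qint (cis (s * th)) 0 = 0" by (simp add: qint_sin)
  have q2: "qint (cis (s * th)) 2 = of_real (2 * cos th)" using sn by (simp add: qint_sin dbl)
  show "qint (cis (s * th)) (- h) / (qint (cis (s * th)) 2 * qint (cis (s * th)) (- (h + 1))) = of_real (Af h)" for h
  proof -
    have "qint (cis (s * th)) (- h) / (qint (cis (s * th)) 2 * qint (cis (s * th)) (- (h + 1))) =
       of_real ((sin (of_int (- h) * th) / sin th) / ((2 * cos th) * (sin (of_int (- (h + 1)) * th) / sin th)))"
      unfolding q2 unfolding qint_sin by (simp only: of_real_mult of_real_divide)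
    also have "(sin (of_int (- h) * th) / sin th) / ((2 * cos th) * (sin (of_int (- (h + 1)) * th) / sin th)) = Af h"
    proof -
      have "of_int (- h) * th = - (of_int h * th)" "of_int (- (h + 1)) * th = - (of_int (h + 1) * th)"
        by (simp_all add: algebra_simps)
      then have "sin (of_int (- h) * th) = - sin (of_int h * th)" "sin (of_int (- (h + 1)) * th) = - sin (of_int (h + 1) * th)"
        by (simp_all only: sin_minus)
      then show ?thesis unfolding Af_def using sn by (simp add: field_simps)
    qed
    finally show ?thesis .
  qed
  show "qint (cis (s * th)) (h + 2) / (qint (cis (s * th)) 2 * qint (cis (s * th)) (h + 1)) = of_real (1 - Af h)"
    if "0 \<le> h" "h \<le> int r - 2" for h
  proof -
    have "qint (cis (s * th)) (h + 2) / (qint (cis (s * th)) 2 * qint (cis (s * th)) (h + 1)) =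
      of_real ((sin (of_int (h + 2) * th) / sin th) / ((2 * cos th) * (sin (of_int (h + 1) * th) / sin th)))"
      unfolding q2 unfolding qint_sin by (simp only: of_real_mult of_real_divide)
    then show ?thesis unfolding Af_pos(2)[OF that] using sn by simp
  qed
qed

text \<open>For odd k the angle is (r - 2 k) pi / r up to sign; an odd k next to r / 2 gives pi / r
  for odd r and 2 pi / r for r divisible by 4. If r is 2 modulo 4, the order is r / 2 and the
  smallest angle 4 pi / r, reached at k = 2, is below pi / 3 only for r > 12.\<close>

lemma small_power:
  assumes "r \<noteq> 6" "r \<noteq> 10"
  shows "\<exists>k. (- cnj ((cis (s * th))\<^sup>2)) ^ k \<noteq> 1 \<and> cmod ((- cnj ((cis (s * th))\<^sup>2)) ^ k - 1) < 1"
proof -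
  have pw: "(- cnj ((cis (s * th))\<^sup>2)) ^ k = (- 1) ^ k * cis (- (s * (2 * real k * th)))" for k
  proof -
    have "cnj ((cis (s * th))\<^sup>2) = cis (- (2 * (s * th)))" by (simp add: power2_eq_square cis_mult cis_cnj)
    then have "(- cnj ((cis (s * th))\<^sup>2)) ^ k = (- 1) ^ k * cis (- (2 * (s * th))) ^ k"
      by (simp only: power_minus[of "cis _"])
    also have "cis (- (2 * (s * th))) ^ k = cis (real k * - (2 * (s * th)))" by (rule Complex.DeMoivre)
    finally show ?thesis by (simp add: algebra_simps)
  qed
  have odd_case: "(- cnj ((cis (s * th))\<^sup>2)) ^ k = cis (- (s * (2 * real k - real r) * th))" if "odd k" for k
  proof -
    \<comment> \<open>For odd k the sign is \<open>cis (s * pi)\<close>, and pi is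
      \<open>real r * th\<close>.\<close>
    have "(- 1) ^ k * cis (- (s * (2 * real k * th))) = cis (s * (real r * th)) * cis (- (s * (2 * real k * th)))"
      using that s unfolding th(2) by (auto simp: complex_eq_iff)
    also have "\<dots> = cis (- (s * (2 * real k - real r) * th))" by (simp add: cis_mult algebra_simps)
    finally show ?thesis unfolding pw .
  qed
  have fin: "\<exists>k. (- cnj ((cis (s * th))\<^sup>2)) ^ k \<noteq> 1 \<and> cmod ((- cnj ((cis (s * th))\<^sup>2)) ^ k - 1) < 1"
    if "(- cnj ((cis (s * th))\<^sup>2)) ^ k = cis (- (s * e * th))" "e \<noteq> 0" "\<bar>e\<bar> * th < pi / 3" for k and e :: real
  proof -
    have "\<bar>- (s * e * th)\<bar> = \<bar>e\<bar> * th" using s th by (auto simp: abs_mult)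
    then have "0 < \<bar>- (s * e * th)\<bar>" "\<bar>- (s * e * th)\<bar> < pi / 3" using that th by auto
    from cis_small_angle[OF this] show ?thesis unfolding that(1)[symmetric] by blast
  qed
  have "odd r \<or> (\<exists>m. r = 4 * m) \<or> (\<exists>m. r = 4 * m + 2)" by presburger
  then consider "odd r" | m where "r = 4 * m" | m where "r = 4 * m + 2" by blast
  then show ?thesis
  proof cases
    case 1
    then obtain m where m: "r = 2 * m + 1" by (elim oddE)
    show ?thesis
    proof (cases "odd m")
      case True
      show ?thesis by (rule fin[OF odd_case[OF True]]) (use m th in \<open>auto simp: abs_mult\<close>)
    next
      case False
      then have "odd (m + 1)" by simp
      show ?thesis by (rule fin[OF odd_case[OF \<open>odd (m + 1)\<close>]]) (use m th in \<open>auto simp: abs_mult\<close>)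
    qed
  next
    case (2 m)
    then have "odd (2 * m - 1)" using r5 by (cases m) auto
    moreover have "2 * real (2 * m - 1) - real r = - 2" using 2 r5 by (cases m) auto
    moreover have "2 * th < pi / 3"
    proof -
      have "8 \<le> r" using 2 r5 by presburger
      then have "8 * th \<le> real r * th" using th(1) by (intro mult_right_mono) auto
      then show ?thesis using th(2) pi_gt_zero by linarith
    qed
    ultimately show ?thesis using fin[OF odd_case[of "2 * m - 1"]] by simp
  next
    case (3 m)
    then have "r \<ge> 14" using assms r5 by presburger
    then have "14 * th \<le> real r * th" using th(1) by (intro mult_right_mono) auto
    then have "4 * th < pi / 3" using th(2) pi_gt_zero by linarith
    moreover have "(- cnj ((cis (s * th))\<^sup>2)) ^ 2 = cis (- (s * 4 * th))" unfolding pw by (simp add: mult.assoc)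
    ultimately show ?thesis using fin[of 2 4] by simp
  qed
qed

text \<open>Since q has order 10, the exponent 21 gives q itself, with angle pi / 5; the factor 3
  comes from the eigenvalue \<open>q ^ 3\<close> of the full twist.\<close>

lemma small_power_10:
  assumes "r = 10"
  shows "((cis (s * th))\<^sup>2) ^ (3 * 7) \<noteq> 1" "cmod (((cis (s * th))\<^sup>2) ^ (3 * 7) - 1) < 1"
proof -
  have "((cis (s * th))\<^sup>2) ^ (3 * 7) = cis (real (2 * (3 * 7)) * (s * th))"
    unfolding power_mult[symmetric] by (rule Complex.DeMoivre)
  also have "real (2 * (3 * 7)) * (s * th) = s * (2 * th) + 4 * (s * (real r * th))" using assms by simp
  also have "\<dots> = s * (2 * th) + 4 * (s * pi)" unfolding th(2) ..
  also have "cis \<dots> = cis (s * (2 * th)) * cis (4 * (s * pi))" by (simp add: cis_mult)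
  also have "cis (4 * (s * pi)) = 1"
  proof -
    have "cis (4 * pi) = 1" using cis_multiple_2pi[of 2] by simp
    then show ?thesis using s cis_cnj[of "4 * pi"] by auto
  qed
  finally have e: "((cis (s * th))\<^sup>2) ^ (3 * 7) = cis (s * (2 * th))" by simp
  have "0 < \<bar>s * (2 * th)\<bar>" "\<bar>s * (2 * th)\<bar> < pi / 3"
    using s th(1,2) assms pi_gt_zero by (auto simp: abs_mult)
  then show "((cis (s * th))\<^sup>2) ^ (3 * 7) \<noteq> 1" "cmod (((cis (s * th))\<^sup>2) ^ (3 * 7) - 1) < 1"
    unfolding e by (rule cis_small_angle)+
qed

lemma density_cis:
  assumes "(r \<noteq> 6 \<and> r \<noteq> 10 \<and> n \<ge> 3) \<or> (r = 10 \<and> n \<ge> 5)"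
  shows "prod_SU 2 r n \<subseteq> closure (jones_image 2 r n (cis (s * th)))"
proof -
  interpret jones_rep r "(cis (s * th))\<^sup>2" Af "cis (s * th)" by (rule jones_rep_cis)
  show ?thesis
  proof (rule density)
    fix h
    show "full n h"
    proof (cases "r = 10")
      case True
      then show ?thesis using full_all[of 4 n h] full_4[OF small_power_10[OF True]] assms by simp
    next
      case False
      obtain k where k: "(- cnj ((cis (s * th))\<^sup>2)) ^ k \<noteq> 1" "cmod ((- cnj ((cis (s * th))\<^sup>2)) ^ k - 1) < 1"
        using small_power assms False by blast
      show ?thesis using full_all[of 3 n h] full_3[OF k] assms False by (cases "n = 3") auto
    qed
  qed
qed

end

theorem theorem0p1:
  fixes r n :: nat and qh :: complex
  assumes "(r \<ge> 5 \<and> r \<noteq> 6 \<and> r \<noteq> 10 \<and> n \<ge> 3) \<or> (r = 10 \<and> n \<ge> 5)"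
    and "qh = exp (\<i> * of_real (pi / real r)) \<or> qh = exp (- (\<i> * of_real (pi / real r)))"
  shows "prod_SU 2 r n \<subseteq> closure (jones_image 2 r n qh)"
proof -
  have r: "r \<ge> 5" using assms(1) by auto
  obtain s :: real where s: "s = 1 \<or> s = - 1" "qh = cis (s * (pi / real r))"
  proof (cases "qh = exp (\<i> * of_real (pi / real r))")
    case True
    then show ?thesis using that[of 1] by (simp add: cis_conv_exp)
  next
    case False
    then have "qh = exp (- (\<i> * of_real (pi / real r)))" using assms(2) by blast
    then show ?thesis using that[of "- 1"] by (simp add: cis_conv_exp)
  qed
  show ?thesis using density_cis[OF r s(1), of n] assms(1) unfolding s(2) th_def[OF r s(1)] by auto
qed

end
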